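(* Let $J:\mathbb{R}^N\to[0,+\infty)$ be measurable, radially symmetric, with $\int_{\mathbb{R}^N}J(x)\,dx=1$, and assume $J$ is radially non-increasing. Let $\Omega$ be a bounded measurable subset of $\mathbb{R}^N$. Then: 1. $\mathbb{Q}_\Omega^{m^J}(t)\le\mathbb{Q}_{\Omega^*}^{m^J}(t)$ for all $t\ge0$. 2. $T_{m^J}(\Omega)\le T_{m^J}(\Omega^* )$. 3. $EM_j^{m^J}(\Omega)\le EM_j^{m^J}(\Omega^* )$ for all integers $j\ge1$.
   Context: "Radially non-increasing" means that $J(x)$ is a non-increasing function of $|x|$. $\Omega^*$ is the ball centered at the origin with $|\Omega^*|=|\Omega|$, where $|\cdot|$ is Lebesgue measure. The random walk $m^J$ on $\mathbb{R}^N$ is $m^J_x(A)=\int_A J(x-y)\,dy$, for which Lebesgue measure is reversible. For a bounded measurable $D\subset\mathbb{R}^N$, write $m=m^J$, $\partial_mD:=\{x\in\mathbb{R}^N\setminus D:m_x(D)>0\}$ and $D_m:=D\cup\partial_mD$. All equations below are understood for a.e. $x$. - $T_{m^J}(D):=\int_D f_D(x)\,dx$, where $f_D\in L^2(D_m)$ is the unique solution of $-\int_{D_m}J(x-y)(f_D(y)-f_D(x))\,dy=1$ for $x\in D$, $f_D(x)=0$ for $x\in\partial_mD$. - $\mathbb{Q}_D^{m^J}(t):=\int_D v(t,x)\,dx$, where $v$ is the solution of $\frac{dv}{dt}(t,x)=\int_{D_m}J(x-y)(v(t,y)-v(t,x))\,dy$ for $(t,x)\in(0,\infty)\times D$, $v(t,x)=0$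 for $(t,x)\in(0,\infty)\times\partial_mD$, $v(0,x)=1$ for $x\in D$ (with $v(t,\cdot)\in L^2(D_m)$). - $EM_j^{m^J}(D):=j\int_0^{+\infty}t^{j-1}\mathbb{Q}_D^{m^J}(t)\,dt$. *)

theory Defs
  imports "HOL-Analysis.Analysis"
begin

definition radially_symmetric :: "(real^'n \<Rightarrow> real) \<Rightarrow> bool" where
  "radially_symmetric J \<longleftrightarrow> (\<forall>x y. norm x = norm y \<longrightarrow> J x = J y)"

definition radially_nonincreasing :: "(real^'n \<Rightarrow> real) \<Rightarrow> bool" where
  "radially_nonincreasing J \<longleftrightarrow> (\<forall>x y. norm x \<le> norm y \<longrightarrow> J y \<le> J x)"

text \<open>The ball is open; it is empty when \<open>\<Omega>\<close> is a null set. Intended for sets of finite measure.\<close>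

definition sym_ball :: "(real^'n) set \<Rightarrow> (real^'n) set" where
  "sym_ball \<Omega> =
     ball 0 (THE r. 0 \<le> r \<and> emeasure lebesgue (ball (0::real^'n) r) = emeasure lebesgue \<Omega>)"

definition rwalk :: "(real^'n \<Rightarrow> real) \<Rightarrow> real^'n \<Rightarrow> (real^'n) measure" where
  "rwalk J x = density lebesgue (\<lambda>y. ennreal (J (x - y)))"

definition m_boundary :: "(real^'n \<Rightarrow> real) \<Rightarrow> (real^'n) set \<Rightarrow> (real^'n) set" where
  "m_boundary J D = {x. x \<notin> D \<and> emeasure (rwalk J x) D > 0}"

definition m_closure :: "(real^'n \<Rightarrow> real) \<Rightarrow> (real^'n) set \<Rightarrow> (real^'n) set" where
  "m_closure J D = D \<union> m_boundary J D"

text \<open>Elements of \<open>L\<^sup>2(S)\<close> are represented by functions on the whole space; only their restriction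
  to \<open>S\<close> matters.\<close>

definition L2_on :: "(real^'n) set \<Rightarrow> (real^'n \<Rightarrow> real) set" where
  "L2_on S = {f. f \<in> borel_measurable (lebesgue_on S) \<and>
                 integrable (lebesgue_on S) (\<lambda>x. (f x)\<^sup>2)}"

definition tendsto_L2_on ::
  "(real^'n) set \<Rightarrow> ('b \<Rightarrow> real^'n \<Rightarrow> real) \<Rightarrow> (real^'n \<Rightarrow> real) \<Rightarrow> 'b filter \<Rightarrow> bool" where
  "tendsto_L2_on S u g F \<longleftrightarrow>
     ((\<lambda>s. \<integral>\<^sup>+x\<in>S. ennreal ((u s x - g x)\<^sup>2) \<partial>lebesgue) \<longlongrightarrow> 0) F"

definition nonlocal_laplacian ::
  "(real^'n \<Rightarrow> real) \<Rightarrow> (real^'n) set \<Rightarrow> (real^'n \<Rightarrow> real) \<Rightarrow> real^'n \<Rightarrow> real" where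
  "nonlocal_laplacian J D f x = (LINT y:m_closure J D|lebesgue. J (x - y) * (f y - f x))"

definition torsion_solution ::
  "(real^'n \<Rightarrow> real) \<Rightarrow> (real^'n) set \<Rightarrow> (real^'n \<Rightarrow> real) \<Rightarrow> bool" where
  "torsion_solution J D f \<longleftrightarrow>
     f \<in> L2_on (m_closure J D) \<and>
     (AE x in lebesgue. x \<in> D \<longrightarrow> - nonlocal_laplacian J D f x = 1) \<and>
     (AE x in lebesgue. x \<in> m_boundary J D \<longrightarrow> f x = 0)"

text \<open>Solutions of the torsion problem, and below of the heat problem, are unique only up to null
  sets, so a representative is chosen; the integrals do not depend on the choice.\<close>

definition torsional_rigidity :: "(real^'n \<Rightarrow> real) \<Rightarrow> (real^'n) set \<Rightarrow> real" where
  "torsional_rigidity J D = (LINT x:D|lebesgue. (SOME f. torsion_solution J D f) x)"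

text \<open>The time derivative is that of the \<open>L\<^sup>2(D)\<close>-valued map \<open>t \<mapsto> v t\<close>, so the equation holds for
  almost every \<open>x \<in> D\<close> at every \<open>t > 0\<close>; the initial value is attained continuously in \<open>L\<^sup>2(D)\<close>.\<close>

definition heat_solution ::
  "(real^'n \<Rightarrow> real) \<Rightarrow> (real^'n) set \<Rightarrow> (real \<Rightarrow> real^'n \<Rightarrow> real) \<Rightarrow> bool" where
  "heat_solution J D v \<longleftrightarrow>
     (\<forall>t\<ge>0. v t \<in> L2_on (m_closure J D)) \<and>
     (\<forall>t>0. tendsto_L2_on D (\<lambda>s x. (v s x - v t x) / (s - t))
               (nonlocal_laplacian J D (v t)) (at t)) \<and>
     (\<forall>t>0. AE x in lebesgue. x \<in> m_boundary J D \<longrightarrow> v t x = 0) \<and>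
     (AE x in lebesgue. x \<in> D \<longrightarrow> v 0 x = 1) \<and>
     tendsto_L2_on D v (v 0) (at_right 0)"

definition heat_content :: "(real^'n \<Rightarrow> real) \<Rightarrow> (real^'n) set \<Rightarrow> real \<Rightarrow> real" where
  "heat_content J D t = (LINT x:D|lebesgue. (SOME v. heat_solution J D v) t x)"

text \<open>The integrand is nonnegative, so the moment is taken in \<open>[0, \<infinity>]\<close>.\<close>

definition exit_moment :: "nat \<Rightarrow> (real^'n \<Rightarrow> real) \<Rightarrow> (real^'n) set \<Rightarrow> ennreal" where
  "exit_moment j J D =
     of_nat j * (\<integral>\<^sup>+t\<in>{0..}. ennreal (t ^ (j - 1) * heat_content J D t) \<partial>lborel)"

end

theory Submission
  imports Defs "HOL-Complex_Analysis.Great_Picard"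
begin

text \<open>Write \<open>P\<^sub>n(f) = \<integral> f(x\<^sub>0) J(x\<^sub>0 - x\<^sub>1) f(x\<^sub>1) \<dots> J(x\<^sub>n\<^sub>-\<^sub>1 - x\<^sub>n) f(x\<^sub>n)\<close> and \<open>P\<^sub>n(D) = P\<^sub>n(1\<^sub>D)\<close>. Since
  \<open>J\<close> has mass \<open>1\<close>, the heat content of \<open>D\<close> at time \<open>t\<close> is the Poisson average
  \<open>e\<^sup>-\<^sup>t \<Sum>\<^sub>n P\<^sub>n(D) t\<^sup>n / n!\<close> and the torsional rigidity is \<open>\<Sum>\<^sub>n P\<^sub>n(D)\<close>, so everything reduces to
  \<open>P\<^sub>n(\<Omega>) \<le> P\<^sub>n(\<Omega>\<^sup>*)\<close>. Polarization with respect to a half-space increases \<open>P\<^sub>n\<close>, because two points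
  on the same side are closer to each other than either is to the reflection of the other. For a
  Lipschitz approximation of \<open>1\<^sub>\<Omega>\<close>, Arzela-Ascoli yields a radially non-increasing function with the
  same first two moments and at least the same \<open>P\<^sub>n\<close>; being nearly an indicator function, it is
  \<open>L\<^sup>1\<close>-close to \<open>1\<close> on \<open>\<Omega>\<^sup>*\<close>.\<close>

text \<open>No finite number of polarizations turns a general set into a ball, and no particular
  sequence of them is tracked; a maximality argument in a compact class takes its place. This is why
  indicators are traded for Lipschitz functions: a fixed Lipschitz constant survives polarization
  and gives compactness. The maximiser is not shown to be equidistributed with \<open>f\<close>;
  only the integrals of \<open>g\<close> and \<open>g\<^sup>2\<close> are kept. They suffice because
  their difference, the integral of \<open>g * (1 - g)\<close>, measures how far a function with
  values between 0 and 1 is from an indicator.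

  Torsional rigidity and heat content are defined through a chosen solution of an equation.
  Existence therefore has to be proved, and the integral has to be computed for an arbitrary
  solution. For the latter, the equation is tested against the n-step survival probability, which
  moves the index from n to n + 1 because convolution with an even kernel is self-adjoint. The
  torsion recursion closes since survival probabilities tend to 0 on a bounded set, the heat
  recursion since it is a Taylor expansion.\<close>

lemma nn_integral_lborel_translate:
  fixes g :: "'a::euclidean_space \<Rightarrow> ennreal"
  assumes [measurable]: "g \<in> borel_measurable borel"
  shows "(\<integral>\<^sup>+x. g (c + x) \<partial>lborel) = (\<integral>\<^sup>+x. g x \<partial>lborel)"
  by (subst lborel_distr_plus[symmetric, of c], subst nn_integral_distr) auto

text \<open>For an isometry, the image measure is translation invariant and gives the unit ball its
  Lebesgue measure; the computation with Fubini below shows that this determines it.\<close>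

lemma lborel_distr_linear_isometry:
  fixes R :: "'a::euclidean_space \<Rightarrow> 'a"
  assumes lin: "linear R" and norm: "\<And>x. norm (R x) = norm x"
  shows "distr lborel borel R = lborel"
proof (rule measure_eqI)
  show "sets (distr lborel borel R) = sets (lborel :: 'a measure)" by simp
  fix A assume "A \<in> sets (distr lborel borel R)"
  then have A[measurable]: "A \<in> sets borel" by simp
  have [measurable]: "R \<in> borel_measurable borel"
    by (intro borel_measurable_continuous_onI linear_continuous_on linear_conv_bounded_linear[THEN iffD1] lin)
  have "inj R"
    unfolding linear_inj_iff_eq_0[OF lin] using norm by (metis norm_eq_zero)
  then have "surj R"
    using lin linear_injective_imp_surjective by blast
  define B where "B = ball (0::'a) 1"
  have B[measurable]: "B \<in> sets borel" by (simp add: B_def)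
  have inB: "R x \<in> B \<longleftrightarrow> x \<in> B" "- x \<in> B \<longleftrightarrow> x \<in> B" for x
    by (auto simp: B_def norm)
  have Rinv: "(\<integral>\<^sup>+y. indicator B (x - R y) \<partial>lborel) = emeasure lborel B" for x :: 'a
  proof -
    from \<open>surj R\<close> obtain z where z: "x = R z" by (metis surjD)
    have "(\<integral>\<^sup>+y. indicator B (x - R y) \<partial>lborel) = (\<integral>\<^sup>+y. indicator B (- z + y) \<partial>lborel)"
    proof (rule nn_integral_cong)
      fix y
      have "x - R y = R (z - y)" by (simp add: z linear_diff[OF lin])
      moreover have "z - y = - (- z + y)" by simp
      ultimately show "indicator B (x - R y) = (indicator B (- z + y) :: ennreal)"
        using inB by (metis indicator_simps)
    qed
    also have "\<dots> = (\<integral>\<^sup>+y. indicator B y \<partial>lborel)"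
      by (rule nn_integral_lborel_translate) simp
    finally show ?thesis by simp
  qed
  \<comment> \<open>The double integral of \<open>indicator A (x + R y) * indicator B x\<close> is
    computed in both orders. Integrating over \<open>y\<close> first gives the image measure of
    \<open>A\<close>, by its translation invariance; shifting \<open>x\<close> by \<open>R y\<close>
    instead leaves a factor \<open>indicator B (x - R y)\<close>, whose integral over
    \<open>y\<close> is given by \<open>Rinv\<close>.\<close>
  have "emeasure (distr lborel borel R) A * emeasure lborel B
      = (\<integral>\<^sup>+y. indicator A (R y) \<partial>lborel) * (\<integral>\<^sup>+x. indicator B x \<partial>lborel)"
  proof -
    have "emeasure (distr lborel borel R) A = (\<integral>\<^sup>+y. indicator A y \<partial>distr lborel borel R)"
      by (simp add: nn_integral_indicator)
    also have "\<dots> = (\<integral>\<^sup>+y. indicator A (R y) \<partial>lborel)"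
      by (subst nn_integral_distr) auto
    finally show ?thesis by simp
  qed
  also have "\<dots> = (\<integral>\<^sup>+x. (\<integral>\<^sup>+y. indicator A (R y) \<partial>lborel) * indicator B x \<partial>lborel)"
    by (simp add: nn_integral_cmult)
  also have "\<dots> = (\<integral>\<^sup>+x. (\<integral>\<^sup>+y. indicator A (x + R y) \<partial>lborel) * indicator B x \<partial>lborel)"
  proof (rule nn_integral_cong, rule arg_cong2[where f="(*)"])
    fix x :: 'a
    from \<open>surj R\<close> obtain z where z: "x = R z" by (metis surjD)
    have "(\<integral>\<^sup>+y. indicator A (x + R y) \<partial>lborel) = (\<integral>\<^sup>+y. (indicator A (R (z + y))::ennreal) \<partial>lborel)"
      by (simp add: z linear_add[OF lin])
    also have "\<dots> = (\<integral>\<^sup>+y. indicator A (R y) \<partial>lborel)"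
      by (rule nn_integral_lborel_translate[where g="\<lambda>y. indicator A (R y)"]) measurable
    finally show "(\<integral>\<^sup>+y. indicator A (R y) \<partial>lborel) = (\<integral>\<^sup>+y. (indicator A (x + R y)::ennreal) \<partial>lborel)" by simp
    show "indicator B x = (indicator B x :: ennreal)" ..
  qed
  also have "\<dots> = (\<integral>\<^sup>+x. (\<integral>\<^sup>+y. indicator A (x + R y) * indicator B x \<partial>lborel) \<partial>lborel)"
    by (simp add: nn_integral_multc)
  also have "\<dots> = (\<integral>\<^sup>+y. (\<integral>\<^sup>+x. indicator A (x + R y) * indicator B x \<partial>lborel) \<partial>lborel)"
    by (rule lborel_pair.Fubini') measurable
  also have "\<dots> = (\<integral>\<^sup>+y. (\<integral>\<^sup>+x. indicator A x * indicator B (x - R y) \<partial>lborel) \<partial>lborel)"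
  proof (rule nn_integral_cong)
    fix y
    have "(\<integral>\<^sup>+x. indicator A (x + R y) * indicator B x \<partial>lborel)
        = (\<integral>\<^sup>+x. indicator A (R y + x) * (indicator B ((R y + x) - R y)::ennreal) \<partial>lborel)"
      by (simp add: add.commute)
    also have "\<dots> = (\<integral>\<^sup>+x. indicator A x * indicator B (x - R y) \<partial>lborel)"
      by (rule nn_integral_lborel_translate[where g="\<lambda>x. indicator A x * indicator B (x - R y)"]) measurable
    finally show "(\<integral>\<^sup>+x. indicator A (x + R y) * indicator B x \<partial>lborel)
       = (\<integral>\<^sup>+x. indicator A x * (indicator B (x - R y)::ennreal) \<partial>lborel)" .
  qed
  also have "\<dots> = (\<integral>\<^sup>+x. (\<integral>\<^sup>+y. indicator A x * indicator B (x - R y) \<partial>lborel) \<partial>lborel)"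
    by (rule lborel_pair.Fubini') measurable
  also have "\<dots> = (\<integral>\<^sup>+x. indicator A x * emeasure lborel B \<partial>lborel)"
    by (simp add: nn_integral_cmult Rinv)
  also have "\<dots> = emeasure lborel A * emeasure lborel B"
    by (simp add: nn_integral_multc)
  finally have "emeasure (distr lborel borel R) A * emeasure lborel B = emeasure lborel A * emeasure lborel B" .
  moreover have "emeasure lborel B \<noteq> 0"
    using open_not_negligible[of B]
    by (auto simp: B_def negligible_iff_null_sets null_sets_def)
  moreover have "emeasure lborel B < \<infinity>"
    unfolding B_def by (rule emeasure_lborel_ball_finite)
  ultimately show "emeasure (distr lborel borel R) A = emeasure lborel A"
    by (metis ennreal_mult_cancel_left mult.commute less_irrefl infinity_ennreal_def)
qed

section \<open>Reflections in hyperplanes\<close>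

definition reflection :: "'a::euclidean_space \<Rightarrow> real \<Rightarrow> 'a \<Rightarrow> 'a" where
  "reflection e s x = x - (2 * (x \<bullet> e - s)) *\<^sub>R e"

lemma reflection_measurable[measurable]: "reflection e s \<in> borel_measurable borel"
  unfolding reflection_def by measurable

lemma continuous_reflection: "continuous_on S (reflection e s)"
  unfolding reflection_def by (intro continuous_intros)

context
  fixes e :: "'a::euclidean_space" and s :: real
  assumes e: "norm e = 1"
begin

lemma reflection_inner: "reflection e s x \<bullet> e = 2 * s - x \<bullet> e"
proof -
  have "e \<bullet> e = 1" using e by (simp add: dot_square_norm)
  then show ?thesis by (simp add: reflection_def inner_diff_left)
qed

lemma reflection_reflection: "reflection e s (reflection e s x) = x"
  unfolding reflection_def[of e s "reflection e s x"] reflection_inner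
  by (simp add: reflection_def algebra_simps flip: scaleR_add_left)

text \<open>All distance comparisons rest on this identity: the correction term is four times the
  product of the signed distances of \<open>x\<close> and \<open>y\<close> from the hyperplane, so
  its sign tells whether they lie on the same side.\<close>

lemma norm_diff_reflection_sq:
  "(norm (x - reflection e s y))\<^sup>2 = (norm (x - y))\<^sup>2 + 4 * (s - x \<bullet> e) * (s - y \<bullet> e)"
proof -
  have ee: "e \<bullet> e = 1" using e by (simp add: dot_square_norm)
  have "(norm (x - reflection e s y))\<^sup>2 = ((x - y) + (2 * (y \<bullet> e - s)) *\<^sub>R e) \<bullet> ((x - y) + (2 * (y \<bullet> e - s)) *\<^sub>R e)"
    by (simp add: reflection_def power2_norm_eq_inner algebra_simps)
  also have "\<dots> = (x - y) \<bullet> (x - y) + 4 * (y \<bullet> e - s) * ((x - y) \<bullet> e) + 4 * (y \<bullet> e - s)\<^sup>2"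
    by (simp add: inner_add_left inner_add_right ee inner_commute power2_eq_square)
       (simp add: inner_commute algebra_simps)
  also have "\<dots> = (x - y) \<bullet> (x - y) + 4 * (s - x \<bullet> e) * (s - y \<bullet> e)"
    by (simp add: inner_diff_left power2_eq_square algebra_simps)
  finally show ?thesis by (simp add: power2_norm_eq_inner)
qed

lemma norm_reflection_diff: "norm (reflection e s x - reflection e s y) = norm (x - y)"
proof -
  have "(norm (reflection e s x - reflection e s y))\<^sup>2 = (norm (x - y))\<^sup>2"
    using norm_diff_reflection_sq[of "reflection e s x" y] norm_diff_reflection_sq[of y x]
      reflection_inner[of x] by (simp add: norm_minus_commute)(simp add: algebra_simps)
  then show ?thesis by simp
qed

lemma norm_diff_reflection_commute: "norm (x - reflection e s y) = norm (reflection e s x - y)"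
  using norm_reflection_diff[of x "reflection e s y"] by (simp add: reflection_reflection)

lemma norm_diff_le_reflection:
  assumes "x \<bullet> e \<le> s" "y \<bullet> e \<le> s"
  shows "norm (x - y) \<le> norm (x - reflection e s y)"
proof (rule power2_le_imp_le)
  show "(norm (x - y))\<^sup>2 \<le> (norm (x - reflection e s y))\<^sup>2"
    using assms by (simp add: norm_diff_reflection_sq)
qed simp

text \<open>The case of \<open>norm_diff_le_reflection\<close> in which one point is the origin;
  \<open>0 \<le> s\<close> is what places the origin in the half-space.\<close>

lemma norm_le_reflection:
  assumes "0 \<le> s" "x \<bullet> e \<le> s"
  shows "norm x \<le> norm (reflection e s x)"
  using norm_diff_le_reflection[of 0 x] assms by simp

lemma reflection_hyperplane: "x \<bullet> e = s \<Longrightarrow> reflection e s x = x"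
  by (simp add: reflection_def)

lemma lborel_distr_reflection: "distr lborel borel (reflection e s) = lborel"
proof -
  have lin: "linear (reflection e 0)"
    by (rule linearI) (simp_all add: reflection_def algebra_simps inner_add_left)
  have nrm: "norm (reflection e 0 x) = norm x" for x
  proof -
    have ee: "e \<bullet> e = 1" using e by (simp add: dot_square_norm)
    have "(norm (reflection e 0 x))\<^sup>2 = (norm x)\<^sup>2"
      by (simp add: reflection_def power2_norm_eq_inner inner_diff_left inner_diff_right ee inner_commute)
    then show ?thesis by simp
  qed
  have "reflection e s = (+) ((2 * s) *\<^sub>R e) \<circ> reflection e 0"
    by (auto simp: reflection_def algebra_simps fun_eq_iff)
  then have "distr lborel borel (reflection e s) = distr (distr lborel borel (reflection e 0)) borel ((+) ((2 * s) *\<^sub>R e))"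
    by (subst distr_distr) auto
  also have "\<dots> = lborel"
    using lborel_distr_linear_isometry[OF lin nrm] by (simp add: lborel_distr_plus)
  finally show ?thesis .
qed

lemma integral_reflection:
  fixes g :: "'a \<Rightarrow> real"
  assumes [measurable]: "g \<in> borel_measurable borel"
  shows "(\<integral>x. g (reflection e s x) \<partial>lborel) = (\<integral>x. g x \<partial>lborel)"
  by (subst (2) lborel_distr_reflection[symmetric], subst integral_distr) auto

lemma integrable_reflection:
  fixes g :: "'a \<Rightarrow> real"
  assumes "integrable lborel g"
  shows "integrable lborel (\<lambda>x. g (reflection e s x))"
proof -
  have "integrable (distr lborel borel (reflection e s)) g"
    using assms by (simp add: lborel_distr_reflection)
  then show ?thesis
    by (subst (asm) integrable_distr_eq) (use assms in auto)
qed

end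

section \<open>Convolution with a probability kernel\<close>

locale conv_kernel =
  fixes J :: "'a::euclidean_space \<Rightarrow> real"
  assumes J_measurable[measurable]: "J \<in> borel_measurable borel"
    and J_nonneg: "\<And>x. 0 \<le> J x"
    and J_even: "\<And>x. J (- x) = J x"
    and J_integrable: "integrable lborel J"
    and J_integral: "(\<integral>x. J x \<partial>lborel) = 1"
begin

definition conv :: "('a \<Rightarrow> real) \<Rightarrow> 'a \<Rightarrow> real" where
  "conv g x = (\<integral>y. J (x - y) * g y \<partial>lborel)"

lemma J_diff_commute: "J (x - y) = J (y - x)"
  using J_even[of "x - y"] by simp

lemma integrable_J_diff: "integrable lborel (\<lambda>y. J (x - y))" "integrable lborel (\<lambda>y. J (y - x))"
  and integral_J_diff: "(\<integral>y. J (x - y) \<partial>lborel) = 1" "(\<integral>y. J (y - x) \<partial>lborel) = 1"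
proof -
  have *: "distr lborel borel ((+) (- x)) = (lborel :: 'a measure)"
    by (rule lborel_distr_plus)
  have "integrable (distr lborel borel ((+) (- x))) J" "integral\<^sup>L (distr lborel borel ((+) (- x))) J = 1"
    by (simp_all add: * J_integrable J_integral)
  then show "integrable lborel (\<lambda>y. J (y - x))" "(\<integral>y. J (y - x) \<partial>lborel) = 1"
    by (simp_all add: integrable_distr_eq integral_distr)
  then show "integrable lborel (\<lambda>y. J (x - y))" "(\<integral>y. J (x - y) \<partial>lborel) = 1"
    by (simp_all add: J_diff_commute[of x])
qed

lemma conv_measurable[measurable]:
  assumes [measurable]: "g \<in> borel_measurable borel"
  shows "conv g \<in> borel_measurable borel"
proof -
  have "(\<lambda>x. \<integral>y. J (x - y) * g y \<partial>lborel) \<in> borel_measurable borel"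
    by (rule lborel.borel_measurable_lebesgue_integral) measurable
  then show ?thesis by (simp add: conv_def[abs_def])
qed

lemma integrable_kernel_bounded:
  assumes [measurable]: "g \<in> borel_measurable borel" and "\<And>x. \<bar>g x\<bar> \<le> M"
  shows "integrable lborel (\<lambda>y. J (x - y) * g y)"
proof (rule Bochner_Integration.integrable_bound)
  show "integrable lborel (\<lambda>y. J (x - y) * M)"
    using integrable_J_diff(1) by (rule integrable_mult_left)
  show "AE y in lborel. norm (J (x - y) * g y) \<le> norm (J (x - y) * M)"
    using assms(2) J_nonneg
    by (intro AE_I2) (auto simp: abs_mult intro!: mult_left_mono order_trans[OF assms(2)])
qed measurable

lemma conv_mono:
  assumes "g \<in> borel_measurable borel" "\<And>x. \<bar>g x\<bar> \<le> M"
    and "h \<in> borel_measurable borel" "\<And>x. \<bar>h x\<bar> \<le> N" and "\<And>x. g x \<le> h x"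
  shows "conv g x \<le> conv h x"
  unfolding conv_def
  by (intro integral_mono integrable_kernel_bounded[OF assms(1,2)] integrable_kernel_bounded[OF assms(3,4)]
      mult_left_mono assms(5) J_nonneg)

lemma conv_const: "conv (\<lambda>_. c) x = c"
  by (simp add: conv_def integral_J_diff)

lemma conv_bounds:
  assumes "g \<in> borel_measurable borel" "\<And>x. 0 \<le> g x" "\<And>x. g x \<le> c"
  shows "0 \<le> conv g x" "conv g x \<le> c"
proof -
  have "\<bar>g x\<bar> \<le> c" for x using assms(2)[of x] assms(3)[of x] by simp
  then show "0 \<le> conv g x" "conv g x \<le> c"
    using conv_mono[of "\<lambda>_. 0" 0 g c x] conv_mono[of g c "\<lambda>_. c" "\<bar>c\<bar>" x] assms by (simp_all add: conv_const)
qed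

text \<open>Fubini applies because the kernel has mass 1 in \<open>x\<close>: the inner integral of
  the absolute value is at most \<open>M * \<bar>g y\<bar>\<close>.\<close>

lemma integrable_kernel_pair:
  assumes g: "integrable lborel g" and [measurable]: "p \<in> borel_measurable borel" and p: "\<And>x. \<bar>p x\<bar> \<le> M"
  shows "integrable (lborel \<Otimes>\<^sub>M lborel) (\<lambda>(y, x). p x * (J (x - y) * g y))"
proof (rule lborel_pair.Fubini_integrable)
  have [measurable]: "g \<in> borel_measurable borel" using g by simp
  show "(\<lambda>(y, x). p x * (J (x - y) * g y)) \<in> borel_measurable (lborel \<Otimes>\<^sub>M lborel)" by measurable
  have M: "M \<ge> 0" using p[of undefined] by linarith
  have *: "integrable lborel (\<lambda>x. p x * (J (x - y) * g y))" for y
  proof (rule Bochner_Integration.integrable_bound)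
    show "integrable lborel (\<lambda>x. M * (J (x - y) * g y))"
      using integrable_J_diff(2) by (intro integrable_mult_left integrable_mult_right)
    show "AE x in lborel. norm (p x * (J (x - y) * g y)) \<le> norm (M * (J (x - y) * g y))"
      using p M by (auto simp: abs_mult intro!: mult_right_mono)
  qed measurable
  then show "AE y in lborel. integrable lborel (\<lambda>x. case (y, x) of (y, x) \<Rightarrow> p x * (J (x - y) * g y))"
    by simp
  show "integrable lborel (\<lambda>y. LINT x|lborel. norm (case (y, x) of (y, x) \<Rightarrow> p x * (J (x - y) * g y)))"
  proof (rule Bochner_Integration.integrable_bound)
    show "integrable lborel (\<lambda>y. M * \<bar>g y\<bar>)" using g by (intro integrable_mult_right integrable_abs)
    show "AE y in lborel. norm (LINT x|lborel. norm (case (y, x) of (y, x) \<Rightarrow> p x * (J (x - y) * g y))) \<le> norm (M * \<bar>g y\<bar>)"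
    proof (intro AE_I2)
      fix y
      have "(LINT x|lborel. norm (p x * (J (x - y) * g y))) \<le> (LINT x|lborel. M * (J (x - y) * \<bar>g y\<bar>))"
      proof (rule integral_mono)
        show "integrable lborel (\<lambda>x. norm (p x * (J (x - y) * g y)))" using * by (rule integrable_norm)
        show "integrable lborel (\<lambda>x. M * (J (x - y) * \<bar>g y\<bar>))"
          using integrable_J_diff(2) by (intro integrable_mult_left integrable_mult_right)
        show "norm (p x * (J (x - y) * g y)) \<le> M * (J (x - y) * \<bar>g y\<bar>)" for x
          using p M J_nonneg[of "x - y"] by (auto simp: abs_mult intro!: mult_right_mono)
      qed
      also have "\<dots> = M * \<bar>g y\<bar>" by (simp add: integral_J_diff)
      finally have "(LINT x|lborel. norm (p x * (J (x - y) * g y))) \<le> M * \<bar>g y\<bar>" .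
      then show "norm (LINT x|lborel. norm (case (y, x) of (y, x) \<Rightarrow> p x * (J (x - y) * g y))) \<le> norm (M * \<bar>g y\<bar>)"
        using M by (simp add: abs_mult)
    qed
  qed measurable
qed

text \<open>Convolution with an even kernel is self-adjoint in the pairing of bounded with
  integrable functions; this is the reversibility of Lebesgue measure for the walk.\<close>

lemma
  assumes g: "integrable lborel g" and [measurable]: "p \<in> borel_measurable borel" and p: "\<And>x. \<bar>p x\<bar> \<le> M"
  shows integrable_mult_conv: "integrable lborel (\<lambda>x. p x * conv g x)"
    and integral_mult_conv: "(\<integral>x. p x * conv g x \<partial>lborel) = (\<integral>y. conv p y * g y \<partial>lborel)"
proof -
  note int = integrable_kernel_pair[OF assms]
  have *: "(\<integral>x. p x * (J (x - y) * g y) \<partial>lborel) = conv p y * g y" for y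
  proof -
    have "(\<integral>x. p x * (J (x - y) * g y) \<partial>lborel) = (\<integral>x. (J (y - x) * p x) * g y \<partial>lborel)"
      by (simp add: J_diff_commute[of y] mult_ac)
    then show ?thesis by (simp add: conv_def)
  qed
  show "integrable lborel (\<lambda>x. p x * conv g x)"
    using lborel_pair.integrable_snd[OF int] by (simp add: conv_def)
  show "(\<integral>x. p x * conv g x \<partial>lborel) = (\<integral>y. conv p y * g y \<partial>lborel)"
    using lborel_pair.Fubini_integral[OF int] by (simp add: conv_def *)
qed

lemma AE_integrable_kernel:
  assumes "integrable lborel g"
  shows "AE x in lborel. integrable lborel (\<lambda>y. J (x - y) * g y)"
  using lborel_pair.AE_integrable_snd[OF integrable_kernel_pair[OF assms, of "\<lambda>_. 1" 1]] by simp

lemma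
  assumes "integrable lborel g"
  shows integrable_conv: "integrable lborel (conv g)"
    and integral_conv: "(\<integral>x. conv g x \<partial>lborel) = (\<integral>x. g x \<partial>lborel)"
  using integrable_mult_conv[OF assms, of "\<lambda>_. 1" 1] integral_mult_conv[OF assms, of "\<lambda>_. 1" 1]
  by (simp_all add: conv_const)

lemma integral_abs_conv_le:
  assumes g: "integrable lborel g"
  shows "(\<integral>x. \<bar>conv g x\<bar> \<partial>lborel) \<le> (\<integral>x. \<bar>g x\<bar> \<partial>lborel)"
proof -
  have "(\<integral>x. \<bar>conv g x\<bar> \<partial>lborel) \<le> (\<integral>x. conv (\<lambda>y. \<bar>g y\<bar>) x \<partial>lborel)"
  proof (rule integral_mono)
    show "\<bar>conv g x\<bar> \<le> conv (\<lambda>y. \<bar>g y\<bar>) x" for x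
      unfolding conv_def
      using integral_norm_bound[of lborel "\<lambda>y. J (x - y) * g y"]
      by (simp add: abs_mult J_nonneg)
  qed (use g in \<open>auto intro!: integrable_abs integrable_conv\<close>)
  then show ?thesis using g by (simp add: integral_conv)
qed

text \<open>For an integrable \<open>g\<close> the kernel integral may diverge at exceptional
  points, where the Bochner integral takes the default value 0 and additivity can fail; hence the
  restriction to almost every \<open>x\<close>.\<close>

lemma AE_conv_diff:
  assumes "integrable lborel g" "integrable lborel h"
  shows "AE x in lborel. conv (\<lambda>y. g y - h y) x = conv g x - conv h x"
  using AE_integrable_kernel[OF assms(1)] AE_integrable_kernel[OF assms(2)]
  by eventually_elim (simp add: conv_def right_diff_distrib)

text \<open>Integral over all n-step paths from \<open>x\<close>, weighted by the product of
  \<open>f\<close> over the n + 1 vertices. For the indicator of a set it is the probability that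
  the walk started at \<open>x\<close> is in the set at each of the times 0 to n.\<close>

primrec path_weight :: "('a \<Rightarrow> real) \<Rightarrow> nat \<Rightarrow> 'a \<Rightarrow> real" where
  "path_weight f 0 = f"
| "path_weight f (Suc n) = (\<lambda>x. f x * conv (path_weight f n) x)"

definition path_mass :: "('a \<Rightarrow> real) \<Rightarrow> nat \<Rightarrow> real" where
  "path_mass f n = (\<integral>x. path_weight f n x \<partial>lborel)"

context
  fixes f :: "'a \<Rightarrow> real"
  assumes f_int: "integrable lborel f" and f0: "\<And>x. 0 \<le> f x" and f1: "\<And>x. f x \<le> 1"
begin

lemma path_weight_measurable[measurable]: "path_weight f n \<in> borel_measurable borel"
proof -
  have [measurable]: "f \<in> borel_measurable borel" using f_int by simp
  show ?thesis by (induction n) auto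
qed

lemma path_weight_bounds: "0 \<le> path_weight f n x" "path_weight f n x \<le> f x"
proof -
  have "(\<forall>x. 0 \<le> path_weight f n x) \<and> (\<forall>x. path_weight f n x \<le> f x)"
  proof (induction n)
    case (Suc n)
    have "0 \<le> conv (path_weight f n) x" "conv (path_weight f n) x \<le> 1" for x
      using Suc f1 by (auto intro!: conv_bounds intro: order_trans)
    then show ?case using f0 by (auto simp: mult_left_le)
  qed (use f0 in auto)
  then show "0 \<le> path_weight f n x" "path_weight f n x \<le> f x" by auto
qed

lemma path_weight_le_1: "path_weight f n x \<le> 1"
  using path_weight_bounds(2) f1 order_trans by blast

lemma integrable_path_weight: "integrable lborel (path_weight f n)"
  by (rule Bochner_Integration.integrable_bound[OF f_int])
     (use path_weight_bounds f0 in \<open>auto intro!: AE_I2\<close>)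

lemma conv_path_weight_bounds: "0 \<le> conv (path_weight f n) x" "conv (path_weight f n) x \<le> 1"
  using path_weight_bounds path_weight_le_1 by (auto intro!: conv_bounds)

end

text \<open>The n + 1 occurrences of \<open>f\<close> are exchanged one at a time. All factors lie
  between 0 and 1 and \<open>conv\<close> contracts the L1 norm, so each exchange costs at most the
  L1 distance of \<open>f\<close> and \<open>g\<close>.\<close>

lemma path_weight_stable:
  assumes f: "integrable lborel f" "\<And>x. 0 \<le> f x" "\<And>x. f x \<le> 1"
    and g: "integrable lborel g" "\<And>x. 0 \<le> g x" "\<And>x. g x \<le> 1"
  shows "(\<integral>x. \<bar>path_weight f n x - path_weight g n x\<bar> \<partial>lborel) \<le> real (n + 1) * (\<integral>x. \<bar>f x - g x\<bar> \<partial>lborel)"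
proof (induction n)
  case (Suc n)
  let ?F = "path_weight f n" and ?G = "path_weight g n"
  note iF = integrable_path_weight[OF f, of n] and iG = integrable_path_weight[OF g, of n]
  have [measurable]: "f \<in> borel_measurable borel" "g \<in> borel_measurable borel" using f g by simp_all
  have id: "integrable lborel (\<lambda>y. ?F y - ?G y)" using iF iG by simp
  have "(\<integral>x. \<bar>path_weight f (Suc n) x - path_weight g (Suc n) x\<bar> \<partial>lborel)
     \<le> (\<integral>x. \<bar>f x - g x\<bar> + \<bar>conv (\<lambda>y. ?F y - ?G y) x\<bar> \<partial>lborel)"
  proof (rule integral_mono_AE)
    show "AE x in lborel. \<bar>path_weight f (Suc n) x - path_weight g (Suc n) x\<bar> \<le> \<bar>f x - g x\<bar> + \<bar>conv (\<lambda>y. ?F y - ?G y) x\<bar>"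
      using AE_conv_diff[OF iF iG]
    proof eventually_elim
      fix x assume x: "conv (\<lambda>y. ?F y - ?G y) x = conv ?F x - conv ?G x"
      have "f x * conv ?F x - g x * conv ?G x = (f x - g x) * conv ?F x + g x * (conv ?F x - conv ?G x)"
        by (simp add: algebra_simps)
      also have "\<bar>\<dots>\<bar> \<le> \<bar>f x - g x\<bar> * conv ?F x + g x * \<bar>conv ?F x - conv ?G x\<bar>"
        using conv_path_weight_bounds[OF f, of n x] g(2)[of x]
        by (intro order_trans[OF abs_triangle_ineq]) (simp add: abs_mult)
      also have "\<dots> \<le> \<bar>f x - g x\<bar> + \<bar>conv ?F x - conv ?G x\<bar>"
        using conv_path_weight_bounds[OF f, of n x] g(2)[of x] g(3)[of x]
        by (intro add_mono) (auto intro: mult_left_le mult_left_le_one_le)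
      finally show "\<bar>path_weight f (Suc n) x - path_weight g (Suc n) x\<bar> \<le> \<bar>f x - g x\<bar> + \<bar>conv (\<lambda>y. ?F y - ?G y) x\<bar>"
        by (simp add: x)
    qed
    show "integrable lborel (\<lambda>x. \<bar>path_weight f (Suc n) x - path_weight g (Suc n) x\<bar>)"
      by (intro integrable_abs Bochner_Integration.integrable_diff integrable_path_weight f g)
    show "integrable lborel (\<lambda>x. \<bar>f x - g x\<bar> + \<bar>conv (\<lambda>y. ?F y - ?G y) x\<bar>)"
      using f g id by (auto intro!: integrable_conv)
  qed
  also have "\<dots> = (\<integral>x. \<bar>f x - g x\<bar> \<partial>lborel) + (\<integral>x. \<bar>conv (\<lambda>y. ?F y - ?G y) x\<bar> \<partial>lborel)"
    using f g id by (intro Bochner_Integration.integral_add) (auto intro!: integrable_conv)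
  also have "\<dots> \<le> (\<integral>x. \<bar>f x - g x\<bar> \<partial>lborel) + real (n + 1) * (\<integral>x. \<bar>f x - g x\<bar> \<partial>lborel)"
    using integral_abs_conv_le[OF id] Suc.IH by linarith
  finally show ?case by (simp add: algebra_simps)
qed simp

lemma path_mass_stable:
  assumes f: "integrable lborel f" "\<And>x. 0 \<le> f x" "\<And>x. f x \<le> 1"
    and g: "integrable lborel g" "\<And>x. 0 \<le> g x" "\<And>x. g x \<le> 1"
  shows "\<bar>path_mass f n - path_mass g n\<bar> \<le> real (n + 1) * (\<integral>x. \<bar>f x - g x\<bar> \<partial>lborel)"
proof -
  have "path_mass f n - path_mass g n = (\<integral>x. path_weight f n x - path_weight g n x \<partial>lborel)"
    unfolding path_mass_def using integrable_path_weight[OF f] integrable_path_weight[OF g] by simp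
  also have "\<bar>\<dots>\<bar> \<le> (\<integral>x. \<bar>path_weight f n x - path_weight g n x\<bar> \<partial>lborel)"
    using integral_norm_bound[of lborel "\<lambda>x. path_weight f n x - path_weight g n x"] by simp
  also note path_weight_stable[OF f g]
  finally show ?thesis .
qed

end

section \<open>Polarization\<close>

definition polarize :: "'a::euclidean_space \<Rightarrow> real \<Rightarrow> ('a \<Rightarrow> real) \<Rightarrow> 'a \<Rightarrow> real" where
  "polarize e s f x = (if x \<bullet> e \<le> s then max (f x) (f (reflection e s x)) else min (f x) (f (reflection e s x)))"

text \<open>Weak majorization on each mirror pair, with \<open>U\<close> already in decreasing order
  on the pair. Unlike a bare inequality between integrals, this relation is stable under convolution
  and under multiplying \<open>u\<close> by \<open>f\<close> and \<open>U\<close> by the polarized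
  \<open>f\<close>, which makes induction on the path length possible.\<close>

definition polarize_dominated :: "'a::euclidean_space \<Rightarrow> real \<Rightarrow> ('a \<Rightarrow> real) \<Rightarrow> ('a \<Rightarrow> real) \<Rightarrow> bool" where
  "polarize_dominated e s u U \<longleftrightarrow> (\<forall>x. x \<bullet> e \<le> s \<longrightarrow>
     U (reflection e s x) \<le> U x \<and> u x \<le> U x \<and> u (reflection e s x) \<le> U x \<and>
     u x + u (reflection e s x) \<le> U x + U (reflection e s x))"

lemma polarize_measurable[measurable]:
  assumes [measurable]: "f \<in> borel_measurable borel"
  shows "polarize e s f \<in> borel_measurable borel"
  unfolding polarize_def[abs_def] by measurable

text \<open>The weight \<open>b\<close> common to both terms sees only the sums, and the excess
  \<open>a - b\<close> meets a value that is at most \<open>U\<close>.\<close>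

lemma two_point_rearrangement:
  fixes a b u v U V :: real
  assumes "0 \<le> b" "b \<le> a" "u \<le> U" "v \<le> U" "u + v \<le> U + V"
  shows "a * u + b * v \<le> a * U + b * V" "b * u + a * v \<le> a * U + b * V"
proof -
  have "(a - b) * u \<le> (a - b) * U" "(a - b) * v \<le> (a - b) * U" "b * (u + v) \<le> b * (U + V)"
    using assms by (intro mult_left_mono; simp)+
  then show "a * u + b * v \<le> a * U + b * V" "b * u + a * v \<le> a * U + b * V"
    by (simp_all add: algebra_simps)
qed

context
  fixes e :: "'a::euclidean_space" and s :: real
  assumes e: "norm e = 1"
begin

lemma reflection_halfspace: "reflection e s x \<bullet> e \<le> s \<longleftrightarrow> s \<le> x \<bullet> e"
  by (simp add: reflection_inner[OF e])

lemma reflection_cases: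
  obtains "x \<bullet> e \<le> s" | z where "z \<bullet> e \<le> s" "x = reflection e s z"
  using reflection_halfspace[of x] reflection_reflection[OF e, of s x] by (metis linear)

lemma polarize_reflection:
  assumes "x \<bullet> e \<le> s"
  shows "polarize e s f x = max (f x) (f (reflection e s x))"
    and "polarize e s f (reflection e s x) = min (f x) (f (reflection e s x))"
proof -
  show "polarize e s f x = max (f x) (f (reflection e s x))" using assms by (simp add: polarize_def)
  \<comment> \<open>If \<open>x\<close> lies on the hyperplane, the reflected point falls under the
    \<open>max\<close> branch of the definition as well; it is then \<open>x\<close> itself, so
    maximum and minimum coincide.\<close>
  show "polarize e s f (reflection e s x) = min (f x) (f (reflection e s x))"
    using assms reflection_halfspace[of x] reflection_hyperplane[OF e, of x s]
    by (cases "x \<bullet> e = s") (auto simp: polarize_def reflection_reflection[OF e] min.commute)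
qed

lemma polarize_pair:
  "polarize e s f x = f x \<and> polarize e s f (reflection e s x) = f (reflection e s x) \<or>
   polarize e s f x = f (reflection e s x) \<and> polarize e s f (reflection e s x) = f x"
proof (cases rule: reflection_cases[of x])
  case 1 then show ?thesis by (auto simp: polarize_reflection max_def min_def)
next
  case (2 z)
  then show ?thesis
    by (auto simp: polarize_reflection reflection_reflection[OF e] max_def min_def)
qed

lemma polarize_dominated_polarize: "polarize_dominated e s f (polarize e s f)"
  by (auto simp: polarize_dominated_def polarize_reflection)

lemma polarize_dominated_self:
  "polarize_dominated e s u U \<Longrightarrow> polarize_dominated e s U U"
  by (simp add: polarize_dominated_def)

text \<open>On a mirror pair the two values of \<open>f\<close> act as the weights of
  \<open>two_point_rearrangement\<close>: polarization puts the larger weight where \<open>U\<close>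
  is larger.\<close>

lemma polarize_dominated_mult:
  assumes f: "\<And>x. 0 \<le> f x" and u: "\<And>x. 0 \<le> u x" and U: "\<And>x. 0 \<le> U x"
    and dom: "polarize_dominated e s u U"
  shows "polarize_dominated e s (\<lambda>x. f x * u x) (\<lambda>x. polarize e s f x * U x)"
  unfolding polarize_dominated_def
proof (intro allI impI)
  fix x assume x: "x \<bullet> e \<le> s"
  let ?x = "reflection e s x"
  have d: "U ?x \<le> U x" "u x \<le> U x" "u ?x \<le> U x" "u x + u ?x \<le> U x + U ?x"
    using dom x by (auto simp: polarize_dominated_def)
  let ?a = "max (f x) (f ?x)" and ?b = "min (f x) (f ?x)"
  have ab: "0 \<le> ?b" "?b \<le> ?a" using f[of x] f[of ?x] by auto
  then have a0: "0 \<le> ?a" by linarith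
  have "?b * U ?x \<le> ?a * U x"
    using ab a0 d U by (intro mult_mono) auto
  moreover have "f x * u x \<le> ?a * U x" "f ?x * u ?x \<le> ?a * U x"
    using d u a0 by (auto intro!: mult_mono)
  moreover have "f x * u x + f ?x * u ?x \<le> ?a * U x + ?b * U ?x"
    using two_point_rearrangement[OF ab d(2-4)] by (cases "f x \<le> f ?x") (simp_all add: max_def min_def)
  ultimately show "polarize e s f ?x * U ?x \<le> polarize e s f x * U x \<and>
      f x * u x \<le> polarize e s f x * U x \<and> f ?x * u ?x \<le> polarize e s f x * U x \<and>
      f x * u x + f ?x * u ?x \<le> polarize e s f x * U x + polarize e s f ?x * U ?x"
    by (simp only: polarize_reflection[OF x])
qed

text \<open>Reflection invariance of Lebesgue measure. It lets inequalities between sums over mirror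
  pairs be integrated over the whole space, without splitting it into half-spaces.\<close>

lemma integral_symmetrize:
  fixes g :: "'a \<Rightarrow> real"
  assumes g: "integrable lborel g"
  shows "(\<integral>x. (g x + g (reflection e s x)) / 2 \<partial>lborel) = (\<integral>x. g x \<partial>lborel)"
  using g integrable_reflection[OF e g, of s] integral_reflection[OF e, of g s] by simp

lemma polarize_dominated_integral:
  fixes u U :: "'a \<Rightarrow> real"
  assumes dom: "polarize_dominated e s u U" and u: "integrable lborel u" and U: "integrable lborel U"
  shows "(\<integral>x. u x \<partial>lborel) \<le> (\<integral>x. U x \<partial>lborel)"
proof -
  have "(\<integral>x. (u x + u (reflection e s x)) / 2 \<partial>lborel) \<le> (\<integral>x. (U x + U (reflection e s x)) / 2 \<partial>lborel)"
  proof (rule integral_mono)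
    show "integrable lborel (\<lambda>x. (u x + u (reflection e s x)) / 2)"
      "integrable lborel (\<lambda>x. (U x + U (reflection e s x)) / 2)"
      using u U integrable_reflection[OF e] by simp_all
    show "(u x + u (reflection e s x)) / 2 \<le> (U x + U (reflection e s x)) / 2" for x
      by (cases rule: reflection_cases[of x])
         (use dom in \<open>auto simp: polarize_dominated_def reflection_reflection[OF e] add.commute\<close>)
  qed
  then show ?thesis unfolding integral_symmetrize[OF u] integral_symmetrize[OF U] .
qed

text \<open>Polarization only permutes the two values on each mirror pair, so the pair sums of
  \<Psi> agree.\<close>

lemma integral_comp_polarize:
  fixes \<Psi> :: "real \<Rightarrow> real"
  assumes "integrable lborel (\<lambda>x. \<Psi> (f x))" "integrable lborel (\<lambda>x. \<Psi> (polarize e s f x))"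
  shows "(\<integral>x. \<Psi> (polarize e s f x) \<partial>lborel) = (\<integral>x. \<Psi> (f x) \<partial>lborel)"
proof -
  have "\<Psi> (polarize e s f x) + \<Psi> (polarize e s f (reflection e s x)) = \<Psi> (f x) + \<Psi> (f (reflection e s x))" for x
    using polarize_pair[of f x] by auto
  then show ?thesis
    using integral_symmetrize[OF assms(1)] integral_symmetrize[OF assms(2)] by simp
qed

text \<open>On one side of the hyperplane, polarization is the maximum or minimum of two functions
  with the same Lipschitz constant. Across it, \<open>y\<close> is compared through its mirror
  image, which lies on the side of \<open>x\<close> and no farther from \<open>x\<close> than
  \<open>y\<close> does.\<close>

lemma polarize_lipschitz:
  assumes L: "\<And>x y. \<bar>f x - f y\<bar> \<le> L * norm (x - y)"
  shows "\<bar>polarize e s f x - polarize e s f y\<bar> \<le> L * norm (x - y)"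
proof -
  have L0: "0 \<le> L"
  proof -
    have "0 \<le> L * norm (e - 0)" using L[of e 0] by linarith
    then show ?thesis using e by simp
  qed
  have same: "\<bar>f (reflection e s x) - f (reflection e s y)\<bar> \<le> L * norm (x - y)" for x y
    using L[of "reflection e s x" "reflection e s y"] by (simp add: norm_reflection_diff[OF e])
  have opp: "\<bar>polarize e s f x - polarize e s f y\<bar> \<le> L * norm (x - y)" if x: "x \<bullet> e \<le> s" and y: "\<not> y \<bullet> e \<le> s" for x y
  proof -
    have "norm (x - reflection e s y) \<le> norm (x - y)"
      using norm_diff_le_reflection[OF e, of x s "reflection e s y"] x y
      by (simp add: reflection_inner[OF e] reflection_reflection[OF e])
    then have "L * norm (x - reflection e s y) \<le> L * norm (x - y)" using L0 by (rule mult_left_mono)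
    moreover have "\<bar>f x - f (reflection e s y)\<bar> \<le> L * norm (x - reflection e s y)" by (rule L)
    moreover have "\<bar>f (reflection e s x) - f y\<bar> \<le> L * norm (x - reflection e s y)"
      using L[of "reflection e s x" y] by (simp add: norm_diff_reflection_commute[OF e])
    ultimately show ?thesis
      using L[of x y] same[of x y] x y unfolding polarize_def by auto
  qed
  show ?thesis
  proof (cases "x \<bullet> e \<le> s \<longleftrightarrow> y \<bullet> e \<le> s")
    case True
    then show ?thesis using L[of x y] same[of x y] unfolding polarize_def by auto
  next
    case False
    then show ?thesis using opp[of x y] opp[of y x] by (auto simp: abs_minus_commute norm_minus_commute)
  qed
qed

text \<open>With the origin in the favoured half-space, reflecting a favoured point does not bring
  it closer to the origin, so both values in its maximum vanish; elsewhere the minimum includes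
  \<open>f x = 0\<close>.\<close>

lemma polarize_support:
  assumes "0 \<le> s" "\<And>x. 0 \<le> f x" "\<And>x. R < norm x \<Longrightarrow> f x = 0" "R < norm x"
  shows "polarize e s f x = 0"
proof (cases "x \<bullet> e \<le> s")
  case True
  then have "R < norm (reflection e s x)" using norm_le_reflection[OF e assms(1), of x] assms(4) by simp
  then show ?thesis using True assms by (simp add: polarize_def)
next
  case False
  then show ?thesis using assms(2)[of "reflection e s x"] assms(3)[OF assms(4)] by (simp add: polarize_def)
qed

end

section \<open>Polarization and convolution with a radially non-increasing kernel\<close>

locale radial_kernel = conv_kernel J for J :: "'a::euclidean_space \<Rightarrow> real" +
  assumes J_radial: "\<And>x y. norm x \<le> norm y \<Longrightarrow> J y \<le> J x"
begin

context
  fixes e :: "'a::euclidean_space" and s :: real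
  assumes e: "norm e = 1"
begin

lemma J_reflection_diff: "J (reflection e s x - reflection e s y) = J (x - y)"
  by (intro antisym J_radial) (simp_all add: norm_reflection_diff[OF e])

lemma J_reflection_diff_commute: "J (reflection e s x - y) = J (x - reflection e s y)"
  by (intro antisym J_radial) (simp_all add: norm_diff_reflection_commute[OF e])

text \<open>Passing from \<open>x\<close> to its mirror image exchanges the weights
  \<open>J (x - y)\<close> and \<open>J (x - reflection e s y)\<close>, so both values of the
  convolution become integrals over mirror pairs with the same two weights.\<close>

lemma
  assumes u: "u \<in> borel_measurable borel" "\<And>x. \<bar>u x\<bar> \<le> M"
  shows conv_symmetrize:
      "conv u x = (\<integral>y. (J (x - y) * u y + J (x - reflection e s y) * u (reflection e s y)) / 2 \<partial>lborel)"
    and conv_symmetrize':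
      "conv u (reflection e s x) = (\<integral>y. (J (x - reflection e s y) * u y + J (x - y) * u (reflection e s y)) / 2 \<partial>lborel)"
    and integrable_symmetrize:
      "integrable lborel (\<lambda>y. (J (x - y) * u y + J (x - reflection e s y) * u (reflection e s y)) / 2)"
    and integrable_symmetrize':
      "integrable lborel (\<lambda>y. (J (x - reflection e s y) * u y + J (x - y) * u (reflection e s y)) / 2)"
proof -
  note i = integrable_kernel_bounded[OF u]
  show "conv u x = (\<integral>y. (J (x - y) * u y + J (x - reflection e s y) * u (reflection e s y)) / 2 \<partial>lborel)"
    unfolding conv_def using integral_symmetrize[OF e i[of x], of s] by simp
  show "integrable lborel (\<lambda>y. (J (x - y) * u y + J (x - reflection e s y) * u (reflection e s y)) / 2)"
    using i[of x] integrable_reflection[OF e i[of x], of s] by simp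
  show "conv u (reflection e s x) = (\<integral>y. (J (x - reflection e s y) * u y + J (x - y) * u (reflection e s y)) / 2 \<partial>lborel)"
    unfolding conv_def using integral_symmetrize[OF e i[of "reflection e s x"], of s]
    by (simp add: J_reflection_diff J_reflection_diff_commute reflection_reflection[OF e])
  show "integrable lborel (\<lambda>y. (J (x - reflection e s y) * u y + J (x - y) * u (reflection e s y)) / 2)"
    using i[of "reflection e s x"] integrable_reflection[OF e i[of "reflection e s x"], of s]
    by (simp add: J_reflection_diff J_reflection_diff_commute reflection_reflection[OF e])
qed

text \<open>For \<open>x\<close> and \<open>y\<close> in the favoured half-space,
  \<open>J (x - reflection e s y) \<le> J (x - y)\<close>, because \<open>y\<close> is at least as
  near to \<open>x\<close> as its mirror image is. The two-point inequality then holds pair by pair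
  under the integral.\<close>

lemma polarize_dominated_conv:
  assumes dom: "polarize_dominated e s u U"
    and u: "u \<in> borel_measurable borel" "\<And>x. \<bar>u x\<bar> \<le> M"
    and U: "U \<in> borel_measurable borel" "\<And>x. \<bar>U x\<bar> \<le> N"
  shows "polarize_dominated e s (conv u) (conv U)"
  unfolding polarize_dominated_def
proof (intro allI impI)
  fix x assume x: "x \<bullet> e \<le> s"
  let ?r = "reflection e s"
  have J: "0 \<le> J (x - ?r y)" "J (x - ?r y) \<le> J (x - y)" if "y \<bullet> e \<le> s" for y
    using that x by (auto intro!: J_nonneg J_radial norm_diff_le_reflection[OF e])
  have 1: "J (x - y) * v y + J (x - ?r y) * v (?r y) \<le> J (x - y) * U y + J (x - ?r y) * U (?r y)"
    and 2: "J (x - ?r y) * v y + J (x - y) * v (?r y) \<le> J (x - y) * U y + J (x - ?r y) * U (?r y)"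
    if v: "polarize_dominated e s v U" for v y
  proof -
    have *: "J (x - y) * v y + J (x - ?r y) * v (?r y) \<le> J (x - y) * U y + J (x - ?r y) * U (?r y)"
      "J (x - ?r y) * v y + J (x - y) * v (?r y) \<le> J (x - y) * U y + J (x - ?r y) * U (?r y)"
      if y: "y \<bullet> e \<le> s" for y
      using two_point_rearrangement[OF J[OF y], of "v y" "U y" "v (?r y)" "U (?r y)"] v y
      by (auto simp: polarize_dominated_def)
    show "J (x - y) * v y + J (x - ?r y) * v (?r y) \<le> J (x - y) * U y + J (x - ?r y) * U (?r y)"
      by (cases rule: reflection_cases[OF e, where x=y and s=s])
         (use * in \<open>auto simp: reflection_reflection[OF e] add.commute\<close>)
    show "J (x - ?r y) * v y + J (x - y) * v (?r y) \<le> J (x - y) * U y + J (x - ?r y) * U (?r y)"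
      by (cases rule: reflection_cases[OF e, where x=y and s=s])
         (use * in \<open>auto simp: reflection_reflection[OF e] add.commute\<close>)
  qed
  \<comment> \<open>In the sum of the convolutions at \<open>x\<close> and at its mirror image, both
    values of \<open>u\<close> get the same total weight, so only the pair sums matter.\<close>
  have 3: "(J (x - y) + J (x - ?r y)) * (u y + u (?r y)) \<le> (J (x - y) + J (x - ?r y)) * (U y + U (?r y))" for y
  proof (rule mult_left_mono)
    show "u y + u (?r y) \<le> U y + U (?r y)"
      by (cases rule: reflection_cases[OF e, where x=y and s=s])
         (use dom in \<open>auto simp: reflection_reflection[OF e] add.commute polarize_dominated_def\<close>)
  qed (simp add: J_nonneg)
  \<comment> \<open>Taking \<open>U\<close> itself for \<open>v\<close> in inequality 2 shows that
    \<open>conv U\<close> is again ordered on the pair.\<close>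
  note dU = polarize_dominated_self[OF e dom]
  have "conv U (?r x) \<le> conv U x"
    unfolding conv_symmetrize[OF U, of x] conv_symmetrize'[OF U, of x]
    by (intro integral_mono integrable_symmetrize[OF U] integrable_symmetrize'[OF U] divide_right_mono 2 dU) simp
  moreover have "conv u x \<le> conv U x"
    unfolding conv_symmetrize[OF U, of x] conv_symmetrize[OF u, of x]
    by (intro integral_mono integrable_symmetrize[OF U] integrable_symmetrize[OF u] divide_right_mono 1 dom) simp
  moreover have "conv u (?r x) \<le> conv U x"
    unfolding conv_symmetrize[OF U, of x] conv_symmetrize'[OF u, of x]
    by (intro integral_mono integrable_symmetrize[OF U] integrable_symmetrize'[OF u] divide_right_mono 2 dom) simp
  moreover have "conv u x + conv u (?r x) \<le> conv U x + conv U (?r x)"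
  proof -
    have *: "conv v x + conv v (?r x) = (\<integral>y. (J (x - y) + J (x - ?r y)) * (v y + v (?r y)) / 2 \<partial>lborel)"
      "integrable lborel (\<lambda>y. (J (x - y) + J (x - ?r y)) * (v y + v (?r y)) / 2)"
      if v: "v \<in> borel_measurable borel" "\<And>x. \<bar>v x\<bar> \<le> K" for v K
    proof -
      have eq: "(J (x - y) * v y + J (x - ?r y) * v (?r y)) / 2 + (J (x - ?r y) * v y + J (x - y) * v (?r y)) / 2
          = (J (x - y) + J (x - ?r y)) * (v y + v (?r y)) / 2" for y
        by (simp add: field_simps)
      have "conv v x + conv v (?r x) = (\<integral>y. (J (x - y) * v y + J (x - ?r y) * v (?r y)) / 2
          + (J (x - ?r y) * v y + J (x - y) * v (?r y)) / 2 \<partial>lborel)"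
        unfolding conv_symmetrize[OF v, of x] conv_symmetrize'[OF v, of x]
        by (rule Bochner_Integration.integral_add[symmetric])
           (intro integrable_symmetrize[OF v] integrable_symmetrize'[OF v])+
      then show "conv v x + conv v (?r x) = (\<integral>y. (J (x - y) + J (x - ?r y)) * (v y + v (?r y)) / 2 \<partial>lborel)"
        by (simp only: eq)
      show "integrable lborel (\<lambda>y. (J (x - y) + J (x - ?r y)) * (v y + v (?r y)) / 2)"
        using Bochner_Integration.integrable_add[OF integrable_symmetrize[OF v, of x] integrable_symmetrize'[OF v, of x]]
        by (simp only: eq)
    qed
    show ?thesis unfolding *(1)[OF u] *(1)[OF U]
      by (intro integral_mono *(2)[OF u] *(2)[OF U] divide_right_mono 3) simp
  qed
  ultimately show "conv U (?r x) \<le> conv U x \<and> conv u x \<le> conv U x \<and>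
     conv u (?r x) \<le> conv U x \<and> conv u x + conv u (?r x) \<le> conv U x + conv U (?r x)" by blast
qed

text \<open>Domination holds between \<open>f\<close> and its polarization, and each step of
  \<open>path_weight\<close> preserves it, first through \<open>conv\<close> and then through
  multiplication.\<close>

lemma path_mass_polarize:
  assumes f: "integrable lborel f" "\<And>x. 0 \<le> f x" "\<And>x. f x \<le> 1"
    and F: "integrable lborel (polarize e s f)"
  shows "path_mass f n \<le> path_mass (polarize e s f) n"
proof -
  let ?F = "polarize e s f"
  have F0: "0 \<le> ?F x" and F1: "?F x \<le> 1" for x
    using polarize_pair[OF e, of s f x] f(2,3) by metis+
  note wf = path_weight_measurable[OF f] path_weight_bounds[OF f] path_weight_le_1[OF f]
  note wF = path_weight_measurable[OF F F0 F1] path_weight_bounds[OF F F0 F1] path_weight_le_1[OF F F0 F1]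
  have "polarize_dominated e s (path_weight f n) (path_weight ?F n)"
  proof (induction n)
    case 0 show ?case by (simp add: polarize_dominated_polarize[OF e])
  next
    case (Suc n)
    have "polarize_dominated e s (conv (path_weight f n)) (conv (path_weight ?F n))"
      using wf wF by (intro polarize_dominated_conv[OF Suc.IH, where M=1 and N=1]) (auto simp: abs_le_iff intro: order_trans[of _ 0])
    then show ?case
      by (simp add: polarize_dominated_mult[OF e f(2) conv_path_weight_bounds(1)[OF f] conv_path_weight_bounds(1)[OF F F0 F1]])
  qed
  then show ?thesis
    unfolding path_mass_def
    by (rule polarize_dominated_integral[OF e]) (intro integrable_path_weight f F F0 F1)+
qed

end

end

section \<open>The rearrangement inequality for path masses\<close>

lemma continuous_integral_0:
  fixes d :: "'a::euclidean_space \<Rightarrow> real"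
  assumes d: "continuous_on UNIV d" "\<And>x. 0 \<le> d x" "integrable lborel d" "(\<integral>x. d x \<partial>lborel) \<le> 0"
  shows "d x = 0"
proof (rule ccontr)
  assume "d x \<noteq> 0"
  have "AE x in lborel. d x = 0"
    using d integral_nonneg_eq_0_iff_AE[OF d(3)] by (simp add: integral_nonneg antisym)
  moreover have op: "open {x. d x \<noteq> 0}"
    using d(1) by (intro open_Collect_neq) (auto intro: continuous_intros)
  ultimately have "{x. d x \<noteq> 0} \<in> null_sets lborel"
    by (subst AE_iff_null_sets) auto
  then have "negligible {x. d x \<noteq> 0}"
    by (simp add: negligible_iff_null_sets null_sets_completionI)
  then show False using open_not_negligible[OF op] \<open>d x \<noteq> 0\<close> by blast
qed

lemma tendsto_integral_bounded_support:
  fixes p :: "nat \<Rightarrow> 'a::euclidean_space \<Rightarrow> real"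
  assumes "\<And>k. p k \<in> borel_measurable borel" "\<And>x. (\<lambda>k. p k x) \<longlonglongrightarrow> q x"
    and "\<And>k x. \<bar>p k x\<bar> \<le> C * indicator (cball 0 R) x"
  shows "(\<lambda>k. \<integral>x. p k x \<partial>lborel) \<longlonglongrightarrow> (\<integral>x. q x \<partial>lborel)"
proof (rule integral_dominated_convergence)
  have [measurable]: "\<And>k. p k \<in> borel_measurable borel" by fact
  show "q \<in> borel_measurable lborel"
    using borel_measurable_LIMSEQ_real[of lborel p q] assms by simp
  show "integrable lborel (\<lambda>x. C * indicator (cball (0::'a) R) x :: real)"
    by (intro integrable_mult_right integrable_real_indicator emeasure_lborel_cball_finite) simp
qed (use assms in auto)

text \<open>Sequentially compact under pointwise convergence and closed under the polarizations that
  keep the origin in the favoured half-space; both rest on fixing \<open>L\<close> and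
  \<open>R\<close> once and for all.\<close>

definition competitors :: "real \<Rightarrow> real \<Rightarrow> ('a::euclidean_space \<Rightarrow> real) set" where
  "competitors L R = {h. (\<forall>x y. \<bar>h x - h y\<bar> \<le> L * norm (x - y)) \<and> (\<forall>x. 0 \<le> h x) \<and> (\<forall>x. h x \<le> 1) \<and>
     (\<forall>x. R < norm x \<longrightarrow> h x = 0)}"

lemma competitorsD:
  assumes "h \<in> competitors L R"
  shows "\<And>x y. \<bar>h x - h y\<bar> \<le> L * norm (x - y)" "\<And>x. 0 \<le> h x" "\<And>x. h x \<le> 1" "\<And>x. R < norm x \<Longrightarrow> h x = 0"
  using assms by (auto simp: competitors_def)

lemma competitors_continuous:
  fixes h :: "'a::euclidean_space \<Rightarrow> real"
  assumes "h \<in> competitors L R"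
  shows "continuous_on UNIV h"
proof -
  have "dist (h x) (h y) \<le> \<bar>L\<bar> * dist x y" for x y
    using order_trans[OF competitorsD(1)[OF assms, of x y] mult_right_mono[OF abs_ge_self norm_ge_zero]]
    by (simp add: dist_norm)
  then have "\<bar>L\<bar>-lipschitz_on UNIV h" by (intro lipschitz_onI) auto
  then show ?thesis by (rule lipschitz_on_continuous_on)
qed

lemma competitors_measurable: "h \<in> competitors L R \<Longrightarrow> h \<in> borel_measurable borel"
  by (rule borel_measurable_continuous_onI) (rule competitors_continuous)

lemma competitors_le_indicator:
  assumes "h \<in> competitors L R" shows "h x \<le> indicator (cball 0 R) x"
  using competitorsD[OF assms] by (auto simp: indicator_def not_le)

lemma competitors_integrable_mult:
  fixes h :: "'a::euclidean_space \<Rightarrow> real"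
  assumes h: "h \<in> competitors L R" and [measurable]: "p \<in> borel_measurable borel" and p: "\<And>x. \<bar>p x\<bar> \<le> 1"
  shows "integrable lborel (\<lambda>x. p x * h x)"
proof (rule Bochner_Integration.integrable_bound)
  have [measurable]: "h \<in> borel_measurable borel" by (rule competitors_measurable[OF h])
  show "(\<lambda>x. p x * h x) \<in> borel_measurable lborel" by measurable
  show "integrable lborel (\<lambda>x. indicator (cball (0::'a) R) x :: real)"
    by (intro integrable_real_indicator emeasure_lborel_cball_finite) simp
  show "AE x in lborel. norm (p x * h x) \<le> norm (indicator (cball (0::'a) R) x :: real)"
  proof (intro AE_I2)
    fix x
    have "\<bar>p x\<bar> * h x \<le> 1 * h x" using p competitorsD(2)[OF h] by (rule mult_right_mono)
    then show "norm (p x * h x) \<le> norm (indicator (cball (0::'a) R) x :: real)"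
      using competitors_le_indicator[OF h, of x] competitorsD(2)[OF h, of x] by (simp add: abs_mult)
  qed
qed

lemma competitors_integrable: "h \<in> competitors L R \<Longrightarrow> integrable lborel (h :: 'a::euclidean_space \<Rightarrow> real)"
  using competitors_integrable_mult[of h L R "\<lambda>_. 1"] by simp

lemma competitors_integrable_square:
  "h \<in> competitors L R \<Longrightarrow> integrable lborel (\<lambda>x::'a::euclidean_space. (h x)\<^sup>2)"
  using competitors_integrable_mult[of h L R h] competitorsD(2,3)[of h L R]
  by (simp add: power2_eq_square competitors_measurable)

lemma competitors_polarize:
  assumes e: "norm (e::'a::euclidean_space) = 1" and s: "0 \<le> s" and h: "h \<in> competitors L R"
  shows "polarize e s h \<in> competitors L R"
proof -
  note hD = competitorsD[OF h]
  have "0 \<le> polarize e s h x \<and> polarize e s h x \<le> 1" for x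
    using polarize_pair[OF e, of s h x] hD(2,3) by metis
  then show ?thesis
    using polarize_lipschitz[OF e hD(1)] polarize_support[OF e s hD(2,4)]
    by (simp add: competitors_def)
qed

lemma competitors_convergent_subsequence:
  fixes h :: "nat \<Rightarrow> 'a::euclidean_space \<Rightarrow> real"
  assumes h: "\<And>k. h k \<in> competitors L R"
  obtains g r where "g \<in> competitors L R" "strict_mono (r :: nat \<Rightarrow> nat)" "\<And>x. (\<lambda>k. h (r k) x) \<longlonglongrightarrow> g x"
proof -
  note hD = competitorsD[OF h]
  obtain g' r where r: "strict_mono (r :: nat \<Rightarrow> nat)"
    and g': "\<And>e. 0 < e \<Longrightarrow> \<exists>N. \<forall>n x. n \<ge> N \<and> x \<in> cball (0::'a) R \<longrightarrow> norm (h (r n) x - g' x) < e"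
  proof (rule Arzela_Ascoli[of "cball (0::'a) R" h 1])
    show "norm (h n x) \<le> 1" for n x using hD(2,3)[of n x] by simp
    show "\<exists>d. 0 < d \<and> (\<forall>n y. y \<in> cball 0 R \<and> norm (x - y) < d \<longrightarrow> norm (h n x - h n y) < \<epsilon>)" if "0 < \<epsilon>" for x \<epsilon>
    proof (intro exI[of _ "\<epsilon> / (\<bar>L\<bar> + 1)"] conjI allI impI)
      show "0 < \<epsilon> / (\<bar>L\<bar> + 1)" using that by simp
      fix n y assume y: "y \<in> cball 0 R \<and> norm (x - y) < \<epsilon> / (\<bar>L\<bar> + 1)"
      have "L \<le> \<bar>L\<bar> + 1" by linarith
      then have "norm (h n x - h n y) \<le> (\<bar>L\<bar> + 1) * norm (x - y)"
        using hD(1)[of n x y] mult_right_mono[of L "\<bar>L\<bar> + 1" "norm (x - y)"] by simp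
      also have "\<dots> < \<epsilon>" using y by (simp add: field_simps add_pos_nonneg)
      finally show "norm (h n x - h n y) < \<epsilon>" .
    qed
  qed auto
  \<comment> \<open>Uniform convergence is only known on \<open>cball 0 R\<close>; outside it all
    members of the sequence vanish.\<close>
  define g where "g x = (if norm x \<le> R then g' x else 0)" for x
  have conv: "(\<lambda>k. h (r k) x) \<longlonglongrightarrow> g x" for x
  proof (cases "norm x \<le> R")
    case True
    show ?thesis
    proof (rule LIMSEQ_I)
      fix \<epsilon> :: real assume "0 < \<epsilon>"
      then show "\<exists>no. \<forall>n\<ge>no. norm (h (r n) x - g x) < \<epsilon>" using g'[of \<epsilon>] True by (auto simp: g_def)
    qed
  next
    case False
    then show ?thesis using hD(4) by (simp add: g_def)
  qed
  have "g \<in> competitors L R"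
    unfolding competitors_def
  proof (intro CollectI conjI allI impI)
    fix x y
    show "\<bar>g x - g y\<bar> \<le> L * norm (x - y)"
      by (rule LIMSEQ_le_const2[OF tendsto_rabs[OF tendsto_diff[OF conv conv]]]) (use hD(1) in blast)
    show "0 \<le> g x" by (rule LIMSEQ_le_const[OF conv]) (use hD(2) in blast)
    show "g x \<le> 1" by (rule LIMSEQ_le_const2[OF conv]) (use hD(3) in blast)
    show "R < norm x \<Longrightarrow> g x = 0" by (simp add: g_def)
  qed
  with r conv show ?thesis using that by blast
qed

context radial_kernel
begin

text \<open>Among the competitors with the same first two moments as \<open>f\<close> and at least its path mass, one
  maximising the integral against a strictly radially decreasing weight is fixed by all
  polarizations that keep the origin in the favoured half-space, hence radially non-increasing.\<close>

lemma radial_competitor: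
  assumes f: "f \<in> competitors L R"
  obtains g where "g \<in> competitors L R" "(\<integral>x. g x \<partial>lborel) = (\<integral>x. f x \<partial>lborel)"
    "(\<integral>x. (g x)\<^sup>2 \<partial>lborel) = (\<integral>x. (f x)\<^sup>2 \<partial>lborel)" "path_mass f n \<le> path_mass g n"
    "\<And>x y. norm x \<le> norm y \<Longrightarrow> g y \<le> g x"
proof -
  define S where "S = {h \<in> competitors L R. (\<integral>x. h x \<partial>lborel) = (\<integral>x. f x \<partial>lborel) \<and>
    (\<integral>x. (h x)\<^sup>2 \<partial>lborel) = (\<integral>x. (f x)\<^sup>2 \<partial>lborel) \<and> path_mass f n \<le> path_mass h n}"
  \<comment> \<open>Any positive, bounded, continuous, strictly radially decreasing weight would
    serve; integrability comes from the bounded support of the competitors.\<close>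
  define \<phi> :: "'a \<Rightarrow> real" where "\<phi> x = 1 / (1 + norm x)" for x
  have pos: "0 < 1 + norm (x::'a)" for x by (simp add: add_pos_nonneg)
  then have ne: "1 + norm (x::'a) \<noteq> 0" for x by (metis less_irrefl)
  have \<phi>: "0 < \<phi> x" "\<phi> x \<le> 1" for x using pos[of x] by (simp_all add: \<phi>_def)
  have \<phi>_mono: "norm x \<le> norm y \<Longrightarrow> \<phi> y \<le> \<phi> x" for x y
    using pos by (auto simp: \<phi>_def intro!: divide_left_mono)
  have \<phi>_strict: "norm x < norm y \<Longrightarrow> \<phi> y < \<phi> x" for x y
    using pos by (auto simp: \<phi>_def intro!: divide_strict_left_mono)
  have \<phi>_cont: "continuous_on UNIV \<phi>" unfolding \<phi>_def using ne by (intro continuous_intros) auto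
  then have [measurable]: "\<phi> \<in> borel_measurable borel" by (rule borel_measurable_continuous_onI)
  define \<Phi> where "\<Phi> h = (\<integral>x. \<phi> x * h x \<partial>lborel)" for h
  have \<phi>_int: "integrable lborel (\<lambda>x. \<phi> x * h x)" if "h \<in> competitors L R" for h
    by (rule competitors_integrable_mult[OF that]) (use \<phi> in \<open>simp_all add: abs_of_pos\<close>)
  have S_pol: "polarize e s h \<in> S" if h: "h \<in> S" and e: "norm e = 1" and s: "0 \<le> s" for e s h
  proof -
    have hc: "h \<in> competitors L R" using h by (simp add: S_def)
    note pc = competitors_polarize[OF e s hc]
    note int = competitors_integrable[OF hc] competitors_integrable[OF pc]
      competitors_integrable_square[OF hc] competitors_integrable_square[OF pc]
    have "(\<integral>x. polarize e s h x \<partial>lborel) = (\<integral>x. h x \<partial>lborel)"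
      using integral_comp_polarize[OF e, of "\<lambda>t. t"] int by simp
    moreover have "(\<integral>x. (polarize e s h x)\<^sup>2 \<partial>lborel) = (\<integral>x. (h x)\<^sup>2 \<partial>lborel)"
      using integral_comp_polarize[OF e, of "\<lambda>t. t\<^sup>2"] int by simp
    moreover have "path_mass h n \<le> path_mass (polarize e s h) n"
      by (rule path_mass_polarize[OF e int(1) competitorsD(2,3)[OF hc] int(2)])
    ultimately show ?thesis using h pc by (simp add: S_def)
  qed
  \<comment> \<open>The moments and \<Phi> pass to the limit by dominated convergence on the ball of
    radius \<open>R\<close>; the path mass does so through its L1 stability.\<close>
  have S_closed: "g \<in> S" and \<Phi>_lim: "(\<lambda>k. \<Phi> (h k)) \<longlonglongrightarrow> \<Phi> g"
    if h: "\<And>k. h k \<in> S" and g: "g \<in> competitors L R" and conv: "\<And>x. (\<lambda>k. h k x) \<longlonglongrightarrow> g x" for h g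
  proof -
    have hc: "h k \<in> competitors L R" for k using h by (simp add: S_def)
    have [measurable]: "h k \<in> borel_measurable borel" for k by (rule competitors_measurable[OF hc])
    have [measurable]: "g \<in> borel_measurable borel" by (rule competitors_measurable[OF g])
    note b = competitorsD(2,3)[OF hc] competitors_le_indicator[OF hc]
    note gb = competitorsD(2,3)[OF g] competitors_le_indicator[OF g]
    show "(\<lambda>k. \<Phi> (h k)) \<longlonglongrightarrow> \<Phi> g" unfolding \<Phi>_def
    proof (rule tendsto_integral_bounded_support[where C=1 and R=R])
      show "\<bar>\<phi> x * h k x\<bar> \<le> 1 * indicator (cball 0 R) x" for k x
        using mult_mono[OF \<phi>(2)[of x] b(3)[of k x]] b(1)[of k x] \<phi>(1)[of x] by (simp add: abs_mult)
    qed (auto intro!: tendsto_intros conv)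
    have "(\<lambda>k. \<integral>x. h k x \<partial>lborel) \<longlonglongrightarrow> (\<integral>x. g x \<partial>lborel)"
      by (rule tendsto_integral_bounded_support[where C=1 and R=R]) (use conv b in auto)
    then have 1: "(\<integral>x. g x \<partial>lborel) = (\<integral>x. f x \<partial>lborel)"
      using h by (simp add: S_def LIMSEQ_const_iff)
    have "(\<lambda>k. \<integral>x. (h k x)\<^sup>2 \<partial>lborel) \<longlonglongrightarrow> (\<integral>x. (g x)\<^sup>2 \<partial>lborel)"
    proof (rule tendsto_integral_bounded_support[where C=1 and R=R])
      show "\<bar>(h k x)\<^sup>2\<bar> \<le> 1 * indicator (cball 0 R) x" for k x
        using mult_mono[OF b(2)[of k x] b(3)[of k x]] b(1)[of k x] by (simp add: power2_eq_square)
    qed (auto intro!: tendsto_intros conv)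
    then have 2: "(\<integral>x. (g x)\<^sup>2 \<partial>lborel) = (\<integral>x. (f x)\<^sup>2 \<partial>lborel)"
      using h by (simp add: S_def LIMSEQ_const_iff)
    have "(\<lambda>k. \<integral>x. \<bar>h k x - g x\<bar> \<partial>lborel) \<longlonglongrightarrow> (\<integral>x. (0::real) \<partial>(lborel::'a measure))"
    proof (rule tendsto_integral_bounded_support[where C=1 and R=R])
      show "\<bar>\<bar>h k x - g x\<bar>\<bar> \<le> 1 * indicator (cball 0 R) x" for k x
        using b[of k x] gb[of x] by simp
      show "(\<lambda>k. \<bar>h k x - g x\<bar>) \<longlonglongrightarrow> 0" for x
        using tendsto_rabs[OF tendsto_diff[OF conv[of x] tendsto_const[of "g x"]]] by simp
    qed auto
    then have "(\<lambda>k. path_mass g n + real (n + 1) * (\<integral>x. \<bar>h k x - g x\<bar> \<partial>lborel)) \<longlonglongrightarrow> path_mass g n + real (n + 1) * 0"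
      by (intro tendsto_intros) simp
    moreover have "path_mass f n \<le> path_mass g n + real (n + 1) * (\<integral>x. \<bar>h k x - g x\<bar> \<partial>lborel)" for k
      using path_mass_stable[OF competitors_integrable[OF hc] competitorsD(2,3)[OF hc]
          competitors_integrable[OF g] competitorsD(2,3)[OF g], of k n] h[of k] by (auto simp: S_def abs_le_iff)
    ultimately have 3: "path_mass f n \<le> path_mass g n"
      using LIMSEQ_le_const by (metis (no_types, lifting) add.right_neutral mult_zero_right)
    show "g \<in> S" using g 1 2 3 by (simp add: S_def)
  qed
  have "f \<in> S" using f by (simp add: S_def)
  have bdd: "bdd_above (\<Phi> ` S)"
  proof (rule bdd_aboveI2)
    fix h assume "h \<in> S"
    then have hc: "h \<in> competitors L R" and hf: "(\<integral>x. h x \<partial>lborel) = (\<integral>x. f x \<partial>lborel)" by (simp_all add: S_def)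
    have "\<Phi> h \<le> (\<integral>x. h x \<partial>lborel)" unfolding \<Phi>_def
      by (rule integral_mono[OF \<phi>_int[OF hc] competitors_integrable[OF hc]])
         (use \<phi> competitorsD(2)[OF hc] in \<open>auto intro: mult_left_le_one_le less_imp_le\<close>)
    then show "\<Phi> h \<le> (\<integral>x. f x \<partial>lborel)" by (simp add: hf)
  qed
  define M where "M = Sup (\<Phi> ` S)"
  have "\<exists>h\<in>S. M - 1 / real (Suc k) < \<Phi> h" for k
    using less_cSup_iff[of "\<Phi> ` S" "M - 1 / real (Suc k)"] bdd \<open>f \<in> S\<close> by (auto simp: M_def)
  then obtain h where hS: "\<And>k. h k \<in> S" and hM: "\<And>k. M - 1 / real (Suc k) < \<Phi> (h k)" by metis
  have hc: "\<And>k. h k \<in> competitors L R" using hS by (simp add: S_def)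
  obtain g r where g: "g \<in> competitors L R" and r: "strict_mono (r :: nat \<Rightarrow> nat)"
    and conv: "\<And>x. (\<lambda>k. h (r k) x) \<longlonglongrightarrow> g x"
    using competitors_convergent_subsequence[of h L R, OF hc] by blast
  have gS: "g \<in> S" by (rule S_closed[OF _ g conv]) (rule hS)
  have "(\<lambda>k. \<Phi> (h (r k))) \<longlonglongrightarrow> \<Phi> g" by (rule \<Phi>_lim[OF _ g conv]) (rule hS)
  moreover have "(\<lambda>k. M - 1 / real (Suc (r k))) \<longlonglongrightarrow> M - 0"
    using LIMSEQ_subseq_LIMSEQ[OF LIMSEQ_inverse_real_of_nat r]
    by (intro tendsto_intros) (simp add: o_def inverse_eq_divide)
  moreover have "\<exists>N. \<forall>k\<ge>N. M - 1 / real (Suc (r k)) \<le> \<Phi> (h (r k))"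
    using less_imp_le[OF hM] by blast
  ultimately have M: "M \<le> \<Phi> g"
    using LIMSEQ_le by fastforce
  have fixed: "g (reflection e s x) \<le> g x"
    if e: "norm e = 1" and s: "0 \<le> s" and x: "x \<bullet> e \<le> s" and less: "norm x < norm (reflection e s x)" for e s x
  proof (rule ccontr)
    assume neg: "\<not> g (reflection e s x) \<le> g x"
    note pc = competitors_polarize[OF e s g]
    \<comment> \<open>Half the integral of \<open>d\<close> is the gain
      \<open>\<Phi> (polarize e s g) - \<Phi> g\<close>, which maximality makes nonpositive. As
      \<open>d\<close> is nonnegative and continuous, it vanishes everywhere, in particular at
      \<open>x\<close>, where a larger value of \<open>g\<close> at the mirror point would make it
      positive.\<close>
    define d where "d y = \<phi> y * (polarize e s g y - g y)
      + \<phi> (reflection e s y) * (polarize e s g (reflection e s y) - g (reflection e s y))" for y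
    have d_eq: "d y = (\<phi> y - \<phi> (reflection e s y)) * (max (g y) (g (reflection e s y)) - g y)" if "y \<bullet> e \<le> s" for y
      unfolding d_def polarize_reflection[OF e that] by (auto simp: max_def min_def algebra_simps)
    have d_refl: "d (reflection e s y) = d y" for y by (simp add: d_def reflection_reflection[OF e])
    have "0 \<le> d y" if "y \<bullet> e \<le> s" for y
      unfolding d_eq[OF that] using \<phi>_mono[OF norm_le_reflection[OF e s that]] by simp
    then have d0: "0 \<le> d y" for y
      by (cases rule: reflection_cases[OF e, where x=y and s=s]) (auto simp: d_refl)
    have int: "integrable lborel (\<lambda>y. \<phi> y * (polarize e s g y - g y))"
      using \<phi>_int[OF pc] \<phi>_int[OF g] by (simp add: right_diff_distrib)
    have d_int: "integrable lborel d"
      unfolding d_def using int integrable_reflection[OF e int, of s] by (rule Bochner_Integration.integrable_add)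
    have "(\<integral>y. d y / 2 \<partial>lborel) = (\<integral>y. \<phi> y * (polarize e s g y - g y) \<partial>lborel)"
      unfolding d_def by (rule integral_symmetrize[OF e int])
    also have "\<dots> = \<Phi> (polarize e s g) - \<Phi> g"
      using \<phi>_int[OF pc] \<phi>_int[OF g] by (simp add: right_diff_distrib \<Phi>_def)
    also have "\<dots> \<le> 0"
      using cSup_upper[of "\<Phi> (polarize e s g)" "\<Phi> ` S"] bdd S_pol[OF gS e s] M by (simp add: M_def)
    finally have "(\<integral>y. d y \<partial>lborel) \<le> 0" by simp
    moreover have "continuous_on UNIV d"
      unfolding d_def
      by (intro continuous_intros \<phi>_cont competitors_continuous[OF g] competitors_continuous[OF pc]
          continuous_on_compose2[OF \<phi>_cont continuous_reflection]
          continuous_on_compose2[OF competitors_continuous[OF g] continuous_reflection]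
          continuous_on_compose2[OF competitors_continuous[OF pc] continuous_reflection]) auto
    ultimately have "d x = 0" using d0 d_int by (intro continuous_integral_0)
    then show False unfolding d_eq[OF x] using \<phi>_strict[OF less] neg by auto
  qed
  have strict: "g y \<le> g x" if xy: "norm x < norm y" for x y
  proof -
    have ne: "y - x \<noteq> 0" using xy by auto
    define N where "N = norm (y - x)"
    have N: "N > 0" using ne by (simp add: N_def)
    \<comment> \<open>The hyperplane is the perpendicular bisector of \<open>x\<close> and
      \<open>y\<close>, so reflection carries \<open>x\<close> to \<open>y\<close>;
      \<open>0 \<le> s\<close> holds because \<open>x\<close> is the point nearer to the
      origin.\<close>
    define e where "e = (1 / N) *\<^sub>R (y - x)"
    define s where "s = ((norm y)\<^sup>2 - (norm x)\<^sup>2) / (2 * N)"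
    have e: "norm e = 1" using N by (simp add: e_def N_def)
    have "(norm x)\<^sup>2 \<le> (norm y)\<^sup>2" using xy by (intro power_mono) auto
    then have s: "0 \<le> s" using N by (simp add: s_def)
    have N2: "N * N = y \<bullet> y - 2 * (x \<bullet> y) + x \<bullet> x"
      unfolding N_def power2_eq_square[symmetric] power2_norm_eq_inner
      by (simp add: inner_diff_left inner_diff_right inner_commute)
    have "x \<bullet> e - s = - (N * N) / (2 * N)"
      unfolding N2 using N by (simp add: e_def s_def power2_norm_eq_inner inner_diff_right field_simps)
    then have xe: "x \<bullet> e - s = - (N / 2)" using N by simp
    have "reflection e s x = x + N *\<^sub>R e" by (simp add: reflection_def xe)
    then have r: "reflection e s x = y" using N by (simp add: e_def)
    show ?thesis using fixed[OF e s, of x] r xe N xy by simp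
  qed
  have "g y \<le> g x" if xy: "norm x \<le> norm y" for x y
  proof (cases "y = 0")
    case True then show ?thesis using xy by simp
  next
    case False
    \<comment> \<open>To include equal norms, \<open>y\<close> is approached by slightly longer
      multiples of itself, to which the strict case applies.\<close>
    have "(\<lambda>k. g ((1 + 1 / real (Suc k)) *\<^sub>R y)) \<longlonglongrightarrow> g ((1 + 0) *\<^sub>R y)"
    proof (rule isCont_tendsto_compose[where g=g])
      show "isCont g ((1 + 0) *\<^sub>R y)" using competitors_continuous[OF g] by (simp add: continuous_on_eq_continuous_at)
      have "(\<lambda>k. 1 / real (Suc k)) \<longlonglongrightarrow> 0"
        using LIMSEQ_inverse_real_of_nat by (simp add: inverse_eq_divide)
      then show "(\<lambda>k. (1 + 1 / real (Suc k)) *\<^sub>R y) \<longlonglongrightarrow> (1 + 0) *\<^sub>R y"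
        by (intro tendsto_scaleR tendsto_add tendsto_const)
    qed
    moreover have "g ((1 + 1 / real (Suc k)) *\<^sub>R y) \<le> g x" for k
    proof (rule strict)
      have "norm x \<le> norm y * 1" using xy by simp
      also have "\<dots> < norm y * (1 + 1 / real (Suc k))" using False by (intro mult_strict_left_mono) auto
      also have "\<dots> = norm ((1 + 1 / real (Suc k)) *\<^sub>R y)" by (simp add: mult.commute abs_of_nonneg)
      finally show "norm x < norm ((1 + 1 / real (Suc k)) *\<^sub>R y)" .
    qed
    ultimately show ?thesis using LIMSEQ_le_const2[of _ "g ((1 + 0) *\<^sub>R y)" "g x"] by auto
  qed
  then show ?thesis using that g gS by (auto simp: S_def)
qed

end

section \<open>Approximation of indicator functions\<close>

lemma integrable_bounded_set:
  assumes "S \<in> sets borel" "bounded S"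
  shows "integrable lborel (indicator S :: 'a::euclidean_space \<Rightarrow> real)"
  using emeasure_bounded_finite[OF assms(2)] assms(1) by (intro integrable_real_indicator) auto

text \<open>A closed \<open>K\<close> inside \<open>S\<close> of nearly full measure is chosen, and
  its indicator is approximated from above by \<open>h m\<close>, which falls linearly from 1 on
  \<open>K\<close> to 0 at distance 1 / (m + 1).\<close>

lemma lipschitz_approximation:
  fixes S :: "'a::euclidean_space set"
  assumes S: "S \<in> sets borel" "bounded S" "0 < measure lborel S" and \<epsilon>: "0 < \<epsilon>"
  obtains f L R where "f \<in> competitors L R" "(\<integral>x. \<bar>f x - indicator S x\<bar> \<partial>lborel) \<le> \<epsilon>"
    "(\<integral>x. f x * (1 - f x) \<partial>lborel) \<le> \<epsilon>"
proof -
  \<comment> \<open>Half the measure of \<open>S\<close> forces \<open>K\<close> to be nonempty,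
    without which \<open>infdist\<close> would be constantly 0; half of \<epsilon> pays for each of
    the two steps from \<open>S\<close> to \<open>K\<close> and from \<open>K\<close> to
    \<open>h m\<close>.\<close>
  define \<delta> where "\<delta> = min (\<epsilon> / 2) (measure lborel S / 2)"
  have \<delta>: "0 < \<delta>" "\<delta> \<le> \<epsilon> / 2" "\<delta> < measure lborel S" using S(3) \<epsilon> by (auto simp: \<delta>_def)
  obtain K where K: "closed K" "K \<subseteq> S" "emeasure lebesgue (S - K) < ennreal \<delta>"
    using sets_lebesgue_inner_closed[of S \<delta>] S(1) \<delta>(1) by (metis sets_completionI_sets sets_lborel)
  have Kb[measurable]: "K \<in> sets borel" and [measurable]: "S \<in> sets borel" using K(1) S(1) by simp_all
  have bK: "bounded K" using S(2) K(2) bounded_subset by blast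
  note iS = integrable_bounded_set[OF S(1,2)] and iK = integrable_bounded_set[OF Kb bK]
  have SK: "(\<integral>x. \<bar>indicator K x - indicator S x\<bar> \<partial>lborel) < \<delta>"
  proof -
    have "(\<integral>x. \<bar>indicator K x - indicator S x\<bar> \<partial>lborel) = (\<integral>x. (indicator (S - K) x :: real) \<partial>(lborel::'a measure))"
      using K(2) by (intro Bochner_Integration.integral_cong) (auto split: split_indicator)
    also have "\<dots> = measure lborel (S - K)" by simp
    also have "\<dots> < \<delta>"
      using K(3) \<delta>(1) by (cases "emeasure lborel (S - K)") (auto simp: measure_def ennreal_less_iff)
    finally show ?thesis .
  qed
  have "K \<noteq> {}"
  proof
    assume "K = {}"
    then have "(\<integral>x. \<bar>indicator K x - indicator S x\<bar> \<partial>lborel) = measure lborel S" by simp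
    then show False using SK \<delta>(3) by simp
  qed
  obtain R0 where R0: "\<And>x. x \<in> K \<Longrightarrow> norm x \<le> R0" using bK by (auto simp: bounded_iff)
  \<comment> \<open>Every \<open>h m\<close> falls off with slope at least 1 and so vanishes at
    distance 1 from \<open>K\<close>.\<close>
  define R where "R = R0 + 1"
  define h where "h m x = max 0 (1 - real (Suc m) * infdist x K)" for m x
  have h: "h m \<in> competitors (real (Suc m)) R" for m
    unfolding competitors_def
  proof (intro CollectI conjI allI impI)
    fix x y
    have "\<bar>infdist x K - infdist y K\<bar> \<le> norm (x - y)"
      using infdist_triangle_abs[of x K y] by (simp add: dist_norm)
    then have "real (Suc m) * \<bar>infdist x K - infdist y K\<bar> \<le> real (Suc m) * norm (x - y)"
      by (intro mult_left_mono) auto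
    moreover have "\<bar>h m x - h m y\<bar> \<le> \<bar>real (Suc m) * infdist x K - real (Suc m) * infdist y K\<bar>"
      by (auto simp: h_def)
    moreover have "\<bar>real (Suc m) * infdist x K - real (Suc m) * infdist y K\<bar> = real (Suc m) * \<bar>infdist x K - infdist y K\<bar>"
      by (simp add: abs_mult flip: right_diff_distrib)
    ultimately show "\<bar>h m x - h m y\<bar> \<le> real (Suc m) * norm (x - y)" by linarith
    show "0 \<le> h m x" by (simp add: h_def)
    show "h m x \<le> 1" by (simp add: h_def infdist_nonneg)
    assume x: "R < norm x"
    have "1 \<le> infdist x K"
      unfolding infdist_notempty[OF \<open>K \<noteq> {}\<close>]
    proof (rule cINF_greatest[OF \<open>K \<noteq> {}\<close>])
      fix a assume "a \<in> K"
      then have "norm a \<le> R0" by (rule R0)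
      moreover have "norm x \<le> norm a + dist x a" by (simp add: dist_norm norm_triangle_sub)
      ultimately show "1 \<le> dist x a" using x by (simp add: R_def)
    qed
    then have "1 * 1 \<le> real (Suc m) * infdist x K" by (intro mult_mono) auto
    then show "h m x = 0" by (simp add: h_def)
  qed
  have lim: "(\<lambda>m. h m x) \<longlonglongrightarrow> indicator K x" for x
  proof (cases "x \<in> K")
    case True
    then show ?thesis by (simp add: h_def)
  next
    case False
    then have pos: "0 < infdist x K" using K(1) \<open>K \<noteq> {}\<close> infdist_pos_not_in_closed by blast
    obtain N where N: "1 / infdist x K < real N" using reals_Archimedean2 by blast
    have "h m x = 0" if "m \<ge> N" for m
    proof -
      have "1 / infdist x K < real (Suc m)" using N that by simp
      then show ?thesis using pos by (simp add: h_def field_simps)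
    qed
    then have "eventually (\<lambda>m. h m x = 0) sequentially" by (auto simp: eventually_sequentially)
    then show ?thesis using False by (simp add: tendsto_eventually)
  qed
  have "(\<lambda>m. \<integral>x. \<bar>h m x - indicator K x\<bar> \<partial>lborel) \<longlonglongrightarrow> (\<integral>x. (0::real) \<partial>(lborel::'a measure))"
  proof (rule tendsto_integral_bounded_support[where C=1 and R=R])
    have [measurable]: "\<And>m. h m \<in> borel_measurable borel" by (rule competitors_measurable[OF h])
    show "(\<lambda>x. \<bar>h m x - indicator K x\<bar>) \<in> borel_measurable borel" for m by measurable
    show "\<bar>\<bar>h m x - indicator K x\<bar>\<bar> \<le> 1 * indicator (cball 0 R) x" for m x
      using competitors_le_indicator[OF h, of m x] competitorsD(2,3)[OF h, of m x] R0[of x]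
      by (auto simp: R_def split: split_indicator split_indicator_asm)
    show "(\<lambda>m. \<bar>h m x - indicator K x\<bar>) \<longlonglongrightarrow> 0" for x
      using tendsto_rabs[OF tendsto_diff[OF lim[of x] tendsto_const[of "indicator K x"]]] by simp
  qed
  then have "eventually (\<lambda>m. (\<integral>x. \<bar>h m x - indicator K x\<bar> \<partial>lborel) < \<delta>) sequentially"
    using \<delta>(1) by (intro order_tendstoD) auto
  then obtain m where m: "(\<integral>x. \<bar>h m x - indicator K x\<bar> \<partial>lborel) < \<delta>"
    by (auto simp: eventually_sequentially)
  let ?f = "h m"
  note fD = competitorsD[OF h[of m]] and fi = competitors_integrable[OF h[of m]] competitors_integrable_square[OF h[of m]]
  have "(\<integral>x. \<bar>?f x - indicator S x\<bar> \<partial>lborel) \<le> (\<integral>x. \<bar>?f x - indicator K x\<bar> + \<bar>indicator K x - indicator S x\<bar> \<partial>lborel)"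
    using fi iS iK by (intro integral_mono) auto
  also have "\<dots> = (\<integral>x. \<bar>?f x - indicator K x\<bar> \<partial>lborel) + (\<integral>x. \<bar>indicator K x - indicator S x\<bar> \<partial>lborel)"
    using fi iS iK by (intro Bochner_Integration.integral_add) auto
  finally have 1: "(\<integral>x. \<bar>?f x - indicator S x\<bar> \<partial>lborel) \<le> \<epsilon>" using m SK \<delta> by linarith
  have "(\<integral>x. ?f x * (1 - ?f x) \<partial>lborel) \<le> (\<integral>x. \<bar>?f x - indicator K x\<bar> \<partial>lborel)"
  proof (rule integral_mono)
    show "integrable lborel (\<lambda>x. ?f x * (1 - ?f x))" using fi by (simp add: right_diff_distrib power2_eq_square)
    show "integrable lborel (\<lambda>x. \<bar>?f x - indicator K x\<bar>)" using fi iK by auto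
    show "?f x * (1 - ?f x) \<le> \<bar>?f x - indicator K x\<bar>" for x
    proof (cases "x \<in> K")
      case True then show ?thesis by (simp add: h_def)
    next
      case False then show ?thesis using fD(2,3)[of x] by (simp add: mult_left_le)
    qed
  qed
  then have "(\<integral>x. ?f x * (1 - ?f x) \<partial>lborel) \<le> \<epsilon>" using m \<delta> \<epsilon> by linarith
  with h 1 show ?thesis using that by blast
qed

text \<open>The superlevel set \<open>{g > 1/2}\<close> is nested with the ball \<open>B\<close>, so the \<open>L\<^sup>1\<close> distance of the
  indicators is the difference of the measures.\<close>

lemma radial_function_near_ball:
  fixes g :: "'a::euclidean_space \<Rightarrow> real"
  assumes g: "integrable lborel g" "\<And>x. 0 \<le> g x" "\<And>x. g x \<le> 1" "integrable lborel (\<lambda>x. (g x)\<^sup>2)"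
    and radial: "\<And>x y. norm x \<le> norm y \<Longrightarrow> g y \<le> g x"
    and \<epsilon>: "(\<integral>x. g x * (1 - g x) \<partial>lborel) \<le> \<epsilon>" "\<bar>(\<integral>x. g x \<partial>lborel) - measure lborel (ball (0::'a) r)\<bar> \<le> \<epsilon>"
  shows "(\<integral>x. \<bar>g x - indicator (ball 0 r) x\<bar> \<partial>lborel) \<le> 5 * \<epsilon>"
proof -
  define B where "B = {x. 1 / 2 < g x}"
  let ?O = "ball (0::'a) r"
  have [measurable]: "g \<in> borel_measurable borel" using g(1) by simp
  have Bm[measurable]: "B \<in> sets borel" unfolding B_def by measurable
  have iB: "integrable lborel (indicator B :: 'a \<Rightarrow> real)"
  proof (rule Bochner_Integration.integrable_bound)
    show "integrable lborel (\<lambda>x. 2 * g x)" using g(1) by simp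
    show "AE x in lborel. norm (indicator B x :: real) \<le> norm (2 * g x)"
      using g(2) by (intro AE_I2) (auto simp: B_def indicator_def)
  qed measurable
  have iO: "integrable lborel (indicator ?O :: 'a \<Rightarrow> real)" by (rule integrable_bounded_set) auto
  have gB: "(\<integral>x. \<bar>g x - indicator B x\<bar> \<partial>lborel) \<le> 2 * \<epsilon>"
  proof -
    have "(\<integral>x. \<bar>g x - indicator B x\<bar> \<partial>lborel) \<le> (\<integral>x. 2 * (g x * (1 - g x)) \<partial>lborel)"
    proof (rule integral_mono)
      show "integrable lborel (\<lambda>x. \<bar>g x - indicator B x\<bar>)" using g(1) iB by auto
      show "integrable lborel (\<lambda>x. 2 * (g x * (1 - g x)))" using g(1,4) by (simp add: right_diff_distrib power2_eq_square)
      \<comment> \<open>The level 1/2 in \<open>B\<close> is what gives this: on \<open>B\<close>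
        the factor \<open>2 * g x\<close> is at least 1, off \<open>B\<close> the factor
        \<open>2 * (1 - g x)\<close> is.\<close>
      show "\<bar>g x - indicator B x\<bar> \<le> 2 * (g x * (1 - g x))" for x
      proof (cases "x \<in> B")
        case True
        then have "(1 - g x) * 1 \<le> (1 - g x) * (2 * g x)" using g(3)[of x] by (intro mult_left_mono) (auto simp: B_def)
        then show ?thesis using True g(3)[of x] by (simp add: algebra_simps)
      next
        case False
        then have "g x * 1 \<le> g x * (2 * (1 - g x))" using g(2)[of x] by (intro mult_left_mono) (auto simp: B_def)
        then show ?thesis using False g(2)[of x] by (simp add: algebra_simps)
      qed
    qed
    then show ?thesis using \<epsilon>(1) by simp
  qed
  have mB: "\<bar>(\<integral>x. g x \<partial>lborel) - measure lborel B\<bar> \<le> 2 * \<epsilon>"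
  proof -
    have "(\<integral>x. g x \<partial>lborel) - measure lborel B = (\<integral>x. g x - indicator B x \<partial>lborel)"
      using g(1) iB by simp
    also have "\<bar>\<dots>\<bar> \<le> (\<integral>x. \<bar>g x - indicator B x\<bar> \<partial>lborel)"
      using integral_norm_bound[of lborel "\<lambda>x. g x - indicator B x"] by simp
    finally show ?thesis using gB by linarith
  qed
  \<comment> \<open>A point of the ball outside \<open>B\<close> bounds the norms of all points of
    \<open>B\<close>, since \<open>g\<close> is radially non-increasing.\<close>
  have nested: "B \<subseteq> ?O \<or> ?O \<subseteq> B"
  proof (rule disjCI)
    assume "\<not> ?O \<subseteq> B"
    then obtain y where "y \<in> ?O" "y \<notin> B" by blast
    then have y: "norm y < r" "\<not> 1 / 2 < g y" by (auto simp: B_def)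
    show "B \<subseteq> ?O"
    proof
      fix x assume "x \<in> B"
      then have "1 / 2 < g x" by (simp add: B_def)
      then have "norm x < norm y" using radial[of y x] y(2) by (meson leI less_le_trans)
      then show "x \<in> ?O" using y(1) by simp
    qed
  qed
  have BO: "(\<integral>x. \<bar>indicator B x - indicator ?O x\<bar> \<partial>lborel) = \<bar>measure lborel B - measure lborel ?O\<bar>"
    using nested
  proof
    assume "B \<subseteq> ?O"
    then have "(\<integral>x. \<bar>indicator B x - indicator ?O x :: real\<bar> \<partial>lborel) = (\<integral>x. indicator ?O x - indicator B x \<partial>lborel)"
      by (intro Bochner_Integration.integral_cong) (auto split: split_indicator)
    moreover have "0 \<le> (\<integral>x. \<bar>indicator B x - indicator ?O x :: real\<bar> \<partial>lborel)" by simp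
    ultimately show ?thesis using iB iO by simp
  next
    assume "?O \<subseteq> B"
    then have "(\<integral>x. \<bar>indicator B x - indicator ?O x :: real\<bar> \<partial>lborel) = (\<integral>x. indicator B x - indicator ?O x \<partial>lborel)"
      by (intro Bochner_Integration.integral_cong) (auto split: split_indicator)
    moreover have "0 \<le> (\<integral>x. \<bar>indicator B x - indicator ?O x :: real\<bar> \<partial>lborel)" by simp
    ultimately show ?thesis using iB iO by simp
  qed
  have "(\<integral>x. \<bar>g x - indicator ?O x\<bar> \<partial>lborel) \<le> (\<integral>x. \<bar>g x - indicator B x\<bar> + \<bar>indicator B x - indicator ?O x\<bar> \<partial>lborel)"
    using g(1) iB iO by (intro integral_mono) auto
  also have "\<dots> = (\<integral>x. \<bar>g x - indicator B x\<bar> \<partial>lborel) + (\<integral>x. \<bar>indicator B x - indicator ?O x\<bar> \<partial>lborel)"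
    using g(1) iB iO by (intro Bochner_Integration.integral_add) auto
  \<comment> \<open>The constant is 2 + 2 + 1: from \<open>g\<close> to the indicator of
    \<open>B\<close>, from the measure of \<open>B\<close> to the integral of \<open>g\<close>, and
    from there to the measure of the ball.\<close>
  finally show ?thesis using gB mB \<epsilon>(2) BO by linarith
qed

context radial_kernel
begin

text \<open>The indicator of \<open>S\<close> is exchanged for \<open>f\<close>, \<open>f\<close>
  for its radial competitor \<open>g\<close>, and \<open>g\<close> for the indicator of the ball.
  The outer exchanges cost an arbitrarily small error by \<open>path_mass_stable\<close>, the middle
  one loses nothing.\<close>

lemma path_mass_le_ball:
  assumes S: "S \<in> sets borel" "bounded S" and r: "measure lborel (ball (0::'a) r) = measure lborel S"
  shows "path_mass (indicator S) n \<le> path_mass (indicator (ball 0 r)) n"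
\<comment> \<open>Null sets are treated apart because the Lipschitz approximation asks for positive
  measure; their path mass is at most 0.\<close>
proof (cases "measure lborel S = 0")
  case True
  have i: "integrable lborel (indicator S :: 'a \<Rightarrow> real)" "\<And>x. 0 \<le> (indicator S x :: real)" "\<And>x. (indicator S x :: real) \<le> 1"
    by (auto intro!: integrable_bounded_set S simp: indicator_def)
  have "path_mass (indicator S) n \<le> (\<integral>x. indicator S x \<partial>lborel)"
    unfolding path_mass_def
    by (intro integral_mono integrable_path_weight i path_weight_bounds(2))
  also have "\<dots> = 0" using True S(1) by simp
  also have "0 \<le> path_mass (indicator (ball (0::'a) r)) n"
    unfolding path_mass_def
    by (intro Bochner_Integration.integral_nonneg path_weight_bounds(1) integrable_bounded_set) (auto simp: indicator_def)
  finally show ?thesis .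
next
  case False
  then have pos: "0 < measure lborel S" by (simp add: zero_less_measure_iff)
  have i: "integrable lborel (indicator T :: 'a \<Rightarrow> real)" "\<And>x. 0 \<le> (indicator T x :: real)" "\<And>x. (indicator T x :: real) \<le> 1"
    if "T \<in> sets borel" "bounded T" for T :: "'a set"
    using that by (auto intro!: integrable_bounded_set simp: indicator_def)
  have b: "ball (0::'a) r \<in> sets borel" "bounded (ball (0::'a) r)" by auto
  show ?thesis
  proof (rule field_le_epsilon)
    fix \<epsilon> :: real assume \<epsilon>: "0 < \<epsilon>"
    \<comment> \<open>One \<delta> is spent on replacing \<open>S\<close> and five on reaching the
      ball, each multiplied by the stability constant \<open>n + 1\<close>.\<close>
    define \<delta> where "\<delta> = \<epsilon> / (6 * real (n + 1))"
    have \<delta>: "0 < \<delta>" using \<epsilon> by (simp add: \<delta>_def)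
    obtain f L R where f: "f \<in> competitors L R" and fS: "(\<integral>x. \<bar>f x - indicator S x\<bar> \<partial>lborel) \<le> \<delta>"
      and ff: "(\<integral>x. f x * (1 - f x) \<partial>lborel) \<le> \<delta>"
      by (rule lipschitz_approximation[OF S pos \<delta>])
    obtain g where g: "g \<in> competitors L R" and g1: "(\<integral>x. g x \<partial>lborel) = (\<integral>x. f x \<partial>lborel)"
      and g2: "(\<integral>x. (g x)\<^sup>2 \<partial>lborel) = (\<integral>x. (f x)\<^sup>2 \<partial>lborel)" and g3: "path_mass f n \<le> path_mass g n"
      and g4: "\<And>x y. norm x \<le> norm y \<Longrightarrow> g y \<le> g x"
      by (rule radial_competitor[OF f]) blast
    note fi = competitors_integrable[OF f] competitorsD(2,3)[OF f]
    note gi = competitors_integrable[OF g] competitorsD(2,3)[OF g]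
    have "(\<integral>x. g x * (1 - g x) \<partial>lborel) = (\<integral>x. f x * (1 - f x) \<partial>lborel)"
      using fi(1) gi(1) competitors_integrable_square[OF f] competitors_integrable_square[OF g] g1 g2
      by (simp add: right_diff_distrib power2_eq_square)
    then have gg: "(\<integral>x. g x * (1 - g x) \<partial>lborel) \<le> \<delta>" using ff by simp
    have "(\<integral>x. f x \<partial>lborel) - measure lborel S = (\<integral>x. f x - indicator S x \<partial>lborel)"
      using fi(1) i(1)[OF S] S(1) by simp
    also have "\<bar>\<dots>\<bar> \<le> (\<integral>x. \<bar>f x - indicator S x\<bar> \<partial>lborel)"
      using integral_norm_bound[of lborel "\<lambda>x. f x - indicator S x"] by simp
    finally have "\<bar>(\<integral>x. g x \<partial>lborel) - measure lborel (ball (0::'a) r)\<bar> \<le> \<delta>" using fS g1 r by simp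
    then have gO: "(\<integral>x. \<bar>g x - indicator (ball 0 r) x\<bar> \<partial>lborel) \<le> 5 * \<delta>"
      by (intro radial_function_near_ball gi competitors_integrable_square[OF g] g4 gg)
    have "path_mass (indicator S) n \<le> path_mass f n + real (n + 1) * (\<integral>x. \<bar>f x - indicator S x\<bar> \<partial>lborel)"
      using path_mass_stable[OF fi i[OF S], of n] by linarith
    also have "\<dots> \<le> path_mass g n + real (n + 1) * \<delta>"
      using g3 fS by (intro add_mono mult_left_mono) auto
    also have "\<dots> \<le> path_mass (indicator (ball 0 r)) n + real (n + 1) * (5 * \<delta>) + real (n + 1) * \<delta>"
    proof -
      have "path_mass g n \<le> path_mass (indicator (ball 0 r)) n + real (n + 1) * (\<integral>x. \<bar>g x - indicator (ball 0 r) x\<bar> \<partial>lborel)"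
        using path_mass_stable[OF gi i[OF b], of n] by linarith
      also have "\<dots> \<le> path_mass (indicator (ball 0 r)) n + real (n + 1) * (5 * \<delta>)"
        using gO by (intro add_mono mult_left_mono) auto
      finally show ?thesis by (rule add_right_mono)
    qed
    also have "\<dots> = path_mass (indicator (ball 0 r)) n + 6 * real (n + 1) * \<delta>"
      by (simp add: algebra_simps)
    also have "6 * real (n + 1) * \<delta> = \<epsilon>"
      by (simp add: \<delta>_def)
    finally show "path_mass (indicator S) n \<le> path_mass (indicator (ball 0 r)) n + \<epsilon>" .
  qed
qed

end

section \<open>The nonlocal Laplacian on a bounded domain\<close>

text \<open>Measurability of \<open>f\<close> is derived, not assumed: by completeness, a function
  equal almost everywhere to a Borel function is Lebesgue measurable.\<close>

lemma integral_lebesgue_cong_AE: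
  fixes f g :: "'a::euclidean_space \<Rightarrow> real"
  assumes g: "g \<in> borel_measurable borel" and AE: "AE x in lborel. f x = g x"
  shows "(\<integral>x. f x \<partial>lebesgue) = (\<integral>x. g x \<partial>lborel)"
proof -
  obtain N where N: "N \<in> null_sets lborel" "{x. f x \<noteq> g x} \<subseteq> N"
    using AE by (auto simp: eventually_ae_filter)
  have gl: "g \<in> borel_measurable lebesgue" using g by (intro measurable_completion) simp
  have "f \<in> borel_measurable lebesgue"
  proof (rule measurableI)
    fix A :: "real set" assume A: "A \<in> sets borel"
    have "f -` A \<inter> space lebesgue = ((g -` A \<inter> space lebesgue) - N) \<union> (f -` A \<inter> N)"
      using N(2) by auto
    moreover have "g -` A \<inter> space lebesgue \<in> sets lebesgue" by (rule measurable_sets[OF gl A])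
    moreover have "N \<in> sets lebesgue" using N(1) by auto
    moreover have "f -` A \<inter> N \<in> sets lebesgue"
      using null_sets_completion_subset[of "f -` A \<inter> N" N lborel] N(1) null_sets_completionI by blast
    ultimately show "f -` A \<inter> space lebesgue \<in> sets lebesgue" by (metis sets.Diff sets.Un)
  qed simp
  then have "(\<integral>x. f x \<partial>lebesgue) = (\<integral>x. g x \<partial>lebesgue)"
    using gl AE by (intro integral_cong_AE) (auto simp: AE_completion_iff)
  also have "\<dots> = (\<integral>x. g x \<partial>lborel)" using g by (intro integral_completion) simp
  finally show ?thesis .
qed

context conv_kernel
begin

lemma conv_tendsto:
  assumes h: "\<And>k. h k \<in> borel_measurable borel" "\<And>k x. \<bar>h k x\<bar> \<le> M" and lim: "\<And>x. (\<lambda>k. h k x) \<longlonglongrightarrow> g x"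
  shows "(\<lambda>k. conv (h k) x) \<longlonglongrightarrow> conv g x"
  unfolding conv_def
proof (rule integral_dominated_convergence[where w="\<lambda>y. J (x - y) * M"])
  have [measurable]: "\<And>k. h k \<in> borel_measurable borel" by fact
  have [measurable]: "g \<in> borel_measurable borel" using borel_measurable_LIMSEQ_real[of borel h g] lim by simp
  show "(\<lambda>y. J (x - y) * g y) \<in> borel_measurable lborel" by measurable
  show "\<And>k. (\<lambda>y. J (x - y) * h k y) \<in> borel_measurable lborel" by measurable
  show "integrable lborel (\<lambda>y. J (x - y) * M)" using integrable_J_diff(1) by (rule integrable_mult_left)
  show "AE y in lborel. (\<lambda>k. J (x - y) * h k y) \<longlonglongrightarrow> J (x - y) * g y" by (intro AE_I2 tendsto_intros lim)
  show "\<And>k. AE y in lborel. norm (J (x - y) * h k y) \<le> J (x - y) * M"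
    using h(2) by (intro AE_I2) (simp add: abs_mult J_nonneg mult_left_mono)
qed

lemma conv_sum:
  assumes "\<And>n. h n \<in> borel_measurable borel" "\<And>n x. \<bar>h n x\<bar> \<le> M"
  shows "conv (\<lambda>y. \<Sum>n\<in>I. c n * h n y) x = (\<Sum>n\<in>I. c n * conv (h n) x)"
proof -
  have "conv (\<lambda>y. \<Sum>n\<in>I. c n * h n y) x = (\<integral>y. (\<Sum>n\<in>I. c n * (J (x - y) * h n y)) \<partial>lborel)"
    by (simp add: conv_def sum_distrib_left mult_ac)
  also have "\<dots> = (\<Sum>n\<in>I. c n * conv (h n) x)"
    unfolding conv_def using integrable_kernel_bounded[OF assms]
    by (subst Bochner_Integration.integral_sum) (auto intro!: integrable_mult_right)
  finally show ?thesis .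
qed

end

text \<open>The Borel set \<open>B\<close> fills the Lebesgue measurable \<open>D\<close> up to a
  null set. It is carried along so that Fubini can be used for \<open>lborel\<close> with Borel
  functions, while the definitions of the statement speak of \<open>D\<close>.\<close>

locale kernel_domain = conv_kernel J for J :: "real^'n \<Rightarrow> real" +
  fixes D B :: "(real^'n) set"
  assumes D_sets: "D \<in> sets lebesgue" and D_bounded: "bounded D"
    and B_sets[measurable]: "B \<in> sets borel" and B_subset: "B \<subseteq> D"
    and D_AE: "AE x in lborel. x \<in> D \<longrightarrow> x \<in> B"
begin

abbreviation survival :: "nat \<Rightarrow> real^'n \<Rightarrow> real" where
  "survival \<equiv> path_weight (indicator B)"

abbreviation mass :: "nat \<Rightarrow> real" where
  "mass \<equiv> path_mass (indicator B)"

lemma indicator_B: "integrable lborel (indicator B :: real^'n \<Rightarrow> real)"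
  "\<And>x. 0 \<le> (indicator B x :: real)" "\<And>x. (indicator B x :: real) \<le> 1"
  using integrable_bounded_set[of B] D_bounded B_subset bounded_subset by (auto simp: indicator_def)

lemmas survival_measurable[measurable] = path_weight_measurable[OF indicator_B]
  and survival_bounds = path_weight_bounds[OF indicator_B]
  and survival_le_1 = path_weight_le_1[OF indicator_B]
  and integrable_survival = integrable_path_weight[OF indicator_B]

lemma survival_abs_le: "\<bar>survival n x\<bar> \<le> indicator B x" "\<bar>survival n x\<bar> \<le> 1"
  using survival_bounds[of n x] survival_le_1[of n x] by auto

lemma survival_outside: "x \<notin> B \<Longrightarrow> survival n x = 0"
  using survival_bounds[of n x] by simp

text \<open>A Borel version \<open>g\<close> of \<open>f\<close>, extended by zero off
  \<open>B\<close>. It turns integrals over \<open>D\<close> into integrals over the whole space,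
  where \<open>conv\<close> acts; measurability is contained in integrability.\<close>

definition represents :: "(real^'n \<Rightarrow> real) \<Rightarrow> (real^'n \<Rightarrow> real) \<Rightarrow> bool" where
  "represents g f \<longleftrightarrow> integrable lborel g \<and> (\<forall>x. x \<notin> B \<longrightarrow> g x = 0) \<and> (AE x in lborel. x \<in> B \<longrightarrow> g x = f x)"

lemma represents_integral:
  assumes "represents g f"
  shows "(LINT x:D|lebesgue. f x) = (\<integral>x. g x \<partial>lborel)"
  unfolding set_lebesgue_integral_def
proof (rule integral_lebesgue_cong_AE)
  show "g \<in> borel_measurable borel" using assms by (auto simp: represents_def)
  have "AE x in lborel. x \<in> B \<longrightarrow> g x = f x" using assms by (simp add: represents_def)
  then show "AE x in lborel. indicator D x *\<^sub>R f x = g x"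
    using D_AE
  proof eventually_elim
    case (elim x)
    then show ?case using assms B_subset by (auto simp: represents_def indicator_def)
  qed
qed

lemma m_boundary_eq: "m_boundary J D = {x. x \<notin> D \<and> 0 < conv (indicator B) x}"
proof -
  have "emeasure (rwalk J x) D = ennreal (conv (indicator B) x)" for x
  proof -
    have "(\<lambda>y. ennreal (J (x - y))) \<in> borel_measurable lebesgue"
      by (intro measurable_completion) measurable
    then have "emeasure (rwalk J x) D = (\<integral>\<^sup>+y. ennreal (J (x - y)) * indicator D y \<partial>lebesgue)"
      unfolding rwalk_def using D_sets by (rule emeasure_density)
    also have "\<dots> = (\<integral>\<^sup>+y. ennreal (J (x - y) * indicator B y) \<partial>lebesgue)"
    proof (rule nn_integral_cong_AE)
      show "AE y in lebesgue. ennreal (J (x - y)) * indicator D y = ennreal (J (x - y) * indicator B y)"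
        unfolding AE_completion_iff using D_AE
        by eventually_elim (use B_subset in \<open>auto simp: indicator_def\<close>)
    qed
    also have "\<dots> = (\<integral>\<^sup>+y. ennreal (J (x - y) * indicator B y) \<partial>lborel)" by (rule nn_integral_completion)
    also have "\<dots> = ennreal (conv (indicator B) x)"
      unfolding conv_def
      by (intro nn_integral_eq_integral integrable_kernel_bounded[where M=1]) (auto simp: J_nonneg indicator_def)
    finally show ?thesis .
  qed
  then show ?thesis by (simp add: m_boundary_def)
qed

lemma m_closure_sets: "m_closure J D \<in> sets lebesgue"
proof -
  have "{x. 0 < conv (indicator B) x} \<in> sets lebesgue"
    by (intro sets_completionI_sets) simp
  moreover have "m_closure J D = D \<union> {x. 0 < conv (indicator B) x}"
    by (auto simp: m_closure_def m_boundary_eq)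
  ultimately show ?thesis using D_sets by auto
qed

text \<open>On the set \<open>B\<close> of finite measure, square integrability gives integrability
  through \<open>\<bar>f x\<bar> \<le> 1 + (f x)\<^sup>2\<close>; the Borel version comes from the
  completion.\<close>

lemma represents_L2:
  assumes "f \<in> L2_on (m_closure J D)"
  shows "\<exists>g. represents g f"
proof -
  let ?m = "m_closure J D"
  have m: "?m \<inter> space lebesgue \<in> sets lebesgue" using m_closure_sets by simp
  have f1: "(\<lambda>x. indicator ?m x *\<^sub>R f x) \<in> borel_measurable lebesgue"
    using assms by (simp add: L2_on_def borel_measurable_restrict_space_iff[OF m])
  have f2: "integrable lebesgue (\<lambda>x. indicator ?m x *\<^sub>R (f x)\<^sup>2)"
    using assms by (simp add: L2_on_def integrable_restrict_space[OF m])
  have Bm: "B \<subseteq> ?m" using B_subset by (auto simp: m_closure_def)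
  have Bl: "(indicator B :: _ \<Rightarrow> real) \<in> borel_measurable lebesgue" by (intro measurable_completion) simp
  have eq: "indicator B x * (indicator ?m x *\<^sub>R f x) = indicator B x * f x" for x
    using Bm by (auto simp: indicator_def)
  have "(\<lambda>x. indicator B x * (indicator ?m x *\<^sub>R f x)) \<in> borel_measurable lebesgue"
    using Bl f1 by (rule borel_measurable_times)
  then have fB: "(\<lambda>x. indicator B x * f x) \<in> borel_measurable lebesgue" by (simp only: eq)
  obtain g0 where g0[measurable]: "g0 \<in> borel_measurable lborel" and g0f: "AE x in lborel. indicator B x * f x = g0 x"
    using completion_ex_borel_measurable_real[OF fB] by auto
  define g where "g x = indicator B x * g0 x" for x
  have [measurable]: "g \<in> borel_measurable borel" using g0 unfolding g_def[abs_def] by simp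
  have gf: "AE x in lborel. g x = indicator B x * f x"
    using g0f by eventually_elim (auto simp: g_def indicator_def)
  have "integrable lebesgue g"
  proof (rule Bochner_Integration.integrable_bound)
    have "integrable lebesgue (indicator B :: _ \<Rightarrow> real)"
      using indicator_B(1) by (subst integrable_completion) auto
    then show "integrable lebesgue (\<lambda>x. indicator B x + indicator ?m x *\<^sub>R (f x)\<^sup>2)"
      using f2 by (rule Bochner_Integration.integrable_add)
    show "g \<in> borel_measurable lebesgue" by (intro measurable_completion) simp
    show "AE x in lebesgue. norm (g x) \<le> norm (indicator B x + indicator ?m x *\<^sub>R (f x)\<^sup>2)"
      unfolding AE_completion_iff using gf
    proof eventually_elim
      case (elim x)
      have "\<bar>f x\<bar> \<le> 1 + (f x)\<^sup>2"
      proof (cases "\<bar>f x\<bar> \<le> 1")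
        case True then show ?thesis using zero_le_power2[of "f x"] by linarith
      next
        case False
        then have "\<bar>f x\<bar> * 1 \<le> \<bar>f x\<bar> * \<bar>f x\<bar>" by (intro mult_left_mono) auto
        then show ?thesis by (simp add: power2_eq_square)
      qed
      then show ?case using elim Bm by (auto simp: indicator_def)
    qed
  qed
  then have "integrable lborel g" by (simp add: integrable_completion)
  moreover have "AE x in lborel. x \<in> B \<longrightarrow> g x = f x" using gf by eventually_elim simp
  ultimately show ?thesis unfolding represents_def by (intro exI[of _ g]) (auto simp: g_def)
qed

text \<open>Hence the coefficient of \<open>- f x\<close> in the nonlocal Laplacian is the full mass \<open>1\<close> of the kernel.\<close>

lemma kernel_outside_closure:
  "AE x in lborel. x \<in> B \<longrightarrow> (AE y in lborel. y \<notin> m_closure J D \<longrightarrow> J (x - y) = 0)"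
proof -
  \<comment> \<open>\<open>p\<close> marks the points from which the kernel does not charge
    \<open>B\<close>. By self-adjointness the integral of \<open>conv p\<close> over
    \<open>B\<close> equals that of \<open>p * conv (indicator B)\<close>, which is 0; hence almost
    every point of \<open>B\<close> sees no mass where \<open>p\<close> is 1.\<close>
  define p :: "real^'n \<Rightarrow> real" where "p y = (if conv (indicator B) y = 0 then 1 else 0)" for y
  have [measurable]: "p \<in> borel_measurable borel" unfolding p_def[abs_def] by measurable
  have p: "\<bar>p y\<bar> \<le> 1" "0 \<le> p y" for y by (auto simp: p_def)
  have p0: "p y * conv (indicator B) y = 0" for y by (simp add: p_def)
  have "(\<integral>x. conv p x * indicator B x \<partial>lborel) = 0"
    using integral_mult_conv[OF indicator_B(1), of p 1] p(1) by (simp add: p0)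
  moreover have "integrable lborel (\<lambda>x. conv p x * indicator B x)"
  proof (rule Bochner_Integration.integrable_bound[OF indicator_B(1)])
    show "AE x in lborel. norm (conv p x * indicator B x) \<le> norm (indicator B x :: real)"
      using conv_bounds[of p 1] p by (auto simp: indicator_def abs_le_iff intro: order_trans[of _ 0])
  qed measurable
  moreover have "0 \<le> conv p x" for x using conv_bounds(1)[of p 1] p by (auto simp: abs_le_iff)
  ultimately have "AE x in lborel. conv p x * indicator B x = 0"
    by (subst (asm) integral_nonneg_eq_0_iff_AE) auto
  then show ?thesis
  proof eventually_elim
    case (elim x)
    show ?case
    proof
      assume "x \<in> B"
      then have "(\<integral>y. J (x - y) * p y \<partial>lborel) = 0" using elim by (simp add: conv_def)
      then have "AE y in lborel. J (x - y) * p y = 0"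
        using integrable_kernel_bounded[of p 1 x] p J_nonneg
        by (subst (asm) integral_nonneg_eq_0_iff_AE) auto
      then show "AE y in lborel. y \<notin> m_closure J D \<longrightarrow> J (x - y) = 0"
      proof eventually_elim
        case (elim y)
        have "0 \<le> conv (indicator B) y" using conv_bounds(1)[of "indicator B" 1] by simp
        then show ?case using elim by (auto simp: m_closure_def m_boundary_eq p_def)
      qed
    qed
  qed
qed

text \<open>Almost every \<open>y\<close> falls into one of three cases: in \<open>B\<close>, where
  \<open>f\<close> equals \<open>g\<close>; in the boundary, where both vanish; outside
  \<open>m_closure J D\<close>, where \<open>J (x - y)\<close> is 0 by
  \<open>kernel_outside_closure\<close>. Against the constant \<open>g x\<close> the kernel then
  integrates to 1.\<close>

lemma nonlocal_laplacian_represents: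
  assumes g: "represents g f" and f0: "AE x in lebesgue. x \<in> m_boundary J D \<longrightarrow> f x = 0"
  shows "AE x in lborel. x \<in> B \<longrightarrow> nonlocal_laplacian J D f x = conv g x - g x"
proof -
  have gi: "integrable lborel g" and gf: "AE x in lborel. x \<in> B \<longrightarrow> g x = f x"
    and gB: "\<And>x. x \<notin> B \<Longrightarrow> g x = 0"
    using g by (auto simp: represents_def)
  have [measurable]: "g \<in> borel_measurable borel" using gi by simp
  show ?thesis
    using gf kernel_outside_closure AE_integrable_kernel[OF gi]
  proof eventually_elim
    case (elim x)
    show ?case
    proof
      assume x: "x \<in> B"
      have "nonlocal_laplacian J D f x = (\<integral>y. J (x - y) * g y - J (x - y) * g x \<partial>lborel)"
        unfolding nonlocal_laplacian_def set_lebesgue_integral_def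
      proof (rule integral_lebesgue_cong_AE)
        have "AE y in lborel. y \<notin> m_closure J D \<longrightarrow> J (x - y) = 0" using elim x by simp
        moreover have "AE y in lborel. y \<in> m_boundary J D \<longrightarrow> f y = 0" using f0 by (simp add: AE_completion_iff)
        ultimately show "AE y in lborel. indicator (m_closure J D) y *\<^sub>R (J (x - y) * (f y - f x)) = J (x - y) * g y - J (x - y) * g x"
          using gf D_AE
        proof eventually_elim
          case (elim y)
          have xf: "f x = g x" using \<open>x \<in> B \<longrightarrow> g x = f x\<close> x by simp
          consider "y \<in> B" | "y \<in> m_boundary J D" "y \<notin> B" | "y \<notin> m_closure J D" "y \<notin> B"
            using elim(4) B_subset by (auto simp: m_closure_def)
          then show ?case
          proof cases
            case 1
            then show ?thesis using elim B_subset xf by (auto simp: m_closure_def right_diff_distrib)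
          next
            case 2
            then show ?thesis using elim xf gB[of y] by (auto simp: m_closure_def right_diff_distrib)
          next
            case 3
            then show ?thesis using elim by simp
          qed
        qed
      qed measurable
      also have "\<dots> = conv g x - g x"
        using elim integrable_J_diff(1)[of x]
        by (subst Bochner_Integration.integral_diff) (auto simp: conv_def integral_J_diff)
      finally show "nonlocal_laplacian J D f x = conv g x - g x" .
    qed
  qed
qed

lemma L2_on_bounded:
  assumes [measurable]: "f \<in> borel_measurable borel" and f: "\<And>x. \<bar>f x\<bar> \<le> M * indicator B x"
  shows "f \<in> L2_on (m_closure J D)" and "represents f f"
proof -
  have m: "m_closure J D \<inter> space lebesgue \<in> sets lebesgue" using m_closure_sets by simp
  have B0: "f x = 0" if "x \<notin> B" for x using f[of x] that by simp
  have i: "integrable lborel (\<lambda>x. (f x)\<^sup>2)"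
  proof (rule Bochner_Integration.integrable_bound)
    show "integrable lborel (\<lambda>x. M\<^sup>2 * indicator B x :: real)" using indicator_B(1) by simp
    show "AE x in lborel. norm ((f x)\<^sup>2) \<le> norm (M\<^sup>2 * indicator B x :: real)"
    proof (intro AE_I2)
      fix x
      have "\<bar>f x\<bar>\<^sup>2 \<le> (M * indicator B x)\<^sup>2" using f[of x] by (intro power_mono) auto
      then show "norm ((f x)\<^sup>2) \<le> norm (M\<^sup>2 * indicator B x :: real)"
        by (auto simp: indicator_def split: if_splits)
    qed
  qed measurable
  have eq: "indicator (m_closure J D) x *\<^sub>R f x = f x" "indicator (m_closure J D) x *\<^sub>R (f x)\<^sup>2 = (f x)\<^sup>2" for x
    using B0[of x] B_subset by (auto simp: indicator_def m_closure_def)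
  have "f \<in> borel_measurable lebesgue" by (intro measurable_completion) simp
  moreover have "integrable lebesgue (\<lambda>x. (f x)\<^sup>2)" using i by (subst integrable_completion) auto
  ultimately show "f \<in> L2_on (m_closure J D)"
    unfolding L2_on_def mem_Collect_eq borel_measurable_restrict_space_iff[OF m] integrable_restrict_space[OF m] eq by simp
  have "integrable lborel f"
  proof (rule Bochner_Integration.integrable_bound)
    show "integrable lborel (\<lambda>x. M * indicator B x :: real)" using indicator_B(1) by simp
    show "AE x in lborel. norm (f x) \<le> norm (M * indicator B x :: real)"
      using order_trans[OF f abs_ge_self] by (intro AE_I2) simp
  qed measurable
  then show "represents f f" using B0 by (simp add: represents_def)
qed

text \<open>Testing the torsion and heat equations against \<open>survival n\<close> gives recursions in \<open>n\<close>.\<close>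

lemma integral_survival_conv:
  assumes g: "integrable lborel g" "\<And>x. x \<notin> B \<Longrightarrow> g x = 0"
  shows "integrable lborel (\<lambda>x. survival n x * conv g x)"
    and "(\<integral>x. survival n x * conv g x \<partial>lborel) = (\<integral>x. survival (Suc n) x * g x \<partial>lborel)"
proof -
  show "integrable lborel (\<lambda>x. survival n x * conv g x)"
    by (rule integrable_mult_conv[OF g(1) survival_measurable survival_abs_le(2)])
  have "(\<integral>x. survival n x * conv g x \<partial>lborel) = (\<integral>x. conv (survival n) x * g x \<partial>lborel)"
    by (rule integral_mult_conv[OF g(1) survival_measurable survival_abs_le(2)])
  also have "\<dots> = (\<integral>x. survival (Suc n) x * g x \<partial>lborel)"
    using g(2) by (intro Bochner_Integration.integral_cong) (auto simp: indicator_def)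
  finally show "(\<integral>x. survival n x * conv g x \<partial>lborel) = (\<integral>x. survival (Suc n) x * g x \<partial>lborel)" .
qed

lemma integrable_survival_mult:
  assumes g: "integrable lborel g"
  shows "integrable lborel (\<lambda>x. survival n x * g x)"
proof (rule Bochner_Integration.integrable_bound[OF g])
  have [measurable]: "g \<in> borel_measurable borel" using g by simp
  show "(\<lambda>x. survival n x * g x) \<in> borel_measurable lborel" by measurable
  show "AE x in lborel. norm (survival n x * g x) \<le> norm (g x)"
    using survival_abs_le(2) by (auto simp: abs_mult intro!: mult_left_le_one_le)
qed

end

section \<open>The torsion problem\<close>

lemma integral_lborel_reflect_point:
  fixes h :: "'a::euclidean_space \<Rightarrow> real"
  assumes [measurable]: "h \<in> borel_measurable borel"
  shows "(\<integral>y. h (c - y) \<partial>lborel) = (\<integral>y. h y \<partial>lborel)"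
    and "integrable lborel h \<Longrightarrow> integrable lborel (\<lambda>y. h (c - y))"
proof -
  have "distr lborel borel (\<lambda>y::'a. c - y) = distr (distr lborel borel uminus) borel ((+) c)"
    by (subst distr_distr) (auto simp: comp_def)
  also have "\<dots> = lborel"
    by (simp add: lborel_distr_linear_isometry linear_uminus lborel_distr_plus)
  finally have d: "distr lborel borel (\<lambda>y::'a. c - y) = lborel" .
  show "(\<integral>y. h (c - y) \<partial>lborel) = (\<integral>y. h y \<partial>lborel)"
    by (subst (2) d[symmetric], subst integral_distr) auto
  assume "integrable lborel h"
  then have "integrable (distr lborel borel (\<lambda>y::'a. c - y)) h" by (simp only: d)
  then show "integrable lborel (\<lambda>y. h (c - y))" by (subst (asm) integrable_distr_eq) auto
qed

lemma AE_lborel_neq: "AE z in lborel. z \<noteq> (c::'a::euclidean_space)"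
  by (rule AE_I[of _ _ "{c}"]) auto

section \<open>A barrier function for bounded domains\<close>

context conv_kernel
begin

text \<open>A density of mass 1 is not concentrated at the origin, a null set. The truncation makes
  the moment finite for every kernel.\<close>

lemma truncated_second_moment_pos:
  assumes R: "0 < R"
  shows "0 < (\<integral>z. J z * min ((norm z)\<^sup>2) R \<partial>lborel)"
proof -
  have i: "integrable lborel (\<lambda>z. J z * min ((norm z)\<^sup>2) R)"
  proof (rule Bochner_Integration.integrable_bound)
    show "integrable lborel (\<lambda>z. J z * R)" using J_integrable by (rule integrable_mult_left)
    show "AE z in lborel. norm (J z * min ((norm z)\<^sup>2) R) \<le> norm (J z * R)"
      using R J_nonneg by (auto simp: abs_mult intro!: mult_left_mono)
  qed measurable
  have nonneg: "0 \<le> J z * min ((norm z)\<^sup>2) R" for z using R J_nonneg by simp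
  have "(\<integral>z. J z * min ((norm z)\<^sup>2) R \<partial>lborel) \<noteq> 0"
  proof
    assume "(\<integral>z. J z * min ((norm z)\<^sup>2) R \<partial>lborel) = 0"
    then have "AE z in lborel. J z * min ((norm z)\<^sup>2) R = 0"
      using i nonneg by (subst (asm) integral_nonneg_eq_0_iff_AE) auto
    then have "AE z in lborel. J z = 0"
      using AE_lborel_neq[of 0] by eventually_elim (use R in \<open>auto simp: min_def split: if_splits\<close>)
    then have "(\<integral>z. J z \<partial>lborel) = 0" by (rule integral_eq_zero_AE)
    then show False using J_integral by simp
  qed
  moreover have "0 \<le> (\<integral>z. J z * min ((norm z)\<^sup>2) R \<partial>lborel)"
    using nonneg by (intro Bochner_Integration.integral_nonneg)
  ultimately show ?thesis by linarith
qed

text \<open>The function \<open>4R\<^sup>2 - |x|\<^sup>2\<close>, cut off outside \<open>B\<close>, is a strict supersolution on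
  \<open>B \<subseteq> cball 0 R\<close>: average the kernel over \<open>y\<close> and \<open>2x - y\<close> and use the parallelogram law.\<close>

lemma conv_barrier_le:
  fixes B :: "'a set"
  assumes [measurable]: "B \<in> sets borel" and BR: "B \<subseteq> cball 0 R" and x: "x \<in> B"
  defines "\<psi> \<equiv> \<lambda>x. indicator B x * (4 * R\<^sup>2 - (norm x)\<^sup>2)"
  shows "conv \<psi> x \<le> \<psi> x - (\<integral>z. J z * min ((norm z)\<^sup>2) (R\<^sup>2) \<partial>lborel)"
proof -
  have nR: "(norm y)\<^sup>2 \<le> R\<^sup>2" if "y \<in> B" for y
    using that BR by (intro power_mono) auto
  have \<psi>b: "\<bar>\<psi> y\<bar> \<le> 4 * R\<^sup>2" for y
  proof (cases "y \<in> B")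
    case True
    have "\<bar>4 * R\<^sup>2 - (norm y)\<^sup>2\<bar> \<le> 4 * R\<^sup>2"
      using nR[OF True] zero_le_power2[of "norm y"] unfolding abs_le_iff by linarith
    then show ?thesis using True by (simp add: \<psi>_def)
  qed (simp add: \<psi>_def)
  have [measurable]: "\<psi> \<in> borel_measurable borel" unfolding \<psi>_def by measurable
  have i1: "integrable lborel (\<lambda>y. J (x - y) * \<psi> y)"
    by (rule integrable_kernel_bounded[OF _ \<psi>b]) measurable
  have i2: "integrable lborel (\<lambda>y. J (x - y) * \<psi> (2 *\<^sub>R x - y))"
    by (rule integrable_kernel_bounded[OF _ \<psi>b]) measurable
  have eq2: "(\<integral>y. J (x - y) * \<psi> (2 *\<^sub>R x - y) \<partial>lborel) = conv \<psi> x"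
  proof -
    have "J (x - y) = J (x - (2 *\<^sub>R x - y))" for y
    proof -
      have "x - (2 *\<^sub>R x - y) = - (x - y)" by (simp add: scaleR_2)
      then show ?thesis by (simp only: J_even)
    qed
    then have "(\<integral>y. J (x - y) * \<psi> (2 *\<^sub>R x - y) \<partial>lborel) = (\<integral>y. J (x - (2 *\<^sub>R x - y)) * \<psi> (2 *\<^sub>R x - y) \<partial>lborel)"
      by simp
    also have "\<dots> = (\<integral>y. J (x - y) * \<psi> y \<partial>lborel)"
      by (rule integral_lborel_reflect_point(1)[where h="\<lambda>y. J (x - y) * \<psi> y"]) measurable
    finally show ?thesis by (simp add: conv_def)
  qed
  let ?c = "\<lambda>y. min ((norm (x - y))\<^sup>2) (R\<^sup>2)"
  have i3: "integrable lborel (\<lambda>y. J (x - y) * ?c y)"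
    by (rule integrable_kernel_bounded[where M="R\<^sup>2"]) (auto simp: abs_le_iff intro: order_trans[of _ 0])
  have point: "(\<psi> y + \<psi> (2 *\<^sub>R x - y)) / 2 \<le> \<psi> x - ?c y" for y
  proof (cases "y \<in> B \<and> 2 *\<^sub>R x - y \<in> B")
    case True
    have "(norm y)\<^sup>2 + (norm (2 *\<^sub>R x - y))\<^sup>2 = 2 * (norm x)\<^sup>2 + 2 * (norm (x - y))\<^sup>2"
      by (simp add: power2_norm_eq_inner inner_diff_left inner_diff_right inner_commute)
    then have "(\<psi> y + \<psi> (2 *\<^sub>R x - y)) / 2 = \<psi> x - (norm (x - y))\<^sup>2"
      using True x by (simp add: \<psi>_def)
    then show ?thesis by simp
  next
    case False
    \<comment> \<open>At least one of the two points lies outside \<open>B\<close>, so the average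
      is at most \<open>2 * R\<^sup>2\<close>, whereas \<open>\<psi> x\<close> is at least
      \<open>3 * R\<^sup>2\<close>. The factor 4 is chosen so that the remaining gap is the
      truncation level \<open>R\<^sup>2\<close>.\<close>
    then have "\<psi> y + \<psi> (2 *\<^sub>R x - y) \<le> 4 * R\<^sup>2"
      using zero_le_power2[of "norm y"] zero_le_power2[of "norm (2 *\<^sub>R x - y)"] zero_le_power2[of R]
      by (auto simp: \<psi>_def indicator_def simp del: zero_le_power2)
    then have "(\<psi> y + \<psi> (2 *\<^sub>R x - y)) / 2 \<le> 2 * R\<^sup>2" by simp
    also have "\<dots> \<le> \<psi> x - R\<^sup>2" using nR[OF x] x by (simp add: \<psi>_def)
    also have "\<dots> \<le> \<psi> x - ?c y" by simp
    finally show ?thesis .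
  qed
  have "conv \<psi> x = (\<integral>y. J (x - y) * \<psi> y / 2 + J (x - y) * \<psi> (2 *\<^sub>R x - y) / 2 \<partial>lborel)"
    using i1 i2 eq2 by (subst Bochner_Integration.integral_add) (auto simp: conv_def)
  also have "\<dots> \<le> (\<integral>y. J (x - y) * \<psi> x - J (x - y) * ?c y \<partial>lborel)"
  proof (rule integral_mono)
    show "integrable lborel (\<lambda>y. J (x - y) * \<psi> y / 2 + J (x - y) * \<psi> (2 *\<^sub>R x - y) / 2)" using i1 i2 by simp
    show "integrable lborel (\<lambda>y. J (x - y) * \<psi> x - J (x - y) * ?c y)"
      using i3 integrable_J_diff(1)[of x] by simp
    show "J (x - y) * \<psi> y / 2 + J (x - y) * \<psi> (2 *\<^sub>R x - y) / 2 \<le> J (x - y) * \<psi> x - J (x - y) * ?c y" for y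
      using mult_left_mono[OF point[of y] J_nonneg[of "x - y"]] by (simp add: algebra_simps add_divide_distrib)
  qed
  also have "\<dots> = \<psi> x - (\<integral>y. J (x - y) * ?c y \<partial>lborel)"
    using i3 integrable_J_diff(1)[of x] by (simp add: integral_J_diff)
  also have "(\<integral>y. J (x - y) * ?c y \<partial>lborel) = (\<integral>z. J z * min ((norm z)\<^sup>2) (R\<^sup>2) \<partial>lborel)"
    by (rule integral_lborel_reflect_point(1)[where h="\<lambda>z. J z * min ((norm z)\<^sup>2) (R\<^sup>2)"]) measurable
  finally show ?thesis .
qed

end

context kernel_domain
begin

text \<open>On \<open>B\<close> each sum is 1 plus \<open>conv\<close> of the preceding one, and
  \<open>\<psi> / c\<close> satisfies the corresponding inequality because the barrier drops by at
  least \<open>c\<close> under \<open>conv\<close>; induction compares the two. In probabilistic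
  terms, the expected exit time from a bounded set is bounded.\<close>

lemma sum_survival_bounded: "\<exists>C. \<forall>n x. (\<Sum>k<n. survival k x) \<le> C * indicator B x"
proof -
  obtain R0 where R0: "\<And>x. x \<in> B \<Longrightarrow> norm x \<le> R0"
    using D_bounded B_subset bounded_subset[of D B] by (auto simp: bounded_iff)
  define R where "R = max 1 R0"
  have R: "0 < R" and BR: "B \<subseteq> cball 0 R" using R0 by (auto simp: R_def max_def) (meson order_trans linear)
  define c where "c = (\<integral>z. J z * min ((norm z)\<^sup>2) (R\<^sup>2) \<partial>lborel)"
  have c: "0 < c" unfolding c_def using R by (intro truncated_second_moment_pos) simp
  define \<psi> where "\<psi> x = indicator B x * (4 * R\<^sup>2 - (norm x)\<^sup>2)" for x :: "real^'n"
  have \<psi>m[measurable]: "\<psi> \<in> borel_measurable borel" unfolding \<psi>_def[abs_def] by measurable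
  have \<psi>0: "0 \<le> \<psi> x" for x
  proof (cases "x \<in> B")
    case True
    then have "(norm x)\<^sup>2 \<le> R\<^sup>2" using BR by (intro power_mono) auto
    then have "(norm x)\<^sup>2 \<le> 4 * R\<^sup>2" using zero_le_power2[of R] by linarith
    then show ?thesis using True by (simp add: \<psi>_def)
  qed (simp add: \<psi>_def)
  have \<psi>1: "\<psi> x \<le> 4 * R\<^sup>2 * indicator B x" for x by (auto simp: \<psi>_def indicator_def)
  have \<psi>2: "\<bar>\<psi> x\<bar> \<le> 4 * R\<^sup>2" for x using \<psi>0[of x] \<psi>1[of x] by (cases "x \<in> B") auto
  have barrier: "conv \<psi> x \<le> \<psi> x - c" if "x \<in> B" for x
    using conv_barrier_le[OF B_sets BR that] unfolding c_def \<psi>_def .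
  have key: "(\<Sum>k<n. survival k x) \<le> \<psi> x / c" for n x
  proof (induction n arbitrary: x)
    case 0 then show ?case using \<psi>0 c by simp
  next
    case (Suc n)
    show ?case
    proof (cases "x \<in> B")
      case False then show ?thesis using \<psi>0[of x] c by (simp add: survival_outside)
    next
      case True
      have "(\<Sum>k<Suc n. survival k x) = 1 + (\<Sum>k<n. survival (Suc k) x)"
        using True by (subst sum.lessThan_Suc_shift) simp
      also have "(\<Sum>k<n. survival (Suc k) x) = conv (\<lambda>y. \<Sum>k<n. survival k y) x"
        using True conv_sum[where h=survival and M=1 and I="{..<n}" and c="\<lambda>_. 1" and x=x] survival_abs_le(2) by simp
      also have "\<dots> \<le> conv (\<lambda>y. (1 / c) * \<psi> y) x"
      proof (rule conv_mono)
        show "\<bar>\<Sum>k<n. survival k y\<bar> \<le> (1 / c) * (4 * R\<^sup>2)" for y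
        proof -
          have "0 \<le> (\<Sum>k<n. survival k y)" using survival_bounds(1) by (rule sum_nonneg)
          moreover have "\<psi> y / c \<le> (4 * R\<^sup>2) / c" using \<psi>2[of y] c by (intro divide_right_mono) auto
          ultimately show ?thesis using Suc.IH[of y] by simp
        qed
        show "\<bar>(1 / c) * \<psi> y\<bar> \<le> (1 / c) * (4 * R\<^sup>2)" for y
          using \<psi>2[of y] c by (simp add: abs_mult divide_right_mono)
        show "(\<Sum>k<n. survival k y) \<le> (1 / c) * \<psi> y" for y using Suc.IH[of y] by simp
      qed measurable
      also have "\<dots> = (1 / c) * conv \<psi> x" using conv_sum[where h="\<lambda>_. \<psi>" and M="4 * R\<^sup>2" and I="{0::nat}" and c="\<lambda>_. 1 / c" and x=x] \<psi>2 by simp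
      also have "1 + \<dots> = (c + conv \<psi> x) / c" using c by (simp add: add_divide_distrib)
      also have "\<dots> \<le> \<psi> x / c" using barrier[OF True] c by (intro divide_right_mono) auto
      finally show ?thesis by simp
    qed
  qed
  have "(\<Sum>k<n. survival k x) \<le> (4 * R\<^sup>2 / c) * indicator B x" for n x
  proof -
    have "\<psi> x / c \<le> (4 * R\<^sup>2 * indicator B x) / c" using \<psi>1[of x] c by (intro divide_right_mono) auto
    then show ?thesis using key[where n=n and x=x] by (simp add: mult.commute)
  qed
  then show ?thesis by blast
qed

lemma summable_survival: "summable (\<lambda>n. survival n x)"
proof -
  obtain C where C: "\<And>n x. (\<Sum>k<n. survival k x) \<le> C * indicator B x" using sum_survival_bounded by blast
  show ?thesis using survival_bounds(1) C by (rule summableI_nonneg_bounded)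
qed

text \<open>The solution is a Neumann series, the expected exit time; on \<open>B\<close> its
  convolution is the same series without the first term. Existence gives the choice in
  \<open>torsional_rigidity\<close> a meaning.\<close>

lemma torsion_solution_exists: "\<exists>f. torsion_solution J D f"
proof
  define f where "f x = (\<Sum>n. survival n x)" for x
  obtain C where C: "\<And>n x. (\<Sum>k<n. survival k x) \<le> C * indicator B x" using sum_survival_bounded by blast
  have lim: "(\<lambda>n. \<Sum>k<n. survival k x) \<longlonglongrightarrow> f x" for x
    unfolding f_def using summable_survival by (rule summable_LIMSEQ)
  have S0: "0 \<le> (\<Sum>k<n. survival k x)" for n x using survival_bounds(1) by (rule sum_nonneg)
  have f0: "0 \<le> f x" for x unfolding f_def using summable_survival survival_bounds(1) by (rule suminf_nonneg)
  have fC: "f x \<le> C * indicator B x" for x by (rule LIMSEQ_le_const2[OF lim]) (use C in blast)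
  have fabs: "\<bar>f x\<bar> \<le> C * indicator B x" for x using f0[of x] fC[of x] by simp
  have fm[measurable]: "f \<in> borel_measurable borel" unfolding f_def[abs_def] by measurable
  note f = L2_on_bounded[OF fm fabs]
  have fB: "f x = 0" if "x \<notin> B" for x using fabs[of x] that by simp
  have eq: "conv f x - f x = - 1" if x: "x \<in> B" for x
  proof -
    have "0 \<le> C" using fabs[of x] x by simp
    then have "(\<lambda>n. conv (\<lambda>y. \<Sum>k<n. survival k y) x) \<longlonglongrightarrow> conv f x"
    proof (intro conv_tendsto[where M=C])
      show "\<bar>\<Sum>k<n. survival k y\<bar> \<le> C" if "0 \<le> C" for n y
        using S0[where n=n and x=y] C[where n=n and x=y] that by (cases "y \<in> B") auto
    qed (use lim in measurable)
    moreover have "conv (\<lambda>y. \<Sum>k<n. survival k y) x = (\<Sum>k<Suc n. survival k x) - 1" for n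
      using x conv_sum[where h=survival and M=1 and I="{..<n}" and c="\<lambda>_. 1" and x=x] survival_abs_le(2)
      by (subst sum.lessThan_Suc_shift) simp
    moreover have "(\<lambda>n. (\<Sum>k<Suc n. survival k x) - 1) \<longlonglongrightarrow> f x - 1"
      using LIMSEQ_Suc[OF lim] by (intro tendsto_intros) simp
    ultimately have "conv f x = f x - 1" using LIMSEQ_unique by fastforce
    then show ?thesis by simp
  qed
  have bd: "x \<in> m_boundary J D \<Longrightarrow> f x = 0" for x
    using fB[of x] B_subset by (auto simp: m_boundary_def)
  show "torsion_solution J D f"
    unfolding torsion_solution_def
  proof (intro conjI)
    show "f \<in> L2_on (m_closure J D)" by (rule f(1))
    show "AE x in lebesgue. x \<in> m_boundary J D \<longrightarrow> f x = 0" using bd by simp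
    then have "AE x in lborel. x \<in> B \<longrightarrow> nonlocal_laplacian J D f x = conv f x - f x"
      by (rule nonlocal_laplacian_represents[OF f(2)])
    then show "AE x in lebesgue. x \<in> D \<longrightarrow> - nonlocal_laplacian J D f x = 1"
      unfolding AE_completion_iff using D_AE by eventually_elim (auto simp: eq)
  qed
qed

text \<open>On \<open>B\<close> the equation reads \<open>g x = 1 + conv g x\<close>. Paired with
  \<open>survival n\<close> it gives \<open>mass n\<close> plus the pairing of \<open>g\<close> with
  \<open>survival (Suc n)\<close>, and these pairings tend to 0 because \<open>survival n x\<close>
  does, being summable. The argument covers every solution, hence also the chosen one.\<close>

lemma torsion_solution_integral:
  assumes f: "torsion_solution J D f"
  shows "mass sums (LINT x:D|lebesgue. f x)"
proof -
  have f0: "AE x in lebesgue. x \<in> m_boundary J D \<longrightarrow> f x = 0"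
    and eq: "AE x in lebesgue. x \<in> D \<longrightarrow> - nonlocal_laplacian J D f x = 1"
    using f by (auto simp: torsion_solution_def)
  obtain g where g: "represents g f" using f represents_L2 by (auto simp: torsion_solution_def)
  have gi: "integrable lborel g" and gB: "\<And>x. x \<notin> B \<Longrightarrow> g x = 0" using g by (auto simp: represents_def)
  have [measurable]: "g \<in> borel_measurable borel" using gi by simp
  have rec: "(\<integral>x. survival n x * g x \<partial>lborel) = mass n + (\<integral>x. survival (Suc n) x * g x \<partial>lborel)" for n
  proof -
    have "(\<integral>x. survival n x * g x \<partial>lborel) = (\<integral>x. survival n x + survival n x * conv g x \<partial>lborel)"
    proof (rule integral_cong_AE)
      show "AE x in lborel. survival n x * g x = survival n x + survival n x * conv g x"
        using nonlocal_laplacian_represents[OF g f0] eq[unfolded AE_completion_iff]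
      proof eventually_elim
        case (elim x)
        show ?case
        proof (cases "x \<in> B")
          case True
          then have "g x = 1 + conv g x" using elim B_subset by auto
          then show ?thesis by (simp add: distrib_left)
        qed (simp add: survival_outside)
      qed
    qed measurable
    also have "\<dots> = mass n + (\<integral>x. survival n x * conv g x \<partial>lborel)"
      unfolding path_mass_def
      by (rule Bochner_Integration.integral_add[OF integrable_survival integral_survival_conv(1)[OF gi gB]])
    also have "(\<integral>x. survival n x * conv g x \<partial>lborel) = (\<integral>x. survival (Suc n) x * g x \<partial>lborel)"
      by (rule integral_survival_conv(2)[OF gi gB])
    finally show ?thesis .
  qed
  have sum: "(\<Sum>k<n. mass k) = (\<integral>x. g x \<partial>lborel) - (\<integral>x. survival n x * g x \<partial>lborel)" for n
  proof (induction n)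
    case 0
    have "(\<integral>x. survival 0 x * g x \<partial>lborel) = (\<integral>x. g x \<partial>lborel)"
      using gB by (intro Bochner_Integration.integral_cong) (auto simp: indicator_def)
    then show ?case by simp
  next
    case (Suc n) then show ?case using rec[of n] by simp
  qed
  have "(\<lambda>n. \<integral>x. survival n x * g x \<partial>lborel) \<longlonglongrightarrow> (\<integral>x. 0 \<partial>(lborel :: (real^'n) measure))"
  proof (rule integral_dominated_convergence[where w="\<lambda>x. \<bar>g x\<bar>"])
    show "AE x in lborel. (\<lambda>n. survival n x * g x) \<longlonglongrightarrow> 0"
      using tendsto_mult_left_zero[OF summable_LIMSEQ_zero[OF summable_survival]] by (intro AE_I2)
    show "\<And>n. AE x in lborel. norm (survival n x * g x) \<le> \<bar>g x\<bar>"
      using survival_abs_le(2) by (auto simp: abs_mult intro!: mult_left_le_one_le)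
  qed (use gi in auto)
  then have "(\<lambda>n. (\<integral>x. g x \<partial>lborel) - (\<integral>x. survival n x * g x \<partial>lborel)) \<longlonglongrightarrow> (\<integral>x. g x \<partial>lborel) - 0"
    by (intro tendsto_intros) simp
  then show ?thesis unfolding sums_def sum represents_integral[OF g] by simp
qed

lemma torsional_rigidity_sums: "mass sums torsional_rigidity J D"
  unfolding torsional_rigidity_def
  by (rule torsion_solution_integral) (rule someI_ex[OF torsion_solution_exists])

end

section \<open>The heat problem\<close>

text \<open>For t \<ge> 0, the expectation of \<open>a\<close> at a Poisson variable of parameter t,
  which is the number of jumps up to time t of a walk that jumps at rate 1.\<close>

definition poisson_mean :: "(nat \<Rightarrow> real) \<Rightarrow> real \<Rightarrow> real" where
  "poisson_mean a t = exp (- t) * (\<Sum>n. a n / fact n * t ^ n)"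

context
  fixes a :: "nat \<Rightarrow> real" and M :: real
  assumes a: "\<And>n. \<bar>a n\<bar> \<le> M"
begin

lemma poisson_terms_le: "\<bar>a n / fact n * t ^ n\<bar> \<le> M * (\<bar>t\<bar> ^ n / fact n)"
proof -
  have "\<bar>a n\<bar> * (\<bar>t\<bar> ^ n / fact n) \<le> M * (\<bar>t\<bar> ^ n / fact n)" using a by (intro mult_right_mono) auto
  then show ?thesis by (simp add: abs_mult power_abs)
qed

lemma exp_majorant_sums: "(\<lambda>n. M * (\<bar>t\<bar> ^ n / fact n)) sums (M * exp \<bar>t\<bar>)"
  using sums_mult[OF exp_converges[of "\<bar>t\<bar>"], of M] by (simp add: divide_inverse mult.commute)

lemma summable_poisson: "summable (\<lambda>n. a n / fact n * t ^ n)"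
proof (rule summable_comparison_test'[OF sums_summable[OF exp_majorant_sums], of 0])
  show "norm (a n / fact n * t ^ n) \<le> M * (\<bar>t\<bar> ^ n / fact n)" for n
    unfolding real_norm_def by (rule poisson_terms_le)
qed

lemma poisson_partial_sums_le: "\<bar>\<Sum>n<k. a n / fact n * t ^ n\<bar> \<le> M * exp \<bar>t\<bar>"
proof -
  have M: "0 \<le> M" using a[of 0] by linarith
  have "\<bar>\<Sum>n<k. a n / fact n * t ^ n\<bar> \<le> (\<Sum>n<k. M * (\<bar>t\<bar> ^ n / fact n))"
    using poisson_terms_le by (intro order_trans[OF sum_abs] sum_mono)
  also have "\<dots> \<le> (\<Sum>n. M * (\<bar>t\<bar> ^ n / fact n))"
    using M by (intro sum_le_suminf sums_summable[OF exp_majorant_sums]) auto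
  also have "\<dots> = M * exp \<bar>t\<bar>" using exp_majorant_sums by (rule sums_unique[symmetric])
  finally show ?thesis .
qed

lemma poisson_mean_le: "0 \<le> t \<Longrightarrow> \<bar>poisson_mean a t\<bar> \<le> M"
proof -
  assume t: "0 \<le> t"
  have "\<bar>\<Sum>n. a n / fact n * t ^ n\<bar> \<le> M * exp \<bar>t\<bar>"
    by (rule LIMSEQ_le_const2[OF tendsto_rabs[OF summable_LIMSEQ[OF summable_poisson]]])
       (use poisson_partial_sums_le in blast)
  then have "exp (- t) * \<bar>\<Sum>n. a n / fact n * t ^ n\<bar> \<le> exp (- t) * (M * exp t)"
    using t by (intro mult_left_mono) auto
  also have "exp (- t) * (M * exp t) = M" by (simp add: exp_minus)
  finally show ?thesis by (simp only: poisson_mean_def abs_mult abs_exp_cancel)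
qed

lemma poisson_mean_partial_sums: "(\<lambda>k. exp (- t) * (\<Sum>n<k. a n / fact n * t ^ n)) \<longlonglongrightarrow> poisson_mean a t"
  unfolding poisson_mean_def by (intro tendsto_intros summable_LIMSEQ summable_poisson)

end

lemma poisson_mean_0: "poisson_mean a 0 = a 0"
  unfolding poisson_mean_def powser_zero[of "\<lambda>n. a n / fact n"] by simp

lemma poisson_mean_diff:
  assumes "\<And>n. \<bar>a n\<bar> \<le> M" "\<And>n. \<bar>b n\<bar> \<le> N"
  shows "poisson_mean a t - poisson_mean b t = poisson_mean (\<lambda>n. a n - b n) t"
  unfolding poisson_mean_def right_diff_distrib[symmetric]
    suminf_diff[OF summable_poisson[of a, OF assms(1)] summable_poisson[of b, OF assms(2)]]
  by (simp add: diff_divide_distrib left_diff_distrib)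

text \<open>Differentiating the series shifts the coefficients, and differentiating
  \<open>exp (- t)\<close> subtracts the original ones. For \<open>a n = survival n x\<close> with
  \<open>x\<close> in \<open>B\<close>, the forward difference is
  \<open>conv (survival n) x - survival n x\<close>, which is the heat equation.\<close>

lemma poisson_mean_deriv:
  assumes a: "\<And>n. \<bar>a n\<bar> \<le> M"
  shows "(poisson_mean a has_real_derivative poisson_mean (\<lambda>n. a (Suc n) - a n) t) (at t)"
proof -
  have "diffs (\<lambda>n. a n / fact n) = (\<lambda>n. a (Suc n) / fact n)"
    by (rule ext) (simp add: diffs_def del: of_nat_Suc)
  then have *: "((\<lambda>t. \<Sum>n. a n / fact n * t ^ n) has_real_derivative (\<Sum>n. a (Suc n) / fact n * t ^ n)) (at t)"
    using termdiffs_strong_converges_everywhere[OF summable_poisson[of a, OF a], of t] by simp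
  have "(poisson_mean a has_real_derivative
      exp (- t) * (\<Sum>n. a (Suc n) / fact n * t ^ n) - exp (- t) * (\<Sum>n. a n / fact n * t ^ n)) (at t)"
    unfolding poisson_mean_def[abs_def] by (rule derivative_eq_intros * refl | simp)+
  then show ?thesis
    using poisson_mean_diff[of "\<lambda>n. a (Suc n)" M a M t] a by (simp add: poisson_mean_def)
qed

lemma poisson_mean_lipschitz:
  assumes a: "\<And>n. \<bar>a n\<bar> \<le> M" and "0 \<le> s" "0 \<le> t"
  shows "\<bar>poisson_mean a s - poisson_mean a t\<bar> \<le> 2 * M * \<bar>s - t\<bar>"
proof -
  have d: "\<bar>a (Suc n) - a n\<bar> \<le> 2 * M" for n using a[of n] a[of "Suc n"] by linarith
  show ?thesis
    using field_differentiable_bound[of "{0..}" "poisson_mean a" "poisson_mean (\<lambda>n. a (Suc n) - a n)" "2 * M" s t]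
      has_field_derivative_at_within[OF poisson_mean_deriv[of a, OF a]]
      poisson_mean_le[of "\<lambda>n. a (Suc n) - a n", OF d] assms(2,3) by auto
qed

text \<open>The mean value theorem turns the quotient into the derivative at an intermediate point.
  Forward differences are bounded by 2, so their Poisson mean is 4-Lipschitz; the bound does not
  depend on \<open>a\<close>, so for \<open>a n = survival n x\<close> it is uniform in
  \<open>x\<close>.\<close>

lemma poisson_mean_quotient:
  assumes a: "\<And>n. \<bar>a n\<bar> \<le> 1" and s: "0 < s" and t: "0 < t" and False: "s \<noteq> t"
  shows "\<bar>(poisson_mean a s - poisson_mean a t) / (s - t) - poisson_mean (\<lambda>n. a (Suc n) - a n) t\<bar> \<le> 4 * \<bar>s - t\<bar>"
proof -
  let ?d = "\<lambda>n. a (Suc n) - a n"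
  have d: "\<bar>?d n\<bar> \<le> 2" for n using a[of n] a[of "Suc n"] by linarith
  obtain z where z: "min s t < z" "z < max s t"
    "poisson_mean a (max s t) - poisson_mean a (min s t) = (max s t - min s t) * poisson_mean ?d z"
    using MVT2[of "min s t" "max s t" "poisson_mean a" "poisson_mean ?d"] poisson_mean_deriv[of a, OF a] False
    by (metis max_def min_def less_eq_real_def linorder_less_linear not_le)
  have q: "(poisson_mean a s - poisson_mean a t) / (s - t) = poisson_mean ?d z"
    using z(3) False by (cases "s \<le> t") (auto simp: max_def min_def field_simps)
  have "\<bar>poisson_mean ?d z - poisson_mean ?d t\<bar> \<le> 2 * 2 * \<bar>z - t\<bar>"
    by (rule poisson_mean_lipschitz[OF d]) (use z(1) s t in auto)
  moreover have "\<bar>z - t\<bar> \<le> \<bar>s - t\<bar>" using z(1,2) by (auto simp: max_def min_def split: if_splits)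
  ultimately show ?thesis unfolding q by simp
qed

context kernel_domain
begin

text \<open>On \<open>B\<close>, which has finite measure, a uniform bound gives an L2 bound, and
  \<open>D\<close> and \<open>B\<close> differ by a null set.\<close>

lemma tendsto_L2_on_bound:
  assumes h: "\<forall>\<^sub>F s in F. AE x in lborel. x \<in> B \<longrightarrow> \<bar>u s x - w x\<bar> \<le> h s" and lim: "(h \<longlongrightarrow> 0) F"
  shows "tendsto_L2_on D u w F"
  unfolding tendsto_L2_on_def
proof (rule tendsto_sandwich)
  show "\<forall>\<^sub>F s in F. 0 \<le> (\<integral>\<^sup>+x\<in>D. ennreal ((u s x - w x)\<^sup>2) \<partial>lebesgue)" by simp
  show "\<forall>\<^sub>F s in F. (\<integral>\<^sup>+x\<in>D. ennreal ((u s x - w x)\<^sup>2) \<partial>lebesgue) \<le> ennreal ((h s)\<^sup>2 * measure lborel B)"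
    using h
  proof eventually_elim
    case (elim s)
    have "(\<integral>\<^sup>+x\<in>D. ennreal ((u s x - w x)\<^sup>2) \<partial>lebesgue) \<le> (\<integral>\<^sup>+x. ennreal ((h s)\<^sup>2 * indicator B x) \<partial>lebesgue)"
    proof (rule nn_integral_mono_AE)
      show "AE x in lebesgue. ennreal ((u s x - w x)\<^sup>2) * indicator D x \<le> ennreal ((h s)\<^sup>2 * indicator B x)"
        unfolding AE_completion_iff using elim D_AE
      proof eventually_elim
        case (elim x)
        show ?case
        proof (cases "x \<in> D")
          case True
          then have x: "x \<in> B" using elim by simp
          have "\<bar>u s x - w x\<bar>\<^sup>2 \<le> (h s)\<^sup>2" using elim x by (intro power_mono) auto
          then show ?thesis using x True by (simp add: ennreal_leI)
        qed simp
      qed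
    qed
    also have "\<dots> = (\<integral>\<^sup>+x. ennreal ((h s)\<^sup>2 * indicator B x) \<partial>lborel)" by (rule nn_integral_completion)
    also have "\<dots> = ennreal ((h s)\<^sup>2 * measure lborel B)"
      using indicator_B(1) by (subst nn_integral_eq_integral) auto
    finally show ?case .
  qed
  have "((\<lambda>s. ennreal ((h s)\<^sup>2 * measure lborel B)) \<longlongrightarrow> ennreal (0\<^sup>2 * measure lborel B)) F"
    by (intro tendsto_ennrealI tendsto_intros lim)
  then show "((\<lambda>s. ennreal ((h s)\<^sup>2 * measure lborel B)) \<longlongrightarrow> 0) F" by simp
qed simp

text \<open>The candidate is the Poisson mean of \<open>survival n x\<close>, the probability that
  the rate-1 walk from \<open>x\<close> has not left \<open>B\<close> by time t. The heat equation
  follows once \<open>conv\<close> is exchanged with the series.\<close>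

lemma heat_solution_exists: "\<exists>v. heat_solution J D v"
proof
  define v where "v t x = poisson_mean (\<lambda>n. survival n x) t" for t x
  have sb: "\<bar>survival n x\<bar> \<le> 1" for n x by (rule survival_abs_le)
  have vB: "v t x = 0" if "x \<notin> B" for t x
    using that by (simp add: v_def poisson_mean_def survival_outside)
  have vm[measurable]: "v t \<in> borel_measurable borel" for t
    unfolding v_def[abs_def] poisson_mean_def by measurable
  \<comment> \<open>A bound independent of \<open>k\<close> and \<open>x\<close> lets the series
    pass through \<open>conv\<close> by dominated convergence; \<open>exp \<bar>t\<bar>\<close>
    accounts for \<open>t\<close> of either sign.\<close>
  have partial_le: "\<bar>exp (- t) * (\<Sum>n<k. survival n x / fact n * t ^ n)\<bar> \<le> exp (- t) * exp \<bar>t\<bar>" for t k x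
    using poisson_partial_sums_le[of "\<lambda>n. survival n x" 1 t k, OF sb] by (simp add: abs_mult)
  have v_le: "\<bar>v t x\<bar> \<le> (exp (- t) * exp \<bar>t\<bar>) * indicator B x" for t x
  proof (cases "x \<in> B")
    case True
    have "\<bar>v t x\<bar> \<le> exp (- t) * exp \<bar>t\<bar>" unfolding v_def
      by (rule LIMSEQ_le_const2[OF tendsto_rabs[OF poisson_mean_partial_sums[OF sb]]]) (use partial_le in blast)
    then show ?thesis using True by simp
  qed (simp add: vB)
  note v = L2_on_bounded[OF vm v_le]
  have cb: "\<bar>conv (survival n) x\<bar> \<le> 1" for n x
    using conv_path_weight_bounds[OF indicator_B, of n x] by simp
  have conv_v: "conv (v t) x = poisson_mean (\<lambda>n. conv (survival n) x) t" for t x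
  proof (rule LIMSEQ_unique)
    show "(\<lambda>k. conv (\<lambda>y. exp (- t) * (\<Sum>n<k. survival n y / fact n * t ^ n)) x) \<longlonglongrightarrow> conv (v t) x"
    proof (rule conv_tendsto)
      show "(\<lambda>k. exp (- t) * (\<Sum>n<k. survival n y / fact n * t ^ n)) \<longlonglongrightarrow> v t y" for y
        unfolding v_def by (rule poisson_mean_partial_sums[OF sb])
    qed (measurable, rule partial_le)
    have "conv (\<lambda>y. exp (- t) * (\<Sum>n<k. survival n y / fact n * t ^ n)) x
        = exp (- t) * (\<Sum>n<k. conv (survival n) x / fact n * t ^ n)" for k
      using conv_sum[where h=survival and M=1 and I="{..<k}" and c="\<lambda>n. exp (- t) * (t ^ n / fact n)" and x=x] sb
      by (simp add: sum_distrib_left mult_ac divide_inverse)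
    then show "(\<lambda>k. conv (\<lambda>y. exp (- t) * (\<Sum>n<k. survival n y / fact n * t ^ n)) x) \<longlonglongrightarrow> poisson_mean (\<lambda>n. conv (survival n) x) t"
      using poisson_mean_partial_sums[of "\<lambda>n. conv (survival n) x" 1 t, OF cb] by simp
  qed
  have bd: "x \<in> m_boundary J D \<Longrightarrow> v t x = 0" for t x
    using vB[of x] B_subset by (auto simp: m_boundary_def)
  \<comment> \<open>On \<open>B\<close>, \<open>conv (survival n) x = survival (Suc n) x\<close>, so
    the Laplacian becomes the Poisson mean of forward differences, as in
    \<open>poisson_mean_deriv\<close>.\<close>
  have lap: "AE x in lborel. x \<in> B \<longrightarrow> nonlocal_laplacian J D (v t) x = poisson_mean (\<lambda>n. survival (Suc n) x - survival n x) t" for t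
  proof -
    have "AE x in lborel. x \<in> B \<longrightarrow> nonlocal_laplacian J D (v t) x = conv (v t) x - v t x"
      by (rule nonlocal_laplacian_represents[OF v(2)]) (use bd in simp)
    then show ?thesis
    proof eventually_elim
      case (elim x)
      then show ?case
        using poisson_mean_diff[of "\<lambda>n. conv (survival n) x" 1 "\<lambda>n. survival n x" 1 t] cb sb
        by (simp add: conv_v v_def)
    qed
  qed
  show "heat_solution J D v"
    unfolding heat_solution_def
  proof (intro conjI allI impI)
    fix t :: real
    show "v t \<in> L2_on (m_closure J D)" by (rule v(1))
    show "AE x in lebesgue. x \<in> m_boundary J D \<longrightarrow> v t x = 0" using bd by simp
    assume t: "0 < t"
    show "tendsto_L2_on D (\<lambda>s x. (v s x - v t x) / (s - t)) (nonlocal_laplacian J D (v t)) (at t)"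
    proof (rule tendsto_L2_on_bound[where h="\<lambda>s. 4 * \<bar>s - t\<bar>"])
      have "\<forall>\<^sub>F s in at t. 0 < s \<and> s \<noteq> t"
        using t by (intro eventually_conj order_tendstoD(1)[OF tendsto_ident_at] eventually_neq_at_within)
      then show "\<forall>\<^sub>F s in at t. AE x in lborel. x \<in> B \<longrightarrow>
          \<bar>(v s x - v t x) / (s - t) - nonlocal_laplacian J D (v t) x\<bar> \<le> 4 * \<bar>s - t\<bar>"
      proof eventually_elim
        case (elim s)
        show ?case using lap[of t]
        proof eventually_elim
          case (elim x)
          then show ?case
            using poisson_mean_quotient[of "\<lambda>n. survival n x" s t, OF sb] \<open>0 < s \<and> s \<noteq> t\<close> t by (simp add: v_def del: path_weight.simps)
        qed
      qed
      have "((\<lambda>s. 4 * \<bar>s - t\<bar>) \<longlongrightarrow> 4 * \<bar>t - t\<bar>) (at t)" by (intro tendsto_intros)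
      then show "((\<lambda>s. 4 * \<bar>s - t\<bar>) \<longlongrightarrow> 0) (at t)" by simp
    qed
  next
    show "AE x in lebesgue. x \<in> D \<longrightarrow> v 0 x = 1"
      unfolding AE_completion_iff using D_AE by eventually_elim (auto simp: v_def poisson_mean_0)
    show "tendsto_L2_on D v (v 0) (at_right 0)"
    proof (rule tendsto_L2_on_bound[where h="\<lambda>s. 2 * \<bar>s\<bar>"])
      have "\<forall>\<^sub>F s in at_right (0::real). 0 < s" by (simp add: eventually_at_right_less)
      then show "\<forall>\<^sub>F s in at_right 0. AE x in lborel. x \<in> B \<longrightarrow> \<bar>v s x - v 0 x\<bar> \<le> 2 * \<bar>s\<bar>"
      proof eventually_elim
        case (elim s)
        then show ?case
          using poisson_mean_lipschitz[of "\<lambda>n. survival n x" 1 s 0 for x, OF sb] by (auto simp: v_def)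
      qed
      have "((\<lambda>s::real. 2 * \<bar>s\<bar>) \<longlongrightarrow> 2 * \<bar>0\<bar>) (at_right 0)" by (intro tendsto_intros)
      then show "((\<lambda>s::real. 2 * \<bar>s\<bar>) \<longlongrightarrow> 0) (at_right 0)" by simp
    qed
  qed
qed

end

text \<open>\<open>G k s\<close> is the Taylor polynomial of \<open>b 0\<close> based at
  \<open>s\<close> and evaluated at \<open>t\<close>. Its derivative in \<open>s\<close> telescopes
  to a single term, and the mean value theorem bounds the remainder by
  \<open>t * C * (t ^ k / fact k)\<close>; a bound \<open>C\<close> common to all orders makes this
  tend to 0.\<close>

lemma taylor_chain_sums:
  fixes b :: "nat \<Rightarrow> real \<Rightarrow> real"
  assumes t: "0 < t" and cont: "\<And>n. continuous_on {0..t} (b n)"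
    and deriv: "\<And>n s. 0 < s \<Longrightarrow> s \<le> t \<Longrightarrow> (b n has_real_derivative b (Suc n) s) (at s)"
    and bound: "\<And>n s. 0 \<le> s \<Longrightarrow> s \<le> t \<Longrightarrow> \<bar>b n s\<bar> \<le> C"
  shows "(\<lambda>n. b n 0 * (t ^ n / fact n)) sums b 0 t"
proof -
  define G where "G k s = (\<Sum>n<k. b n s * ((t - s) ^ n / fact n))" for k s
  have G_deriv: "(G (Suc k) has_real_derivative b (Suc k) s * ((t - s) ^ k / fact k)) (at s)" if s: "0 < s" "s \<le> t" for k s
  proof (induction k)
    case 0
    show ?case unfolding G_def by (simp add: deriv[OF s])
  next
    case (Suc k)
    have G_Suc: "G (Suc (Suc k)) = (\<lambda>s. G (Suc k) s + b (Suc k) s * ((t - s) ^ Suc k / fact (Suc k)))"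
      by (rule ext) (simp add: G_def)
    have p: "((\<lambda>s. (t - s) ^ Suc k / fact (Suc k)) has_real_derivative - ((t - s) ^ k / fact k)) (at s)"
    proof -
      have "((\<lambda>s. t - s) has_real_derivative - 1) (at s)" by (auto intro!: derivative_eq_intros)
      from DERIV_cdivide[OF DERIV_power[OF this, of "Suc k"], of "fact (Suc k)"]
      have "((\<lambda>s. (t - s) ^ Suc k / fact (Suc k)) has_real_derivative (real (Suc k) * (- 1 * (t - s) ^ k)) / fact (Suc k)) (at s)"
        by (simp del: of_nat_Suc fact_Suc power_Suc)
      moreover have "(real (Suc k) * (- 1 * (t - s) ^ k)) / fact (Suc k) = - ((t - s) ^ k / fact k)"
        by (simp del: of_nat_Suc)
      ultimately show ?thesis by (simp only:)
    qed
    show ?case unfolding G_Suc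
      using DERIV_add[OF Suc.IH DERIV_mult[OF deriv[OF s, of "Suc k"] p]] by (simp add: algebra_simps)
  qed
  have G_cont: "continuous_on {0..t} (G k)" for k
    unfolding G_def by (intro continuous_intros cont) auto
  \<comment> \<open>Only the term of index 0 survives at \<open>s = t\<close>, since
    \<open>0 ^ 0 = 1\<close>; the successor ensures that this term is present.\<close>
  have G_t: "G (Suc k) t = b 0 t" for k
    unfolding G_def by (subst sum.lessThan_Suc_shift) simp
  have C: "0 \<le> C" using bound[of 0 0] t by linarith
  have diff: "\<bar>b 0 t - G (Suc k) 0\<bar> \<le> t * C * (t ^ k / fact k)" for k
  proof -
    have "G (Suc k) differentiable (at s)" if "0 < s" "s < t" for s
      using G_deriv[of s k] that by (auto simp: real_differentiable_def)
    from MVT[OF t G_cont this] obtain l z where z: "0 < z" "z < t"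
      "(G (Suc k) has_real_derivative l) (at z)" "G (Suc k) t - G (Suc k) 0 = (t - 0) * l" by blast
    have l: "l = b (Suc k) z * ((t - z) ^ k / fact k)"
      using DERIV_unique[OF z(3) G_deriv[OF z(1), of k]] z(2) by simp
    have "\<bar>l\<bar> \<le> C * (t ^ k / fact k)"
      unfolding l abs_mult using z(1,2) bound[of z "Suc k"] C
      by (intro mult_mono) (auto simp: power_abs intro!: divide_right_mono power_mono)
    then have "t * \<bar>l\<bar> \<le> t * (C * (t ^ k / fact k))" using t by (intro mult_left_mono) auto
    then show ?thesis using z(4) t by (simp add: G_t abs_mult mult.assoc)
  qed
  have "(\<lambda>k. t * C * (t ^ k / fact k)) \<longlonglongrightarrow> t * C * 0"
  proof (intro tendsto_intros)
    show "(\<lambda>k. t ^ k / fact k) \<longlonglongrightarrow> 0"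
      using summable_LIMSEQ_zero[OF summable_exp[of t]] by (simp add: divide_inverse mult.commute)
  qed
  then have "(\<lambda>k. t * C * (t ^ k / fact k)) \<longlonglongrightarrow> 0" by simp
  then have "(\<lambda>k. b 0 t - G (Suc k) 0) \<longlonglongrightarrow> 0"
    by (rule Lim_null_comparison[rotated]) (use diff in auto)
  then have "(\<lambda>k. b 0 t - (b 0 t - G (Suc k) 0)) \<longlonglongrightarrow> b 0 t - 0" by (intro tendsto_intros)
  then have "(\<lambda>k. G (Suc k) 0) \<longlonglongrightarrow> b 0 t" by simp
  then have "(\<lambda>k. G k 0) \<longlonglongrightarrow> b 0 t" by (rule LIMSEQ_imp_Suc)
  then show ?thesis by (simp add: sums_def G_def)
qed

section \<open>Integrals of arbitrary heat solutions\<close>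

context kernel_domain
begin

lemma represents_diff_nn_integral:
  assumes U: "represents U u" and W: "represents W w"
  shows "(\<integral>\<^sup>+x\<in>D. ennreal ((u x - w x)\<^sup>2) \<partial>lebesgue) = (\<integral>\<^sup>+x. ennreal ((U x - W x)\<^sup>2) \<partial>lborel)"
proof -
  have "AE x in lborel. x \<in> B \<longrightarrow> U x = u x" "AE x in lborel. x \<in> B \<longrightarrow> W x = w x"
    using U W by (simp_all add: represents_def)
  then have "AE x in lebesgue. ennreal ((u x - w x)\<^sup>2) * indicator D x = ennreal ((U x - W x)\<^sup>2)"
    unfolding AE_completion_iff using D_AE
  proof eventually_elim
    case (elim x)
    have "x \<notin> B \<Longrightarrow> U x = 0 \<and> W x = 0" using U W by (simp add: represents_def)
    then show ?case using elim B_subset by (cases "x \<in> B") (auto simp: indicator_def)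
  qed
  then have "(\<integral>\<^sup>+x\<in>D. ennreal ((u x - w x)\<^sup>2) \<partial>lebesgue) = (\<integral>\<^sup>+x. ennreal ((U x - W x)\<^sup>2) \<partial>lebesgue)"
    by (rule nn_integral_cong_AE)
  then show ?thesis by (simp only: nn_integral_completion)
qed

text \<open>On the bounded set \<open>B\<close>, \<open>|z| \<le> \<eta> + z\<^sup>2 / \<eta>\<close> replaces the Cauchy-Schwarz inequality.\<close>

lemma tendsto_L1_of_L2:
  assumes lim: "tendsto_L2_on D u w F" and W: "represents W w"
    and U: "\<forall>\<^sub>F s in F. represents (U s) (u s)"
  shows "((\<lambda>s. \<integral>x. \<bar>U s x - W x\<bar> \<partial>lborel) \<longlongrightarrow> 0) F"
proof (rule tendstoI)
  fix \<epsilon> :: real assume \<epsilon>: "0 < \<epsilon>"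
  define m where "m = measure lborel B"
  have m: "0 \<le> m" by (simp add: m_def)
  \<comment> \<open>This keeps \<open>\<eta> * m\<close> below \<open>\<epsilon> / 2\<close>, the 1
    avoiding division by zero. The L2 integral is required to be below
    \<open>\<epsilon> * \<eta> / 2\<close> because it gets divided by \<eta>.\<close>
  define \<eta> where "\<eta> = \<epsilon> / (2 * (m + 1))"
  have \<eta>: "0 < \<eta>" using \<epsilon> m by (simp add: \<eta>_def)
  have "\<eta> * m + \<epsilon> / 2 < \<eta> * (m + 1) + \<epsilon> / 2" using \<eta> by simp
  also have "\<dots> = \<epsilon>" using m by (simp add: \<eta>_def field_simps)
  finally have small: "\<eta> * m + \<epsilon> / 2 < \<epsilon>" .
  have "\<forall>\<^sub>F s in F. (\<integral>\<^sup>+x\<in>D. ennreal ((u s x - w x)\<^sup>2) \<partial>lebesgue) < ennreal (\<epsilon> * \<eta> / 2)"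
    using lim \<epsilon> \<eta> unfolding tendsto_L2_on_def by (intro order_tendstoD) auto
  then show "\<forall>\<^sub>F s in F. dist (\<integral>x. \<bar>U s x - W x\<bar> \<partial>lborel) 0 < \<epsilon>"
    using U
  proof eventually_elim
    case (elim s)
    have [measurable]: "U s \<in> borel_measurable borel" "W \<in> borel_measurable borel"
      using W elim(2) by (auto simp: represents_def)
    have int: "integrable lborel (\<lambda>x. \<bar>U s x - W x\<bar>)"
      using W elim(2) by (auto simp: represents_def)
    have "ennreal (\<integral>x. \<bar>U s x - W x\<bar> \<partial>lborel) = (\<integral>\<^sup>+x. ennreal \<bar>U s x - W x\<bar> \<partial>lborel)"
      using int by (intro nn_integral_eq_integral[symmetric]) auto
    also have "\<dots> \<le> (\<integral>\<^sup>+x. ennreal (\<eta> * indicator B x) + ennreal (1 / \<eta>) * ennreal ((U s x - W x)\<^sup>2) \<partial>lborel)"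
    proof (rule nn_integral_mono)
      fix x
      let ?z = "U s x - W x"
      have "\<bar>?z\<bar> \<le> \<eta> * indicator B x + (1 / \<eta>) * ?z\<^sup>2"
      proof (cases "x \<in> B")
        case True
        have "\<bar>?z\<bar> \<le> \<eta> + (1 / \<eta>) * ?z\<^sup>2"
        proof (cases "\<bar>?z\<bar> \<le> \<eta>")
          case True
          then show ?thesis using \<eta> by (simp add: add_increasing2)
        next
          case False
          then have "\<bar>?z\<bar> * \<eta> \<le> \<bar>?z\<bar> * \<bar>?z\<bar>" by (intro mult_left_mono) auto
          then have "\<bar>?z\<bar> \<le> ?z\<^sup>2 / \<eta>" using \<eta> by (simp add: field_simps power2_eq_square)
          then show ?thesis using \<eta> by simp
        qed
        then show ?thesis using True by simp
      next
        case False
        then show ?thesis using W elim(2) by (simp add: represents_def)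
      qed
      then show "ennreal \<bar>?z\<bar> \<le> ennreal (\<eta> * indicator B x) + ennreal (1 / \<eta>) * ennreal (?z\<^sup>2)"
        using \<eta> by (simp add: ennreal_leI flip: ennreal_mult ennreal_plus)
    qed
    also have "\<dots> = (\<integral>\<^sup>+x. ennreal (\<eta> * indicator B x) \<partial>lborel) + ennreal (1 / \<eta>) * (\<integral>\<^sup>+x. ennreal ((U s x - W x)\<^sup>2) \<partial>lborel)"
      by (subst nn_integral_add) (auto simp: nn_integral_cmult)
    also have "(\<integral>\<^sup>+x. ennreal (\<eta> * indicator B x) \<partial>lborel) = ennreal (\<eta> * m)"
      using indicator_B(1) \<eta> by (subst nn_integral_eq_integral) (auto simp: m_def)
    also have "(\<integral>\<^sup>+x. ennreal ((U s x - W x)\<^sup>2) \<partial>lborel) = (\<integral>\<^sup>+x\<in>D. ennreal ((u s x - w x)\<^sup>2) \<partial>lebesgue)"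
      by (rule represents_diff_nn_integral[OF elim(2) W, symmetric])
    also have "ennreal (\<eta> * m) + ennreal (1 / \<eta>) * \<dots> \<le> ennreal (\<eta> * m) + ennreal (1 / \<eta>) * ennreal (\<epsilon> * \<eta> / 2)"
      using elim(1) by (intro add_left_mono mult_left_mono) auto
    also have "\<dots> = ennreal (\<eta> * m + \<epsilon> / 2)"
      using \<eta> \<epsilon> m by (simp flip: ennreal_mult ennreal_plus)
    finally have "(\<integral>x. \<bar>U s x - W x\<bar> \<partial>lborel) \<le> \<eta> * m + \<epsilon> / 2"
      using \<eta> \<epsilon> m by (subst (asm) ennreal_le_iff) auto
    moreover have "0 \<le> (\<integral>x. \<bar>U s x - W x\<bar> \<partial>lborel)" by simp
    ultimately show ?case using small by (simp add: dist_real_def)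
  qed
qed

text \<open>L2 convergence on \<open>D\<close> gives L1 convergence of the versions, and both
  functionals are 1-Lipschitz for the L1 norm, as \<open>survival n\<close> is bounded by 1.\<close>

lemma tendsto_integral_of_L2:
  assumes lim: "tendsto_L2_on D u w F" and W: "represents W w"
    and U: "\<forall>\<^sub>F s in F. represents (U s) (u s)"
  shows "((\<lambda>s. \<integral>x. survival n x * U s x \<partial>lborel) \<longlongrightarrow> (\<integral>x. survival n x * W x \<partial>lborel)) F"
    and "((\<lambda>s. \<integral>x. \<bar>U s x\<bar> \<partial>lborel) \<longlongrightarrow> (\<integral>x. \<bar>W x\<bar> \<partial>lborel)) F"
proof -
  have Wi: "integrable lborel W" using W by (simp add: represents_def)
  have 1: "\<forall>\<^sub>F s in F. norm ((\<integral>x. survival n x * U s x \<partial>lborel) - (\<integral>x. survival n x * W x \<partial>lborel))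
      \<le> (\<integral>x. \<bar>U s x - W x\<bar> \<partial>lborel)"
    using U
  proof eventually_elim
    case (elim s)
    then have Ui: "integrable lborel (U s)" by (simp add: represents_def)
    have "(\<integral>x. survival n x * U s x \<partial>lborel) - (\<integral>x. survival n x * W x \<partial>lborel)
        = (\<integral>x. survival n x * (U s x - W x) \<partial>lborel)"
      using integrable_survival_mult[OF Ui, of n] integrable_survival_mult[OF Wi, of n]
      by (simp add: right_diff_distrib)
    also have "norm \<dots> \<le> (\<integral>x. norm (survival n x * (U s x - W x)) \<partial>lborel)" by (rule integral_norm_bound)
    also have "\<dots> \<le> (\<integral>x. \<bar>U s x - W x\<bar> \<partial>lborel)"
    proof (rule integral_mono)
      show "integrable lborel (\<lambda>x. norm (survival n x * (U s x - W x)))"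
        using integrable_survival_mult[of "\<lambda>x. U s x - W x" n] Ui Wi by (intro integrable_norm) simp
      show "integrable lborel (\<lambda>x. \<bar>U s x - W x\<bar>)" using Ui Wi by auto
      show "norm (survival n x * (U s x - W x)) \<le> \<bar>U s x - W x\<bar>" for x
        using survival_abs_le(2)[of n x] by (auto simp: abs_mult intro!: mult_left_le_one_le)
    qed
    finally show ?case .
  qed
  show "((\<lambda>s. \<integral>x. survival n x * U s x \<partial>lborel) \<longlongrightarrow> (\<integral>x. survival n x * W x \<partial>lborel)) F"
    using Lim_null_comparison[OF 1 tendsto_L1_of_L2[OF assms]] by (simp add: LIM_zero_iff)
  have 2: "\<forall>\<^sub>F s in F. norm ((\<integral>x. \<bar>U s x\<bar> \<partial>lborel) - (\<integral>x. \<bar>W x\<bar> \<partial>lborel)) \<le> (\<integral>x. \<bar>U s x - W x\<bar> \<partial>lborel)"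
    using U
  proof eventually_elim
    case (elim s)
    then have Ui: "integrable lborel (U s)" by (simp add: represents_def)
    have "(\<integral>x. \<bar>U s x\<bar> \<partial>lborel) - (\<integral>x. \<bar>W x\<bar> \<partial>lborel) = (\<integral>x. \<bar>U s x\<bar> - \<bar>W x\<bar> \<partial>lborel)"
      using Ui Wi by simp
    also have "norm \<dots> \<le> (\<integral>x. norm (\<bar>U s x\<bar> - \<bar>W x\<bar>) \<partial>lborel)" by (rule integral_norm_bound)
    also have "\<dots> \<le> (\<integral>x. \<bar>U s x - W x\<bar> \<partial>lborel)"
      using Ui Wi by (intro integral_mono) auto
    finally show ?case .
  qed
  show "((\<lambda>s. \<integral>x. \<bar>U s x\<bar> \<partial>lborel) \<longlongrightarrow> (\<integral>x. \<bar>W x\<bar> \<partial>lborel)) F"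
    using Lim_null_comparison[OF 2 tendsto_L1_of_L2[OF assms]] by (simp add: LIM_zero_iff)
qed

text \<open>Tested against \<open>survival n\<close> and multiplied by \<open>exp t\<close>, a heat solution gives functions
  \<open>b n\<close> with \<open>b n' = b (n + 1)\<close> that are bounded uniformly in \<open>n\<close>, so \<open>b 0\<close> is the sum of its Taylor
  series at \<open>0\<close>.\<close>

lemma heat_solution_integral:
  assumes v: "heat_solution J D v" and t: "0 \<le> t"
  shows "(\<lambda>n. mass n * (t ^ n / fact n)) sums (exp t * (LINT x:D|lebesgue. v t x))"
proof -
  have "\<forall>s. \<exists>g. 0 \<le> s \<longrightarrow> represents g (v s)"
    using v represents_L2 unfolding heat_solution_def by blast
  then obtain g where g: "\<And>s. 0 \<le> s \<Longrightarrow> represents (g s) (v s)" by metis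
  have gi: "integrable lborel (g s)" and gB: "x \<notin> B \<Longrightarrow> g s x = 0" if "0 \<le> s" for s x
    using g[OF that] by (auto simp: represents_def)
  define a where "a n s = (\<integral>x. survival n x * g s x \<partial>lborel)" for n s
  \<comment> \<open>The L1 norm bounds all \<open>a n\<close> at once; its maximum over the time
    interval supplies the constant for the Taylor argument.\<close>
  define N where "N s = (\<integral>x. \<bar>g s x\<bar> \<partial>lborel)" for s
  have a_le: "\<bar>a n s\<bar> \<le> N s" if s: "0 \<le> s" for n s
  proof -
    have "\<bar>a n s\<bar> \<le> (\<integral>x. norm (survival n x * g s x) \<partial>lborel)"
      unfolding a_def using integral_norm_bound[of lborel "\<lambda>x. survival n x * g s x"] by simp
    also have "\<dots> \<le> N s" unfolding N_def
    proof (rule integral_mono)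
      show "integrable lborel (\<lambda>x. norm (survival n x * g s x))"
        using integrable_survival_mult[OF gi[OF s]] by (rule integrable_norm)
      show "integrable lborel (\<lambda>x. \<bar>g s x\<bar>)" using gi[OF s] by simp
      show "norm (survival n x * g s x) \<le> \<bar>g s x\<bar>" for x
        using survival_abs_le(2)[of n x] by (auto simp: abs_mult intro!: mult_left_le_one_le)
    qed
    finally show ?thesis .
  qed
  have "AE x in lborel. x \<in> B \<longrightarrow> g 0 x = indicator B x"
  proof -
    have "AE x in lborel. x \<in> B \<longrightarrow> g 0 x = v 0 x" using g[of 0] by (simp add: represents_def)
    moreover have "AE x in lborel. x \<in> D \<longrightarrow> v 0 x = 1"
      using v by (simp add: heat_solution_def AE_completion_iff)
    ultimately show ?thesis by eventually_elim (use B_subset in auto)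
  qed
  then have a0: "a n 0 = mass n" for n
    unfolding a_def path_mass_def
  proof (intro integral_cong_AE)
    assume *: "AE x in lborel. x \<in> B \<longrightarrow> g 0 x = indicator B x"
    show "AE x in lborel. survival n x * g 0 x = survival n x"
      using * by eventually_elim (auto simp: survival_outside)
  qed (use gi[of 0] in auto)
  \<comment> \<open>The zero-extended version of the Laplacian of \<open>v s\<close>; the factor
    \<open>indicator B\<close> removes the mass that \<open>conv\<close> spreads outside
    \<open>B\<close>.\<close>
  define W where "W s x = indicator B x * conv (g s) x - g s x" for s x
  have quot: "represents (\<lambda>x. (g s x - g r x) / (s - r)) (\<lambda>x. (v s x - v r x) / (s - r))" if "0 \<le> s" "0 \<le> r" for s r
  proof -
    have "AE x in lborel. x \<in> B \<longrightarrow> g s x = v s x" "AE x in lborel. x \<in> B \<longrightarrow> g r x = v r x"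
      using g that by (auto simp: represents_def)
    then have "AE x in lborel. x \<in> B \<longrightarrow> (g s x - g r x) / (s - r) = (v s x - v r x) / (s - r)"
      by eventually_elim auto
    then show ?thesis using gi gB that by (auto simp: represents_def)
  qed
  have W: "represents (W s) (nonlocal_laplacian J D (v s))" if s: "0 < s" for s
  proof -
    have "AE x in lborel. x \<in> B \<longrightarrow> nonlocal_laplacian J D (v s) x = conv (g s) x - g s x"
      using v s by (intro nonlocal_laplacian_represents g) (auto simp: heat_solution_def)
    then have "AE x in lborel. x \<in> B \<longrightarrow> W s x = nonlocal_laplacian J D (v s) x"
      by eventually_elim (auto simp: W_def)
    moreover have "integrable lborel (W s)"
      unfolding W_def[abs_def] using gi[of s] s integrable_mult_conv[of "g s" "indicator B" 1]
      by (intro Bochner_Integration.integrable_diff) auto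
    ultimately show ?thesis using gB[of s] s by (auto simp: represents_def W_def)
  qed
  have ev: "\<forall>\<^sub>F r in at s. 0 < r \<and> r \<noteq> s" if "0 < s" for s :: real
    using that by (intro eventually_conj order_tendstoD(1)[OF tendsto_ident_at] eventually_neq_at_within)
  have lim: "tendsto_L2_on D (\<lambda>r x. (v r x - v s x) / (r - s)) (nonlocal_laplacian J D (v s)) (at s)" if "0 < s" for s
    using v that by (simp add: heat_solution_def)
  have quot_ev: "\<forall>\<^sub>F r in at s. represents (\<lambda>x. (g r x - g s x) / (r - s)) (\<lambda>x. (v r x - v s x) / (r - s))" if "0 < s" for s
    using ev[OF that] by eventually_elim (use that in \<open>auto intro!: quot\<close>)
  have a_deriv: "(a n has_real_derivative a (Suc n) s - a n s) (at s)" if s: "0 < s" for n s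
  proof -
    have s0: "0 \<le> s" using s by simp
    have "(\<integral>x. survival n x * W s x \<partial>lborel) = (\<integral>x. survival n x * conv (g s) x - survival n x * g s x \<partial>lborel)"
      by (intro Bochner_Integration.integral_cong) (auto simp: W_def right_diff_distrib indicator_def survival_outside)
    also have "\<dots> = (\<integral>x. survival n x * conv (g s) x \<partial>lborel) - a n s"
      unfolding a_def
      by (intro Bochner_Integration.integral_diff integral_survival_conv(1) integrable_survival_mult gi gB s0)
    also have "(\<integral>x. survival n x * conv (g s) x \<partial>lborel) = a (Suc n) s"
      unfolding a_def by (intro integral_survival_conv(2) gi gB s0)
    finally have W_eq: "(\<integral>x. survival n x * W s x \<partial>lborel) = a (Suc n) s - a n s" .
    have eq: "\<forall>\<^sub>F r in at s. (\<integral>x. survival n x * ((g r x - g s x) / (r - s)) \<partial>lborel) = (a n r - a n s) / (r - s)"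
      using ev[OF s]
    proof eventually_elim
      case (elim r)
      have "(\<integral>x. survival n x * ((g r x - g s x) / (r - s)) \<partial>lborel)
          = (\<integral>x. (survival n x * g r x - survival n x * g s x) / (r - s) \<partial>lborel)"
        by (simp add: right_diff_distrib)
      then show ?case
        using elim integrable_survival_mult[OF gi[of r], of n] integrable_survival_mult[OF gi[of s], of n] s
        by (simp add: a_def)
    qed
    show ?thesis
      unfolding has_field_derivative_iff
      using tendsto_integral_of_L2(1)[OF lim[OF s] W[OF s] quot_ev[OF s], of n]
      by (simp only: W_eq tendsto_cong[OF eq])
  qed
  have lim0: "((\<lambda>s. a n s) \<longlongrightarrow> a n 0) (at_right 0)" "(N \<longlongrightarrow> N 0) (at_right 0)" for n
  proof -
    have "\<forall>\<^sub>F s in at_right 0. represents (g s) (v s)"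
      using eventually_at_right_less[of "0::real"] by eventually_elim (simp add: g)
    moreover have "tendsto_L2_on D v (v 0) (at_right 0)" using v by (simp add: heat_solution_def)
    ultimately show "((\<lambda>s. a n s) \<longlongrightarrow> a n 0) (at_right 0)" "(N \<longlongrightarrow> N 0) (at_right 0)"
      unfolding a_def N_def[abs_def] using tendsto_integral_of_L2[of v "v 0" "at_right 0" "g 0" g] g[of 0] by auto
  qed
  \<comment> \<open>Differentiability forces continuity: the L1 distance of \<open>g r\<close> and
    \<open>g s\<close> is \<open>\<bar>r - s\<bar>\<close> times the L1 norm of the difference
    quotient, which converges.\<close>
  have N_cont: "(N \<longlongrightarrow> N s) (at s)" if s: "0 < s" for s
  proof -
    let ?Q = "\<lambda>r. \<integral>x. \<bar>(g r x - g s x) / (r - s)\<bar> \<partial>lborel"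
    have "((\<lambda>r. \<bar>r - s\<bar> * ?Q r) \<longlongrightarrow> \<bar>s - s\<bar> * (\<integral>x. \<bar>W s x\<bar> \<partial>lborel)) (at s)"
      by (intro tendsto_intros tendsto_integral_of_L2(2)[OF lim[OF s] W[OF s] quot_ev[OF s]])
    then have *: "((\<lambda>r. \<bar>r - s\<bar> * ?Q r) \<longlongrightarrow> 0) (at s)" by simp
    have "\<forall>\<^sub>F r in at s. norm (N r - N s) \<le> \<bar>r - s\<bar> * ?Q r"
      using ev[OF s]
    proof eventually_elim
      case (elim r)
      note i = gi[of r] gi[of s]
      have "N r - N s = (\<integral>x. \<bar>g r x\<bar> - \<bar>g s x\<bar> \<partial>lborel)" unfolding N_def using i elim s by simp
      also have "norm \<dots> \<le> (\<integral>x. norm (\<bar>g r x\<bar> - \<bar>g s x\<bar>) \<partial>lborel)" by (rule integral_norm_bound)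
      also have "\<dots> \<le> (\<integral>x. \<bar>r - s\<bar> * \<bar>(g r x - g s x) / (r - s)\<bar> \<partial>lborel)"
        using i elim s by (intro integral_mono) (auto simp: abs_divide)
      finally show ?case using elim by simp
    qed
    then have "((\<lambda>r. N r - N s) \<longlongrightarrow> 0) (at s)" using * by (rule Lim_null_comparison)
    then show ?thesis by (rule LIM_zero_cancel)
  qed
  have cont: "continuous_on {0..T} f"
    if "\<And>s. 0 < s \<Longrightarrow> (f \<longlongrightarrow> f s) (at s)" "(f \<longlongrightarrow> f 0) (at_right 0)" "0 < T" for f :: "real \<Rightarrow> real" and T
    unfolding continuous_on_def
  proof
    fix s assume s: "s \<in> {0..T}"
    show "(f \<longlongrightarrow> f s) (at s within {0..T})"
    proof (cases "s = 0")
      case True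
      then show ?thesis using that by (simp add: at_within_Icc_at_right)
    next
      case False
      then have "(f \<longlongrightarrow> f s) (at s)" using s that(1) by simp
      then show ?thesis by (rule tendsto_within_subset) simp
    qed
  qed
  have rep: "(LINT x:D|lebesgue. v t x) = a 0 t"
  proof -
    have "(LINT x:D|lebesgue. v t x) = (\<integral>x. g t x \<partial>lborel)" by (rule represents_integral[OF g[OF t]])
    also have "\<dots> = a 0 t" unfolding a_def
      using gB[OF t] by (intro Bochner_Integration.integral_cong) (auto simp: indicator_def)
    finally show ?thesis .
  qed
  show ?thesis
  proof (cases "t = 0")
    case True
    have "(\<lambda>n. mass n * (0 ^ n / fact n)) sums (\<Sum>n\<in>{0}. mass n * (0 ^ n / fact n))"
      by (rule sums_finite) auto
    then show ?thesis using True rep a0[of 0] by simp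
  next
    case False
    then have t: "0 < t" using t by simp
    have "continuous_on {0..t} N" using N_cont lim0(2) t by (intro cont)
    then obtain s0 where s0: "\<forall>s\<in>{0..t}. N s \<le> N s0"
      using continuous_attains_sup[of "{0..t}" N] t by auto
    have N0: "0 \<le> N s" for s by (simp add: N_def)
    have "(\<lambda>n. (exp 0 * a n 0) * (t ^ n / fact n)) sums (exp t * a 0 t)"
    proof (rule taylor_chain_sums[where b="\<lambda>n s. exp s * a n s"])
      show "continuous_on {0..t} (\<lambda>s. exp s * a n s)" for n
      proof (intro continuous_intros cont t lim0)
        show "(a n \<longlongrightarrow> a n s) (at s)" if "0 < s" for s
          using DERIV_isCont[OF a_deriv[OF that]] by (simp add: isCont_def)
      qed
      show "((\<lambda>s. exp s * a n s) has_real_derivative exp s * a (Suc n) s) (at s)" if "0 < s" for n s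
        by (rule derivative_eq_intros a_deriv that refl | simp add: algebra_simps)+
      show "\<bar>exp s * a n s\<bar> \<le> exp t * N s0" if "0 \<le> s" "s \<le> t" for n s
      proof -
        have "\<bar>a n s\<bar> \<le> N s0" using a_le[of s n] s0 that by force
        then have "exp s * \<bar>a n s\<bar> \<le> exp t * N s0" using that N0 by (intro mult_mono) auto
        then show ?thesis by (simp add: abs_mult)
      qed
    qed (rule t)
    then show ?thesis by (simp add: a0 rep)
  qed
qed

lemma heat_content_sums:
  "0 \<le> t \<Longrightarrow> (\<lambda>n. mass n * (t ^ n / fact n)) sums (exp t * heat_content J D t)"
  unfolding heat_content_def
  by (rule heat_solution_integral) (rule someI_ex[OF heat_solution_exists])

end

section \<open>Borel kernel, centred ball and final comparison\<close>

lemma radially_nonincreasing_measurable: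
  fixes J :: "real^'n \<Rightarrow> real"
  assumes "radially_nonincreasing J"
  shows "J \<in> borel_measurable borel"
proof -
  obtain e :: "real^'n" where e: "norm e = 1" using vector_choose_size[of 1] by auto
  \<comment> \<open>Up to sign, \<open>h\<close> is the radial profile of \<open>J\<close>. Cutting
    negative arguments off at 0 keeps it monotone on the whole line, hence Borel, so that
    \<open>J\<close> fits the locale \<open>conv_kernel\<close>.\<close>
  define h where "h r = - J (max r 0 *\<^sub>R e)" for r
  have "mono h"
    using assms e by (intro monoI) (auto simp: h_def radially_nonincreasing_def)
  then have [measurable]: "h \<in> borel_measurable borel" by (rule borel_measurable_mono)
  have "J x = - h (norm x)" for x
    using assms e unfolding h_def radially_nonincreasing_def by (simp add: antisym)
  then have "J = (\<lambda>x. - h (norm x))" by (rule ext)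
  then show ?thesis by simp
qed

text \<open>The volume of a ball is a positive multiple of a power of its radius, hence injective on
  nonnegative radii; this makes the definite description in \<open>sym_ball\<close> meaningful. For
  \<open>m = 0\<close> the radius is 0 and the open ball is empty.\<close>

lemma sym_ball_eq:
  fixes D :: "(real^'n) set"
  assumes "emeasure lebesgue D = ennreal m" "0 \<le> m"
  obtains r where "sym_ball D = ball 0 r" "0 \<le> r" "measure lborel (ball (0::real^'n) r) = m"
proof -
  let ?d = "DIM(real^'n)"
  define V where "V = unit_ball_vol (real ?d)"
  have V: "0 < V" by (simp add: V_def)
  define r where "r = root ?d (m / V)"
  have d: "0 < ?d" by (rule DIM_positive)
  have r: "0 \<le> r" using V assms(2) d by (simp add: r_def)
  have rV: "V * r ^ ?d = m" using V assms(2) d by (simp add: r_def del: DIM_cart)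
  have ball: "emeasure lebesgue (ball (0::real^'n) s) = ennreal (V * s ^ ?d)" if "0 \<le> s" for s
    using emeasure_ball[OF that, of "0::real^'n"] by (simp add: V_def)
  have "(THE s. 0 \<le> s \<and> emeasure lebesgue (ball (0::real^'n) s) = emeasure lebesgue D) = r"
  proof (rule the_equality)
    show "0 \<le> r \<and> emeasure lebesgue (ball (0::real^'n) r) = emeasure lebesgue D"
      using r rV ball assms(1) by metis
    fix s assume s: "0 \<le> s \<and> emeasure lebesgue (ball (0::real^'n) s) = emeasure lebesgue D"
    then have "ennreal (V * s ^ ?d) = ennreal (V * r ^ ?d)" using ball[of s] assms(1) rV by simp
    then have "V * s ^ ?d = V * r ^ ?d" using s r V by (subst (asm) ennreal_inj) auto
    then have "s ^ ?d = r ^ ?d" using V by simp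
    then show "s = r" using s r d power_eq_imp_eq_base by metis
  qed
  then have "sym_ball D = ball 0 r" by (simp add: sym_ball_def)
  moreover have "measure lborel (ball (0::real^'n) r) = m"
    using ball[OF r] rV assms(2) by (simp add: measure_def)
  ultimately show ?thesis using that r by blast
qed

theorem theorem4p2:
  fixes J :: "real^'n \<Rightarrow> real" and \<Omega> :: "(real^'n) set"
  assumes "J \<in> borel_measurable lebesgue"
    and "\<And>x. 0 \<le> J x"
    and "radially_symmetric J"
    and "has_bochner_integral lebesgue J 1"
    and "radially_nonincreasing J"
    and "\<Omega> \<in> sets lebesgue"
    and "bounded \<Omega>"
  shows "(\<forall>t\<ge>0. heat_content J \<Omega> t \<le> heat_content J (sym_ball \<Omega>) t) \<and>
         torsional_rigidity J \<Omega> \<le> torsional_rigidity J (sym_ball \<Omega>) \<and>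
         (\<forall>j\<ge>1. exit_moment j J \<Omega> \<le> exit_moment j J (sym_ball \<Omega>))"
proof -
  have Jm: "J \<in> borel_measurable borel" using assms(5) by (rule radially_nonincreasing_measurable)
  interpret radial_kernel J
  proof
    show "J (- x) = J x" for x using assms(3) norm_minus_cancel unfolding radially_symmetric_def by blast
    show "norm x \<le> norm y \<Longrightarrow> J y \<le> J x" for x y using assms(5) by (simp add: radially_nonincreasing_def)
    show "integrable lborel J" "(\<integral>x. J x \<partial>lborel) = 1"
      using assms(4) Jm by (simp_all add: has_bochner_integral_iff integrable_completion integral_completion)
  qed (use Jm assms(2) in auto)
  \<comment> \<open>A Lebesgue measurable set is a Borel set together with part of a null set; the
    Borel part serves as the set \<open>B\<close> of \<open>kernel_domain\<close>.\<close>
  obtain B N N' where B: "\<Omega> = B \<union> N" "N \<subseteq> N'" "N' \<in> null_sets lborel" "B \<in> sets lborel"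
    using assms(6) by (rule sets_completionE)
  have AE: "AE x in lborel. x \<in> \<Omega> \<longrightarrow> x \<in> B"
    using AE_not_in[OF B(3)] by eventually_elim (use B in auto)
  interpret \<Omega>: kernel_domain J \<Omega> B
  proof
    show "B \<in> sets borel" using B(4) by simp
    show "B \<subseteq> \<Omega>" using B(1) by blast
  qed (fact assms AE)+
  have bB: "bounded B" using assms(7) \<Omega>.B_subset by (rule bounded_subset)
  have "emeasure lebesgue \<Omega> = emeasure lebesgue B"
  proof (rule emeasure_eq_AE)
    have "AE x in lborel. x \<in> \<Omega> \<longleftrightarrow> x \<in> B" using AE by eventually_elim (use \<Omega>.B_subset in blast)
    then show "AE x in lebesgue. x \<in> \<Omega> \<longleftrightarrow> x \<in> B" by (rule AE_completion)
    show "B \<in> sets lebesgue" using B(4) by (rule sets_completionI_sets)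
  qed (rule assms(6))
  also have "\<dots> = ennreal (measure lborel B)"
    using emeasure_bounded_finite[OF bB] B(4) by (simp add: emeasure_eq_ennreal_measure less_top)
  finally obtain r where r: "sym_ball \<Omega> = ball 0 r" "measure lborel (ball (0::real^'n) r) = measure lborel B"
    by (rule sym_ball_eq) auto
  interpret ball: kernel_domain J "ball 0 r" "ball 0 r"
    by unfold_locales auto
  have mass: "\<Omega>.mass n \<le> ball.mass n" for n
    using B(4) bB r(2) by (intro path_mass_le_ball) auto
  have heat: "heat_content J \<Omega> t \<le> heat_content J (sym_ball \<Omega>) t" if t: "0 \<le> t" for t
  proof -
    \<comment> \<open>Both sides are power series in t with the path masses over factorials as
      coefficients, so termwise comparison suffices.\<close>
    have "exp t * heat_content J \<Omega> t \<le> exp t * heat_content J (ball 0 r) t"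
      using t by (intro sums_le[OF _ \<Omega>.heat_content_sums[OF t] ball.heat_content_sums[OF t]] mult_right_mono mass) auto
    then show ?thesis by (simp add: r)
  qed
  moreover have "torsional_rigidity J \<Omega> \<le> torsional_rigidity J (sym_ball \<Omega>)"
    unfolding r(1) by (rule sums_le[OF mass \<Omega>.torsional_rigidity_sums ball.torsional_rigidity_sums])
  \<comment> \<open>Only times t \<ge> 0 enter the integral, where the heat contents are compared
    and the weight \<open>t ^ (j - 1)\<close> is nonnegative.\<close>
  moreover have "exit_moment j J \<Omega> \<le> exit_moment j J (sym_ball \<Omega>)" for j
    unfolding exit_moment_def
    by (intro mult_left_mono nn_integral_mono)
       (auto simp: indicator_def intro!: ennreal_leI mult_left_mono heat)
  ultimately show ?thesis by blast
qed

end
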